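(* Let $\mathcal{K} = (K, \le_{\mathcal{K}})$ be an abstract elementary class (AEC). The following are equivalent: (1) $\mathcal{K}$ has intersections. (2) There is a functorial expansion $\mathcal{K}^+$ of $\mathcal{K}$ with countably many relation symbols of finite arity (that is, $\tau(\mathcal{K}^+)$ is obtained from $\tau(\mathcal{K})$ by adding countably many such symbols) and a $\forall Q^{\text{struct}}$-theory $T$ in $\mathbb{L}^{\operatorname{LS}(\mathcal{K})^+\text{-struct}}_{\infty,\omega}(\tau(\mathcal{K}^+))$ such that $\mathcal{K}^+ = \operatorname{Mod}_{\mathcal{F}}(T)$, where $\mathcal{F}$ is the smallest fragment containing $T$.
   Context: Structures: vocabularies are finitary; structures are allowed to have empty universe (when the vocabulary has no constant symbols). $|M|$ is the universe of $M$ and $\|M\|$ its cardinality. AEC: an abstract elementary class is a pair $\mathcal{K}=(K,\le_{\mathcal{K}})$ such that: (1) $K$ is a class of structures in a fixed vocabulary $\tau(\mathcal{K})$, $\le_{\mathcal{K}}$ is a partial order on $K$, $M\le_{\mathcal{K}} N$ implies $M\subseteq N$ (substructure), and $K$ and $\le_{\mathcal{K}}$ are closed under isomorphisms; (2) coherence: if $M_0,M_1,M_2\in K$, $M_0\subseteq M_1\le_{\mathcal{K}} M_2$ and $M_0\le_{\mathcal{K}} M_2$, then $M_0\le_{\mathcal{K}} M_1$; (3) Tarski–Vaught chain axioms: if $\delta$ is a limit ordinal, $\langle M_i:i<\delta\rangle$ is $\le_{\mathcal{K}}$-increasing and $M=\bigcup_{i<\delta}M_i$, then $M\in K$, $M_0\le_{\mathcal{K}}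 M$, and if $N\in K$ satisfies $M_i\le_{\mathcal{K}} N$ for all $i<\delta$ then $M\le_{\mathcal{K}} N$; (4) Löwenheim–Skolem–Tarski axiom: there is a cardinal $\lambda\ge|\tau(\mathcal{K})|+\aleph_0$ such that for every $N\in K$ and $A\subseteq|N|$ there is $M\in K$ with $A\subseteq|M|$, $M\le_{\mathcal{K}} N$ and $\|M\|\le|A|+\lambda$. The least such $\lambda$ is $\operatorname{LS}(\mathcal{K})$, the Löwenheim–Skolem–Tarski number. Intersections: for $N\in K$ and $A\subseteq|N|$, $c\ell^N(A)$ is the intersection of all (universes of) $N_0\le_{\mathcal{K}} N$ with $A\subseteq|N_0|$; it is also viewed as the $\tau(\mathcal{K})$-substructure of $N$ with that universe. $\mathcal{K}$ has intersections if $c\ell^N(A)\le_{\mathcal{K}} N$ for all $N\in K$ and $A\subseteq|N|$. Functorial expansion: a functorial expansion of an AEC $\mathcal{K}$ is a class $K^+$ of structures in a vocabulary $\tau(K^+)\supseteq\tau(\mathcal{K})$ (finitary) such that the reduct map $M\mapsto M\restriction\tau(\mathcal{K})$ is a structure-preserving bijection from $K^+$ onto $K$: any isomorphism between two members of $K$ is also an isomorphism between their expansions in $K^+$, and if $M\le_{\mathcal{K}} N$ then the expansion of $M$ is a substructure of the expansion of $N$. One sets $\mathcal{K}^+=(K^+,\le_{\mathcal{K}^+})$ where $M\le_{\mathcal{K}^+}N$ iff $M\restriction\tau(\mathcal{K})\le_{\mathcal{K}} N\restriction\tau(\mathcal{K})$; $\mathcal{K}^+$ is also called a functorial expansion of $\mathcal{K}$.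 Structural logic: let $\tau$ be a vocabulary and $\kappa$ an infinite cardinal. $\mathbb{L}^{\kappa\text{-struct}}_{\infty,\omega}(\tau)$ is $\mathbb{L}_{\infty,\omega}(\tau)$ (set-sized conjunctions and disjunctions, finite quantifier strings, finitely many free variables) closed additionally under the following: if $n<\omega$, $\phi(x,\mathbf{z})$ and $\psi_i(y_i,\mathbf{z})$ ($i<n$) are formulas, $\tau_0\subseteq\tau$ is a sub-vocabulary, $M$ is a $\tau_0$-structure whose universe is an ordinal $<\kappa$, and $\mathbf{A}=\langle A_i:i<n\rangle$ are subsets of $|M|$, then, writing $\mathbf{y}=\langle y_i:i<n\rangle$, $Q^{\text{struct}}_{M,\mathbf{A}}\,x\,\mathbf{y}\,\phi(x,\mathbf{z})\langle\psi_i(y_i,\mathbf{z}):i<n\rangle$ is a formula. Its satisfaction: $N\models Q^{\text{struct}}_{M,\mathbf{A}}\,x\,\mathbf{y}\,\phi(x,\mathbf{b})\langle\psi_i(y_i,\mathbf{b}):i<n\rangle$ iff (i) $N\models\forall x(\psi_i(x,\mathbf{b})\to\phi(x,\mathbf{b}))$ for all $i<n$, and (ii) there is a $\tau_0$-substructure $N_0$ of $N$ with universe $\phi(N,\mathbf{b})$ and an isomorphism $f$ from $N_0$ onto $M$ with $f[\psi_i(N,\mathbf{b})]=A_i$ for all $i<n$. A $\forall Q^{\text{struct}}$-sentence is a sentence of the form $\forall\mathbf{z}\bigvee_{(M,\mathbf{A})\in S}Q^{\text{struct}}_{M,\mathbf{A}}\,x\,\mathbf{y}\,\phi(x,\mathbf{z})\langle\psi_i(y_i,\mathbf{z}):i<n\rangle$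 with $\phi$ and the $\psi_i$ quantifier-free and $S$ a non-empty set. A $\forall Q^{\text{struct}}$-theory is a theory consisting exclusively of $\forall Q^{\text{struct}}$-sentences. Fragments and ordering: a fragment $\mathcal{F}$ is a set of formulas closed under subformulas and containing all atomic formulas (closure under finitary operations is not required). For $\tau$-structures $N_1\subseteq N_2$ and a fragment $\mathcal{F}\subseteq\mathbb{L}^{\kappa\text{-struct}}_{\infty,\omega}(\tau)$, $N_1\preceq_{\mathcal{F}}N_2$ means $N_1\models\phi(\mathbf{a})\iff N_2\models\phi(\mathbf{a})$ for all $\phi\in\mathcal{F}$ and $\mathbf{a}\in N_1$. $N_1\preceq^*_{\mathcal{F}}N_2$ means: $N_1\preceq_{\mathcal{F}}N_2$, and for every formula $Q^{\text{struct}}_{M,\mathbf{A}}\,x\,\mathbf{y}\,\phi(x,\mathbf{z})\langle\psi_i(y_i,\mathbf{z}):i<n\rangle$ in $\mathcal{F}$ and every $\mathbf{b}\in N_1$, if $|\phi(N_1,\mathbf{b})|<\kappa$ then $\phi(N_1,\mathbf{b})=\phi(N_2,\mathbf{b})$ and $\psi_i(N_1,\mathbf{b})=\psi_i(N_2,\mathbf{b})$ for all $i<n$. For a theory $T\subseteq\mathcal{F}$, $\operatorname{Mod}_{\mathcal{F}}(T)$ is the pair $(\operatorname{Mod}(T),\preceq^*_{\mathcal{F}})$. *)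

theory Defs
  imports "HOL-Library.Countable_Set"
begin

unbundle cardinal_syntax

text \<open>
  A type \<open>'u\<close> plays the role of the universe of all sets: "sets" are the subsets of \<open>'u\<close> of
  cardinality less than that of \<open>'u\<close>, and "classes" are arbitrary HOL sets over \<open>'u\<close>.
  A second type \<open>'i\<close> supplies the index sets of the infinitary conjunctions and disjunctions.
  For \<open>'i = 'u\<close>, the predicate \<open>set_universe\<close> says precisely that the cardinality of \<open>'u\<close> is
  strongly inaccessible, i.e. that one works inside a Grothendieck universe. Having two types
  includes this case, but keeps the hypothesis satisfiable in plain HOL (e.g. take for \<open>'u\<close> a type
  of cardinality \<open>\<aleph>\<^sub>1\<close>, and for \<open>'i\<close> the type \<open>'u set set\<close>).
\<close>

abbreviation small :: "'a set \<Rightarrow> bool" where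
  "small A \<equiv> |A| <o |UNIV :: 'a set|"

definition set_universe :: "'u itself \<Rightarrow> 'i itself \<Rightarrow> bool" where
  "set_universe (_ :: 'u itself) (_ :: 'i itself) \<longleftrightarrow>
     natLeq <o |UNIV :: 'u set| \<and>
     regularCard |UNIV :: 'u set| \<and>
     (\<forall>A :: 'u set. small A \<longrightarrow> |Pow A| <o |UNIV :: 'i set| )"

text \<open>
  \<open>|UNIV :: 'u set|\<close> is a well-order of \<open>'u\<close> all of whose proper initial segments are small.
  Hence its elements serve as the ordinals; \<open>ords a\<close> is the (von Neumann style) set of ordinals
  below the ordinal \<open>a\<close>.
\<close>

definition ords :: "'u \<Rightarrow> 'u set" where
  "ords a = underS |UNIV :: 'u set| a"

definition is_limit :: "'u \<Rightarrow> bool" where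
  "is_limit d \<longleftrightarrow> ords d \<noteq> {} \<and> (\<forall>i\<in>ords d. \<exists>j\<in>ords d. i \<in> ords j)"

definition is_cardinal :: "'u \<Rightarrow> bool" where
  "is_cardinal l \<longleftrightarrow> (\<forall>i\<in>ords l. |ords i| <o |ords l| )"

text \<open>Symbols are given by a name and an arity; a vocabulary is a small set of symbols.\<close>

datatype 'u symbol = FunSym 'u nat | RelSym 'u nat

definition vocabulary :: "'u symbol set \<Rightarrow> bool" where
  "vocabulary \<tau> \<longleftrightarrow> |\<tau>| <o |UNIV :: 'u set|"

text \<open>
  \<open>fun_int M f xs\<close> is the value at \<open>xs\<close> of the interpretation of \<open>FunSym f (length xs)\<close>, and
  similarly for relations. Interpretations carry a fixed dummy value wherever they are
  not meaningful, so that equality of \<open>\<tau>\<close>-structures is HOL equality.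
\<close>

record 'u struc =
  univ :: "'u set"
  fun_int :: "'u \<Rightarrow> 'u list \<Rightarrow> 'u"
  rel_int :: "'u \<Rightarrow> 'u list \<Rightarrow> bool"

definition is_struct :: "'u symbol set \<Rightarrow> 'u struc \<Rightarrow> bool" where
  "is_struct \<tau> M \<longleftrightarrow>
     small (univ M) \<and>
     (\<forall>f xs. if FunSym f (length xs) \<in> \<tau> \<and> set xs \<subseteq> univ M
             then fun_int M f xs \<in> univ M else fun_int M f xs = undefined) \<and>
     (\<forall>r xs. rel_int M r xs \<longrightarrow> RelSym r (length xs) \<in> \<tau> \<and> set xs \<subseteq> univ M)"

definition reduct :: "'u symbol set \<Rightarrow> 'u struc \<Rightarrow> 'u struc" where
  "reduct \<tau> M = \<lparr>univ = univ M,
     fun_int = (\<lambda>f xs. if FunSym f (length xs) \<in> \<tau> then fun_int M f xs else undefined),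
     rel_int = (\<lambda>r xs. RelSym r (length xs) \<in> \<tau> \<and> rel_int M r xs)\<rparr>"

definition restr :: "'u set \<Rightarrow> 'u struc \<Rightarrow> 'u struc" where
  "restr U M = \<lparr>univ = U,
     fun_int = (\<lambda>f xs. if set xs \<subseteq> U then fun_int M f xs else undefined),
     rel_int = (\<lambda>r xs. set xs \<subseteq> U \<and> rel_int M r xs)\<rparr>"

definition substruct :: "'u symbol set \<Rightarrow> 'u struc \<Rightarrow> 'u struc \<Rightarrow> bool" where
  "substruct \<tau> M N \<longleftrightarrow>
     is_struct \<tau> M \<and> is_struct \<tau> N \<and> univ M \<subseteq> univ N \<and>
     (\<forall>f xs. FunSym f (length xs) \<in> \<tau> \<and> set xs \<subseteq> univ M \<longrightarrow> fun_int M f xs = fun_int N f xs) \<and>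
     (\<forall>r xs. RelSym r (length xs) \<in> \<tau> \<and> set xs \<subseteq> univ M \<longrightarrow> rel_int M r xs = rel_int N r xs)"

definition iso :: "'u symbol set \<Rightarrow> ('u \<Rightarrow> 'u) \<Rightarrow> 'u struc \<Rightarrow> 'u struc \<Rightarrow> bool" where
  "iso \<tau> g M N \<longleftrightarrow>
     is_struct \<tau> M \<and> is_struct \<tau> N \<and> bij_betw g (univ M) (univ N) \<and>
     (\<forall>f xs. FunSym f (length xs) \<in> \<tau> \<and> set xs \<subseteq> univ M \<longrightarrow>
        g (fun_int M f xs) = fun_int N f (map g xs)) \<and>
     (\<forall>r xs. RelSym r (length xs) \<in> \<tau> \<and> set xs \<subseteq> univ M \<longrightarrow>
        rel_int M r xs = rel_int N r (map g xs))"

text \<open>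
  The union of the chain \<open>\<langle>Ms i : i \<in> I\<rangle>\<close>: the unique structure on the union of the universes
  that extends every \<open>Ms i\<close> (it exists for small \<open>I\<close>, as the cardinality of \<open>'u\<close> is regular).
\<close>

definition is_chain_union ::
    "'u symbol set \<Rightarrow> 'u set \<Rightarrow> ('u \<Rightarrow> 'u struc) \<Rightarrow> 'u struc \<Rightarrow> bool" where
  "is_chain_union \<tau> I Ms M \<longleftrightarrow>
     is_struct \<tau> M \<and> univ M = (\<Union>i\<in>I. univ (Ms i)) \<and> (\<forall>i\<in>I. substruct \<tau> (Ms i) M)"

record 'u aclass =
  voc :: "'u symbol set"
  models :: "'u struc set"
  strong :: "'u struc rel"

definition increasing_chain :: "'u aclass \<Rightarrow> 'u \<Rightarrow> ('u \<Rightarrow> 'u struc) \<Rightarrow> bool" where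
  "increasing_chain \<K> d Ms \<longleftrightarrow>
     (\<forall>i\<in>ords d. Ms i \<in> models \<K>) \<and>
     (\<forall>j\<in>ords d. \<forall>i\<in>ords j. (Ms i, Ms j) \<in> strong \<K>)"

definition LST_cardinal :: "'u aclass \<Rightarrow> 'u \<Rightarrow> bool" where
  "LST_cardinal \<K> l \<longleftrightarrow>
     is_cardinal l \<and> |voc \<K>| +c natLeq \<le>o |ords l| \<and>
     (\<forall>N\<in>models \<K>. \<forall>A. A \<subseteq> univ N \<longrightarrow>
        (\<exists>M\<in>models \<K>. A \<subseteq> univ M \<and> (M, N) \<in> strong \<K> \<and> |univ M| \<le>o |A| +c |ords l| ))"

definition AEC :: "'u aclass \<Rightarrow> bool" where
  "AEC \<K> \<longleftrightarrow>
     vocabulary (voc \<K>) \<and>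
     (\<forall>M\<in>models \<K>. is_struct (voc \<K>) M) \<and>
     partial_order_on (models \<K>) (strong \<K>) \<and>
     (\<forall>M N. (M, N) \<in> strong \<K> \<longrightarrow> substruct (voc \<K>) M N) \<and>
     (\<forall>M N g. M \<in> models \<K> \<and> iso (voc \<K>) g M N \<longrightarrow> N \<in> models \<K>) \<and>
     (\<forall>M1 M2 N1 N2 g. (M1, M2) \<in> strong \<K> \<and> iso (voc \<K>) g M2 N2 \<and>
        univ N1 = g ` univ M1 \<and> iso (voc \<K>) g M1 N1 \<longrightarrow> (N1, N2) \<in> strong \<K>) \<and>
     (\<forall>M0 M1 M2. M0 \<in> models \<K> \<and> substruct (voc \<K>) M0 M1 \<and>
        (M1, M2) \<in> strong \<K> \<and> (M0, M2) \<in> strong \<K> \<longrightarrow> (M0, M1) \<in> strong \<K>) \<and>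
     (\<forall>d Ms M. is_limit d \<and> increasing_chain \<K> d Ms \<and> is_chain_union (voc \<K>) (ords d) Ms M \<longrightarrow>
        M \<in> models \<K> \<and>
        (\<forall>z\<in>ords d. ords z = {} \<longrightarrow> (Ms z, M) \<in> strong \<K>) \<and>
        (\<forall>N\<in>models \<K>. (\<forall>i\<in>ords d. (Ms i, N) \<in> strong \<K>) \<longrightarrow> (M, N) \<in> strong \<K>)) \<and>
     (\<exists>l. LST_cardinal \<K> l)"

definition LS :: "'u aclass \<Rightarrow> 'u" where
  "LS \<K> = (THE l. LST_cardinal \<K> l \<and> (\<forall>l'. LST_cardinal \<K> l' \<longrightarrow> ords l \<subseteq> ords l'))"

definition closure_in :: "'u aclass \<Rightarrow> 'u struc \<Rightarrow> 'u set \<Rightarrow> 'u set" where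
  "closure_in \<K> N A = \<Inter>{univ N0 | N0. (N0, N) \<in> strong \<K> \<and> A \<subseteq> univ N0}"

definition has_intersections :: "'u aclass \<Rightarrow> bool" where
  "has_intersections \<K> \<longleftrightarrow>
     (\<forall>N\<in>models \<K>. \<forall>A. A \<subseteq> univ N \<longrightarrow> (restr (closure_in \<K> N A) N, N) \<in> strong \<K>)"

text \<open>A functorial expansion is given by its vocabulary \<open>\<tau>'\<close> and its class \<open>Kp\<close> of structures.\<close>

definition functorial_expansion :: "'u aclass \<Rightarrow> 'u symbol set \<Rightarrow> 'u struc set \<Rightarrow> bool" where
  "functorial_expansion \<K> \<tau>' Kp \<longleftrightarrow>
     vocabulary \<tau>' \<and> voc \<K> \<subseteq> \<tau>' \<and>
     (\<forall>M\<in>Kp. is_struct \<tau>' M) \<and>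
     bij_betw (reduct (voc \<K>)) Kp (models \<K>) \<and>
     (\<forall>M\<in>Kp. \<forall>N\<in>Kp. \<forall>g. iso (voc \<K>) g (reduct (voc \<K>) M) (reduct (voc \<K>) N) \<longrightarrow> iso \<tau>' g M N) \<and>
     (\<forall>M\<in>Kp. \<forall>N\<in>Kp. (reduct (voc \<K>) M, reduct (voc \<K>) N) \<in> strong \<K> \<longrightarrow> substruct \<tau>' M N)"

definition expansion_class :: "'u aclass \<Rightarrow> 'u symbol set \<Rightarrow> 'u struc set \<Rightarrow> 'u aclass" where
  "expansion_class \<K> \<tau>' Kp = \<lparr>voc = \<tau>', models = Kp,
     strong = {(M, N). M \<in> Kp \<and> N \<in> Kp \<and> (reduct (voc \<K>) M, reduct (voc \<K>) N) \<in> strong \<K>}\<rparr>"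

datatype 'u tm = Var nat | App 'u "'u tm list"

text \<open>
  \<open>Conj I F\<close> is the conjunction of the formulas \<open>F i\<close> with \<open>i \<in> I\<close>; likewise \<open>Disj\<close>.
  \<open>QStruct \<tau>\<^sub>0 M As x \<phi> ys \<psi>s\<close> is the structural quantifier for the \<open>\<tau>\<^sub>0\<close>-structure \<open>M\<close> with the
  distinguished subsets \<open>As\<close>; it binds \<open>x\<close> in \<open>\<phi>\<close> and, separately for each \<open>k\<close>, the variable
  \<open>ys ! k\<close> in \<open>\<psi>s ! k\<close>. All other free variables of \<open>\<phi>\<close> and of the \<open>\<psi>s ! k\<close> are parameters.
\<close>

datatype ('u, 'i) fm =
    Eq "'u tm" "'u tm"
  | Rel 'u "'u tm list"
  | Neg "('u, 'i) fm"
  | Conj "'i set" "'i \<Rightarrow> ('u, 'i) fm"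
  | Disj "'i set" "'i \<Rightarrow> ('u, 'i) fm"
  | Ex nat "('u, 'i) fm"
  | All nat "('u, 'i) fm"
  | QStruct "'u symbol set" "'u struc" "'u set list" nat "('u, 'i) fm" "nat list" "('u, 'i) fm list"

primrec tm_vars :: "'u tm \<Rightarrow> nat set" where
  "tm_vars (Var x) = {x}"
| "tm_vars (App f ts) = \<Union>(set (map tm_vars ts))"

primrec free_vars :: "('u, 'i) fm \<Rightarrow> nat set" where
  "free_vars (Eq s t) = tm_vars s \<union> tm_vars t"
| "free_vars (Rel r ts) = (\<Union>t\<in>set ts. tm_vars t)"
| "free_vars (Neg \<phi>) = free_vars \<phi>"
| "free_vars (Conj I F) = (\<Union>i\<in>I. free_vars (F i))"
| "free_vars (Disj I F) = (\<Union>i\<in>I. free_vars (F i))"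
| "free_vars (Ex x \<phi>) = free_vars \<phi> - {x}"
| "free_vars (All x \<phi>) = free_vars \<phi> - {x}"
| "free_vars (QStruct \<tau>\<^sub>0 M As x \<phi> ys \<psi>s) =
     (free_vars \<phi> - {x}) \<union> (\<Union>(y, V)\<in>set (zip ys (map free_vars \<psi>s)). V - {y})"

inductive_set terms :: "'u symbol set \<Rightarrow> 'u tm set" for \<tau> where
  "Var x \<in> terms \<tau>"
| "\<lbrakk>FunSym f (length ts) \<in> \<tau>; \<And>t. t \<in> set ts \<Longrightarrow> t \<in> terms \<tau>\<rbrakk> \<Longrightarrow> App f ts \<in> terms \<tau>"

definition atomic_formulas :: "'u symbol set \<Rightarrow> ('u, 'i) fm set" where
  "atomic_formulas \<tau> =
     {Eq s t | s t. s \<in> terms \<tau> \<and> t \<in> terms \<tau>} \<union>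
     {Rel r ts | r ts. RelSym r (length ts) \<in> \<tau> \<and> set ts \<subseteq> terms \<tau>}"

text \<open>
  The formulas of the \<open>\<kappa>\<close>-structural logic over \<open>\<tau>\<close>, with \<open>\<kappa>\<close> a cardinal in the sense of the library.
  That the ordinal \<open>a\<close> is below \<open>\<kappa>\<close> is expressed as \<open>|ords a| <o \<kappa>\<close>.
\<close>

inductive_set formulas :: "'u symbol set \<Rightarrow> 'k rel \<Rightarrow> ('u, 'i) fm set" for \<tau> \<kappa> where
  "\<phi> \<in> atomic_formulas \<tau> \<Longrightarrow> \<phi> \<in> formulas \<tau> \<kappa>"
| "\<phi> \<in> formulas \<tau> \<kappa> \<Longrightarrow> Neg \<phi> \<in> formulas \<tau> \<kappa>"
| "\<lbrakk>small I; \<And>i. i \<in> I \<Longrightarrow> F i \<in> formulas \<tau> \<kappa>; finite (\<Union>i\<in>I. free_vars (F i))\<rbrakk>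
     \<Longrightarrow> Conj I F \<in> formulas \<tau> \<kappa>"
| "\<lbrakk>small I; \<And>i. i \<in> I \<Longrightarrow> F i \<in> formulas \<tau> \<kappa>; finite (\<Union>i\<in>I. free_vars (F i))\<rbrakk>
     \<Longrightarrow> Disj I F \<in> formulas \<tau> \<kappa>"
| "\<phi> \<in> formulas \<tau> \<kappa> \<Longrightarrow> Ex x \<phi> \<in> formulas \<tau> \<kappa>"
| "\<phi> \<in> formulas \<tau> \<kappa> \<Longrightarrow> All x \<phi> \<in> formulas \<tau> \<kappa>"
| "\<lbrakk>\<tau>\<^sub>0 \<subseteq> \<tau>; is_struct \<tau>\<^sub>0 M; univ M = ords a; |ords a| <o \<kappa>;
     \<And>A. A \<in> set As \<Longrightarrow> A \<subseteq> univ M;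
     length As = length \<psi>s; length ys = length \<psi>s;
     \<phi> \<in> formulas \<tau> \<kappa>; \<And>\<psi>. \<psi> \<in> set \<psi>s \<Longrightarrow> \<psi> \<in> formulas \<tau> \<kappa>\<rbrakk>
     \<Longrightarrow> QStruct \<tau>\<^sub>0 M As x \<phi> ys \<psi>s \<in> formulas \<tau> \<kappa>"

inductive quantifier_free :: "('u, 'i) fm \<Rightarrow> bool" where
  "quantifier_free (Eq s t)"
| "quantifier_free (Rel r ts)"
| "quantifier_free \<phi> \<Longrightarrow> quantifier_free (Neg \<phi>)"
| "(\<And>i. i \<in> I \<Longrightarrow> quantifier_free (F i)) \<Longrightarrow> quantifier_free (Conj I F)"
| "(\<And>i. i \<in> I \<Longrightarrow> quantifier_free (F i)) \<Longrightarrow> quantifier_free (Disj I F)"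

primrec tm_val :: "'u struc \<Rightarrow> (nat \<Rightarrow> 'u) \<Rightarrow> 'u tm \<Rightarrow> 'u" where
  "tm_val N v (Var x) = v x"
| "tm_val N v (App f ts) = fun_int N f (map (tm_val N v) ts)"

text \<open>
  The semantics of the structural quantifier in terms of the sets \<open>P\<close> and \<open>Ps\<close> defined in \<open>N\<close> by
  \<open>\<phi>\<close> and the \<open>\<psi>s\<close>.
\<close>

definition struct_quant ::
    "'u struc \<Rightarrow> 'u symbol set \<Rightarrow> 'u struc \<Rightarrow> 'u set list \<Rightarrow> 'u set \<Rightarrow> 'u set list \<Rightarrow> bool" where
  "struct_quant N \<tau>\<^sub>0 M As P Ps \<longleftrightarrow>
     (\<forall>k<length Ps. Ps ! k \<subseteq> P) \<and>
     (\<exists>N0 g. substruct \<tau>\<^sub>0 N0 (reduct \<tau>\<^sub>0 N) \<and> univ N0 = P \<and> iso \<tau>\<^sub>0 g N0 M \<and>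
        (\<forall>k<length Ps. g ` (Ps ! k) = As ! k))"

text \<open>
  Assignments are total functions, so the value of \<open>sat N \<phi> v\<close> is meaningful when \<open>v\<close> maps the free
  variables of \<open>\<phi>\<close> into the universe of \<open>N\<close>; in particular \<open>N\<close> may be empty.
\<close>

primrec sat :: "'u struc \<Rightarrow> ('u, 'i) fm \<Rightarrow> (nat \<Rightarrow> 'u) \<Rightarrow> bool" where
  "sat N (Eq s t) = (\<lambda>v. tm_val N v s = tm_val N v t)"
| "sat N (Rel r ts) = (\<lambda>v. rel_int N r (map (tm_val N v) ts))"
| "sat N (Neg \<phi>) = (\<lambda>v. \<not> sat N \<phi> v)"
| "sat N (Conj I F) = (\<lambda>v. \<forall>i\<in>I. sat N (F i) v)"
| "sat N (Disj I F) = (\<lambda>v. \<exists>i\<in>I. sat N (F i) v)"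
| "sat N (Ex x \<phi>) = (\<lambda>v. \<exists>a\<in>univ N. sat N \<phi> (v(x := a)))"
| "sat N (All x \<phi>) = (\<lambda>v. \<forall>a\<in>univ N. sat N \<phi> (v(x := a)))"
| "sat N (QStruct \<tau>\<^sub>0 M As x \<phi> ys \<psi>s) = (\<lambda>v.
     struct_quant N \<tau>\<^sub>0 M As {a \<in> univ N. sat N \<phi> (v(x := a))}
       (map (\<lambda>(y, S). {a \<in> univ N. S (v(y := a))}) (zip ys (map (sat N) \<psi>s))))"

definition def_set :: "'u struc \<Rightarrow> nat \<Rightarrow> ('u, 'i) fm \<Rightarrow> (nat \<Rightarrow> 'u) \<Rightarrow> 'u set" where
  "def_set N x \<phi> v = {a \<in> univ N. sat N \<phi> (v(x := a))}"

definition sentences :: "'u symbol set \<Rightarrow> 'k rel \<Rightarrow> ('u, 'i) fm set" where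
  "sentences \<tau> \<kappa> = {\<sigma> \<in> formulas \<tau> \<kappa>. free_vars \<sigma> = {}}"

text \<open>For sentences the assignment is irrelevant.\<close>

definition Mod :: "'u symbol set \<Rightarrow> ('u, 'i) fm set \<Rightarrow> 'u struc set" where
  "Mod \<tau> T = {N. is_struct \<tau> N \<and> (\<forall>\<sigma>\<in>T. \<forall>v. sat N \<sigma> v)}"

text \<open>
  A structure does not determine its vocabulary here, so the elements of the set \<open>S\<close> of pairs
  \<open>(M, \<^bold>A)\<close> also record the vocabulary \<open>\<tau>\<^sub>0\<close> of \<open>M\<close>.
\<close>

definition is_forall_Q :: "('u, 'i) fm \<Rightarrow> bool" where
  "is_forall_Q \<sigma> \<longleftrightarrow> (\<exists>zs I F S x \<phi> ys \<psi>s.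
     \<sigma> = foldr All zs (Disj I F) \<and>
     S \<noteq> {} \<and> F ` I = (\<lambda>(\<tau>\<^sub>0, M, As). QStruct \<tau>\<^sub>0 M As x \<phi> ys \<psi>s) ` S \<and>
     quantifier_free \<phi> \<and> (\<forall>\<psi>\<in>set \<psi>s. quantifier_free \<psi>))"

text \<open>A theory is a set, not a proper class, of sentences.\<close>

definition forall_Q_theory :: "'u symbol set \<Rightarrow> 'k rel \<Rightarrow> ('u, 'i) fm set \<Rightarrow> bool" where
  "forall_Q_theory \<tau> \<kappa> T \<longleftrightarrow>
     T \<subseteq> sentences \<tau> \<kappa> \<and> |T| <o |UNIV :: 'i set| \<and> (\<forall>\<sigma>\<in>T. is_forall_Q \<sigma>)"

primrec direct_subformulas :: "('u, 'i) fm \<Rightarrow> ('u, 'i) fm set" where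
  "direct_subformulas (Eq s t) = {}"
| "direct_subformulas (Rel r ts) = {}"
| "direct_subformulas (Neg \<phi>) = {\<phi>}"
| "direct_subformulas (Conj I F) = F ` I"
| "direct_subformulas (Disj I F) = F ` I"
| "direct_subformulas (Ex x \<phi>) = {\<phi>}"
| "direct_subformulas (All x \<phi>) = {\<phi>}"
| "direct_subformulas (QStruct \<tau>\<^sub>0 M As x \<phi> ys \<psi>s) = insert \<phi> (set \<psi>s)"

text \<open>
  No bound on the size of a fragment is imposed: for \<open>'i = 'u\<close>, the fragment generated by a
  set-sized theory is automatically set-sized.
\<close>

definition fragment :: "'u symbol set \<Rightarrow> 'k rel \<Rightarrow> ('u, 'i) fm set \<Rightarrow> bool" where
  "fragment \<tau> \<kappa> \<F> \<longleftrightarrow>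
     \<F> \<subseteq> formulas \<tau> \<kappa> \<and> atomic_formulas \<tau> \<subseteq> \<F> \<and> (\<forall>\<phi>\<in>\<F>. direct_subformulas \<phi> \<subseteq> \<F>)"

definition generated_fragment ::
    "'u symbol set \<Rightarrow> 'k rel \<Rightarrow> ('u, 'i) fm set \<Rightarrow> ('u, 'i) fm set" where
  "generated_fragment \<tau> \<kappa> T = \<Inter>{\<F>. fragment \<tau> \<kappa> \<F> \<and> T \<subseteq> \<F>}"

definition elem_sub :: "'u symbol set \<Rightarrow> ('u, 'i) fm set \<Rightarrow> 'u struc \<Rightarrow> 'u struc \<Rightarrow> bool" where
  "elem_sub \<tau> \<F> N1 N2 \<longleftrightarrow>
     substruct \<tau> N1 N2 \<and>
     (\<forall>\<phi>\<in>\<F>. \<forall>v. v ` free_vars \<phi> \<subseteq> univ N1 \<longrightarrow> sat N1 \<phi> v = sat N2 \<phi> v)"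

definition elem_sub_star ::
    "'u symbol set \<Rightarrow> 'k rel \<Rightarrow> ('u, 'i) fm set \<Rightarrow> 'u struc \<Rightarrow> 'u struc \<Rightarrow> bool" where
  "elem_sub_star \<tau> \<kappa> \<F> N1 N2 \<longleftrightarrow>
     elem_sub \<tau> \<F> N1 N2 \<and>
     (\<forall>\<tau>\<^sub>0 M As x \<phi> ys \<psi>s v.
        QStruct \<tau>\<^sub>0 M As x \<phi> ys \<psi>s \<in> \<F> \<and>
        v ` free_vars (QStruct \<tau>\<^sub>0 M As x \<phi> ys \<psi>s) \<subseteq> univ N1 \<and>
        |def_set N1 x \<phi> v| <o \<kappa> \<longrightarrow>
        def_set N1 x \<phi> v = def_set N2 x \<phi> v \<and>
        (\<forall>k<length \<psi>s. def_set N1 (ys ! k) (\<psi>s ! k) v = def_set N2 (ys ! k) (\<psi>s ! k) v))"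

definition Mod_class ::
    "'u symbol set \<Rightarrow> 'k rel \<Rightarrow> ('u, 'i) fm set \<Rightarrow> ('u, 'i) fm set \<Rightarrow> 'u aclass" where
  "Mod_class \<tau> \<kappa> \<F> T = \<lparr>voc = \<tau>, models = Mod \<tau> T,
     strong = {(N1, N2). N1 \<in> Mod \<tau> T \<and> N2 \<in> Mod \<tau> T \<and> elem_sub_star \<tau> \<kappa> \<F> N1 N2}\<rparr>"

end

theory Submission
  imports Defs
begin

text \<open>
  If the class is axiomatized by universal structural sentences, then for parameters \<open>b\<close> in all
  the strong submodels \<open>M\<close> of \<open>N\<close> under consideration, the quantifier-free sets \<open>\<phi>(M, b)\<close> have
  size less than \<open>\<kappa>\<close> and hence coincide with \<open>\<phi>(N, b)\<close>. So \<open>\<phi>(N, b)\<close> lies in the intersection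
  of these submodels, which therefore satisfies the axioms and is a strong submodel of \<open>N\<close>.

  Conversely, given intersections, expand by relations \<open>R(x, b)\<close> saying that \<open>x\<close> is in the closure
  of the finite tuple \<open>b\<close>, and let the axioms say that \<open>R(_, b)\<close> is, with \<open>b\<close> marked, isomorphic
  to a member of the expanded class generated by its marked elements; only a
  small set of isomorphism types is involved, as closures of finite tuples have size at most
  \<open>LS \<K>\<close>. In a model of the axioms the structures on the sets \<open>R(_, b)\<close> form a
  directed system of strong embeddings, and an abstract elementary class is closed under directed
  unions.
\<close>

section \<open>Ordinals and cardinals\<close>

text \<open>\<open>elem_sub_star\<close> compares the sets defined in the two models only where they
  are smaller than \<kappa>. A true disjunct matches such a set with a structure of size below
  \<kappa>, so between models of the theory the guard always holds, and a submodel is strong iff the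
  sets agree for all its parameters. The rest of the generated fragment adds nothing: besides
  quantifier-free formulas it has only the disjuncts and end segments of the axioms. Empty universes
  need care, since a quantified axiom is vacuous there while its matrix may fail.

  In the converse, \<kappa> is the successor of \<open>LS \<K>\<close> because the
  Loewenheim-Skolem-Tarski axiom bounds the closures of finite sets by \<open>LS \<K>\<close>.
  Closures are the same in a model and in its strong extensions, which makes the expansion
  functorial; and a model is the directed union of the closures of its finite subsets, so equality
  of these closures makes a submodel strong. A structure that merely satisfies the axioms offers no
  ambient model in which to form closures, so these are compared locally, inside its generated
  pieces.\<close>

lemma card_of_finite_infinite:
  assumes "finite B" "infinite A"
  shows "|B| \<le>o |A|"
proof -
  have "|B| <o natLeq" "natLeq \<le>o |A|"
    using assms finite_iff_ordLess_natLeq infinite_iff_natLeq_ordLeq by blast+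
  then show ?thesis by (rule ordLess_imp_ordLeq[OF ordLess_ordLeq_trans])
qed

lemma wo_rel_UNIV: "wo_rel |UNIV :: 'u set|"
  by (simp add: card_of_Well_order wo_rel_def)

lemma mem_ords_iff: "i \<in> ords j \<longleftrightarrow> i \<noteq> j \<and> (i, j) \<in> |UNIV :: 'u set|" for i j :: 'u
  by (simp add: ords_def underS_def)

lemma ords_linear: "i \<in> ords j \<or> i = j \<or> j \<in> ords i"
  using wo_rel.TOTALS[OF wo_rel_UNIV, rule_format, of i j] by (simp add: mem_ords_iff Field_card_of) blast

lemma ords_trans: "i \<in> ords j \<Longrightarrow> j \<in> ords k \<Longrightarrow> i \<in> ords k"
  unfolding mem_ords_iff
  using transD[OF wo_rel.TRANS[OF wo_rel_UNIV], of i j k]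
    antisymD[OF wo_rel.ANTISYM[OF wo_rel_UNIV], of i j] by blast

lemma ords_irrefl: "i \<notin> ords i"
  by (simp add: mem_ords_iff)

lemma ords_mono: "i \<in> ords j \<Longrightarrow> ords i \<subseteq> ords j"
  by (auto intro: ords_trans)

lemma ords_subset_iff: "ords i \<subseteq> ords j \<longleftrightarrow> i = j \<or> i \<in> ords j"
  using ords_linear[of i j] ords_mono[of i j] ords_irrefl[of j] by auto

lemma ords_inj: "ords i = ords j \<Longrightarrow> i = j"
  using ords_linear[of i j] ords_irrefl[of i] ords_irrefl[of j] by auto

lemma ords_induct [case_names less]:
  assumes "\<And>d. (\<And>i. i \<in> ords d \<Longrightarrow> P i) \<Longrightarrow> P d"
  shows "P (d :: 'u)"
proof -
  have "wf ( |UNIV :: 'u set| - Id)"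
    using wo_rel.WF[OF wo_rel_UNIV] .
  then show ?thesis
  proof (induction d rule: wf_induct_rule)
    case (less d)
    then show ?case using assms by (auto simp: mem_ords_iff)
  qed
qed

lemma small_ords: "small (ords a)"
  unfolding ords_def by (rule card_of_underS[OF card_of_Card_order]) (simp add: Field_card_of)

lemma finite_subset_ords_limit:
  assumes "is_limit d" "finite b" "b \<subseteq> ords d"
  shows "\<exists>i\<in>ords d. b \<subseteq> ords i"
  using assms(2,3)
proof (induction b rule: finite_induct)
  case empty
  then show ?case using assms(1) by (auto simp: is_limit_def)
next
  case (insert x b)
  then obtain i where i: "i \<in> ords d" "b \<subseteq> ords i" by auto
  obtain j where j: "j \<in> ords d" "x \<in> ords j"
    using assms(1) insert.prems by (auto simp: is_limit_def)
  show ?case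
    using ords_linear[of i j] i j ords_mono[of i j] ords_mono[of j i] ords_trans[of x j i] by auto
qed

text \<open>Regularity makes a small set non-cofinal. The bound supplied by the negation of
  \<open>cofinal\<close> may itself belong to the set, hence the \<open>insert\<close>.\<close>

lemma small_subset_insert_ords:
  fixes A :: "'u set"
  assumes "regularCard |UNIV :: 'u set|" "small A"
  shows "\<exists>d. A \<subseteq> insert d (ords d)"
proof -
  have "\<not> cofinal A |UNIV :: 'u set|"
    using assms not_ordLess_ordIso unfolding regularCard_def by (auto simp: Field_card_of)
  then obtain d where d: "\<forall>b\<in>A. d \<noteq> b \<longrightarrow> (d, b) \<notin> |UNIV :: 'u set|"
    by (auto simp: cofinal_def)
  have "A \<subseteq> insert d (ords d)"
  proof
    fix b assume "b \<in> A"
    then show "b \<in> insert d (ords d)"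
      using d ords_linear[of b d] by (auto simp: mem_ords_iff)
  qed
  then show ?thesis ..
qed

text \<open>The well-order of \<open>P\<close> of least type embeds onto an initial segment of
  \<open>ords l\<close>; an initial segment is some \<open>ords a\<close>, with \<open>a = l\<close>
  in the extreme case. This supplies the ordinal universes that the structural quantifier
  demands.\<close>

lemma ex_ords_bij:
  assumes "|P| \<le>o |ords l|"
  shows "\<exists>g a. bij_betw g P (ords a) \<and> ords a \<subseteq> ords (l :: 'u)"
proof -
  let ?r = "|UNIV :: 'u set|" and ?w = "Restr |UNIV :: 'u set| (ords l)"
  have Fw: "Field ?w = ords l"
    using Refl_Field_Restr2[of ?r "ords l"] wo_rel.REFL[OF wo_rel_UNIV]
    by (simp add: Field_card_of)
  have w: "Well_order ?w" by (simp add: Well_order_Restr card_of_Well_order)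
  then have "|ords l| \<le>o ?w" using card_of_least[of "ords l" ?w] Fw by simp
  then have "|P| \<le>o ?w" using assms ordLeq_transitive by blast
  then obtain g where g: "embed |P| ?w g" by (auto simp: ordLeq_def)
  have "inj_on g P" using embed_inj_on[OF card_of_Well_order g] by (simp add: Field_card_of)
  then have bij: "bij_betw g P (g ` P)" by (simp add: bij_betw_def)
  have "wo_rel.ofilter ?w (g ` P)"
    using embed_Field_ofilter[OF card_of_Well_order w g] by (simp add: Field_card_of)
  then consider a where "a \<in> ords l" "g ` P = underS ?w a" | "g ` P = ords l"
    using wo_rel.ofilter_underS_Field[of ?w] w Fw by (auto simp: wo_rel_def)
  then show ?thesis
  proof cases
    case 1
    have "x \<in> underS ?w a \<longleftrightarrow> x \<in> ords a \<and> x \<in> ords l \<and> a \<in> ords l" for x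
      by (auto simp: underS_def ords_def)
    then have "g ` P = ords a" using 1 ords_mono[OF 1(1)] by blast
    then have "bij_betw g P (ords a)" using bij by simp
    then show ?thesis using ords_mono[OF 1(1)] by blast
  next
    case 2
    with bij show ?thesis by auto
  qed
qed

section \<open>Structures\<close>

abbreviation fun_closed :: "'u symbol set \<Rightarrow> 'u struc \<Rightarrow> 'u set \<Rightarrow> bool" where
  "fun_closed \<tau> N U \<equiv>
     \<forall>f xs. FunSym f (length xs) \<in> \<tau> \<and> set xs \<subseteq> U \<longrightarrow> fun_int N f xs \<in> U"

lemma univ_restr [simp]: "univ (restr U N) = U"
  and fun_int_restr: "fun_int (restr U N) f xs = (if set xs \<subseteq> U then fun_int N f xs else undefined)"
  and rel_int_restr: "rel_int (restr U N) s xs \<longleftrightarrow> set xs \<subseteq> U \<and> rel_int N s xs"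
  and univ_reduct [simp]: "univ (reduct \<tau> N) = univ N"
  and fun_int_reduct: "fun_int (reduct \<tau> N) f xs =
    (if FunSym f (length xs) \<in> \<tau> then fun_int N f xs else undefined)"
  and rel_int_reduct: "rel_int (reduct \<tau> N) s xs \<longleftrightarrow> RelSym s (length xs) \<in> \<tau> \<and> rel_int N s xs"
  by (simp_all add: restr_def reduct_def)

lemma struc_eqI:
  fixes M N :: "'u struc"
  assumes "univ M = univ N" "\<And>f xs. fun_int M f xs = fun_int N f xs"
    "\<And>s xs. rel_int M s xs = rel_int N s xs"
  shows "M = N"
  using assms by (intro struc.equality ext) auto

lemma is_struct_small: "is_struct \<tau> M \<Longrightarrow> small (univ M)"
  by (simp add: is_struct_def)

lemma is_struct_fun:
  assumes "is_struct \<tau> M" "FunSym f (length xs) \<in> \<tau>" "set xs \<subseteq> univ M"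
  shows "fun_int M f xs \<in> univ M"
proof -
  have "if FunSym f (length xs) \<in> \<tau> \<and> set xs \<subseteq> univ M
    then fun_int M f xs \<in> univ M else fun_int M f xs = undefined"
    using assms(1) unfolding is_struct_def by blast
  then show ?thesis using assms by simp
qed

lemma is_struct_undefined:
  assumes "is_struct \<tau> M" "\<not> (FunSym f (length xs) \<in> \<tau> \<and> set xs \<subseteq> univ M)"
  shows "fun_int M f xs = undefined"
proof -
  have "if FunSym f (length xs) \<in> \<tau> \<and> set xs \<subseteq> univ M
    then fun_int M f xs \<in> univ M else fun_int M f xs = undefined"
    using assms(1) unfolding is_struct_def by blast
  then show ?thesis using assms(2) by presburger
qed

lemma is_struct_rel: "is_struct \<tau> M \<Longrightarrow> rel_int M s xs \<Longrightarrow>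
    RelSym s (length xs) \<in> \<tau> \<and> set xs \<subseteq> univ M"
  by (simp add: is_struct_def)

lemma is_struct_restr_iff:
  assumes "is_struct \<tau> N" "U \<subseteq> univ N"
  shows "is_struct \<tau> (restr U N) \<longleftrightarrow> fun_closed \<tau> N U"
proof
  assume *: "is_struct \<tau> (restr U N)"
  show "fun_closed \<tau> N U"
    using is_struct_fun[OF *] by (simp add: fun_int_restr)
next
  assume c: "fun_closed \<tau> N U"
  have "small U"
    using assms is_struct_small card_of_mono1 ordLeq_ordLess_trans by blast
  moreover have "fun_int N f xs = undefined" if "FunSym f (length xs) \<notin> \<tau>" for f xs
    using is_struct_undefined[OF assms(1)] that by blast
  ultimately show "is_struct \<tau> (restr U N)"
    using c is_struct_rel[OF assms(1)]
    by (simp add: is_struct_def fun_int_restr rel_int_restr)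
qed

lemma substruct_restr:
  assumes "is_struct \<tau> N" "U \<subseteq> univ N" "fun_closed \<tau> N U"
  shows "substruct \<tau> (restr U N) N"
  using assms is_struct_restr_iff[of \<tau> N U]
  by (simp add: substruct_def fun_int_restr rel_int_restr)

text \<open>Since the dummy values are prescribed, a substructure is literally a restriction. Strong
  submodels of \<open>N\<close> can therefore be handled through their universes alone.\<close>

lemma substruct_eq_restr:
  assumes "substruct \<tau> M N"
  shows "M = restr (univ M) N"
proof (rule struc_eqI)
  have M: "is_struct \<tau> M" and N: "is_struct \<tau> N" and s: "univ M \<subseteq> univ N"
    and f: "\<And>f xs. FunSym f (length xs) \<in> \<tau> \<Longrightarrow> set xs \<subseteq> univ M \<Longrightarrow> fun_int M f xs = fun_int N f xs"
    and r: "\<And>s xs. RelSym s (length xs) \<in> \<tau> \<Longrightarrow> set xs \<subseteq> univ M \<Longrightarrow> rel_int M s xs = rel_int N s xs"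
    using assms by (auto simp: substruct_def)
  show "fun_int M g xs = fun_int (restr (univ M) N) g xs" for g xs
    unfolding fun_int_restr using f is_struct_undefined[OF M] is_struct_undefined[OF N] by metis
  show "rel_int M g xs = rel_int (restr (univ M) N) g xs" for g xs
    unfolding rel_int_restr using r is_struct_rel[OF M] is_struct_rel[OF N] by metis
qed simp

lemma substruct_univ: "substruct \<tau> M N \<Longrightarrow> univ M \<subseteq> univ N"
  and substruct_struct1: "substruct \<tau> M N \<Longrightarrow> is_struct \<tau> M"
  and substruct_struct2: "substruct \<tau> M N \<Longrightarrow> is_struct \<tau> N"
  by (simp_all add: substruct_def)

lemma substruct_closed: "substruct \<tau> M N \<Longrightarrow> fun_closed \<tau> N (univ M)"
  using is_struct_fun[of \<tau> M] unfolding substruct_def by metis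

lemma substruct_rel: "substruct \<tau> M N \<Longrightarrow> set xs \<subseteq> univ M \<Longrightarrow> rel_int M s xs = rel_int N s xs"
  using substruct_eq_restr rel_int_restr by metis

lemma restr_restr: "U \<subseteq> V \<Longrightarrow> restr U (restr V N) = restr U N"
  by (rule struc_eqI) (auto simp: fun_int_restr rel_int_restr)

lemma restr_univ: "is_struct \<tau> N \<Longrightarrow> restr (univ N) N = N"
  using substruct_eq_restr[of \<tau> N N] by (simp add: substruct_def)

lemma reduct_restr: "reduct \<tau> (restr U N) = restr U (reduct \<tau> N)"
  by (rule struc_eqI) (auto simp: fun_int_restr rel_int_restr fun_int_reduct rel_int_reduct)

lemma is_struct_reduct: "is_struct \<tau>' N \<Longrightarrow> \<tau> \<subseteq> \<tau>' \<Longrightarrow> is_struct \<tau> (reduct \<tau> N)"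
  unfolding is_struct_def univ_reduct fun_int_reduct rel_int_reduct by (metis subsetD)

lemma reduct_id: "is_struct \<tau> N \<Longrightarrow> reduct \<tau> N = N"
  by (rule struc_eqI)
    (auto simp: fun_int_reduct rel_int_reduct dest: is_struct_undefined is_struct_rel)

lemma substruct_reduct:
  "substruct \<tau>' M N \<Longrightarrow> \<tau> \<subseteq> \<tau>' \<Longrightarrow> substruct \<tau> (reduct \<tau> M) (reduct \<tau> N)"
  using is_struct_reduct unfolding substruct_def univ_reduct fun_int_reduct rel_int_reduct
  by (smt (verit, best) subsetD)

lemma substruct_trans: "substruct \<tau> L M \<Longrightarrow> substruct \<tau> M N \<Longrightarrow> substruct \<tau> L N"
  unfolding substruct_def by (metis subset_trans)

lemma substruct_restr_restr:
  assumes "is_struct \<tau> N" "U \<subseteq> V" "V \<subseteq> univ N" "is_struct \<tau> (restr U N)" "is_struct \<tau> (restr V N)"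
  shows "substruct \<tau> (restr U N) (restr V N)"
  using assms by (auto simp: substruct_def fun_int_restr rel_int_restr)

section \<open>Isomorphisms and transport of structure\<close>

lemma iso_bij: "iso \<tau> g M N \<Longrightarrow> bij_betw g (univ M) (univ N)"
  and iso_struct1: "iso \<tau> g M N \<Longrightarrow> is_struct \<tau> M"
  and iso_struct2: "iso \<tau> g M N \<Longrightarrow> is_struct \<tau> N"
  and iso_fun: "iso \<tau> g M N \<Longrightarrow> FunSym f (length xs) \<in> \<tau> \<Longrightarrow> set xs \<subseteq> univ M \<Longrightarrow>
    g (fun_int M f xs) = fun_int N f (map g xs)"
  by (simp_all add: iso_def)

lemma iso_rel: "iso \<tau> g M N \<Longrightarrow> set xs \<subseteq> univ M \<Longrightarrow> rel_int M s xs = rel_int N s (map g xs)"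
  unfolding iso_def using is_struct_rel by (metis length_map)

lemma iso_reduct: "iso \<tau>' g M N \<Longrightarrow> \<tau> \<subseteq> \<tau>' \<Longrightarrow> iso \<tau> g (reduct \<tau> M) (reduct \<tau> N)"
  by (auto simp: iso_def is_struct_reduct fun_int_reduct rel_int_reduct)

lemma iso_sym:
  assumes "iso \<tau> g M N"
  shows "iso \<tau> (inv_into (univ M) g) N M"
proof -
  let ?h = "inv_into (univ M) g"
  have b: "bij_betw g (univ M) (univ N)" using assms by (rule iso_bij)
  have hb: "bij_betw ?h (univ N) (univ M)" using b by (rule bij_betw_inv_into)
  have 1: "map g (map ?h ys) = ys" if "set ys \<subseteq> univ N" for ys
    using that bij_betw_inv_into_right[OF b] by (simp add: map_idI subset_iff)
  have 2: "set (map ?h ys) \<subseteq> univ M" if "set ys \<subseteq> univ N" for ys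
    using that bij_betw_imp_surj_on[OF hb] by auto
  show ?thesis
    unfolding iso_def
  proof (intro conjI allI impI; (elim conjE)?)
    fix f ys assume f: "FunSym f (length ys) \<in> \<tau>" "set ys \<subseteq> univ N"
    have "fun_int M f (map ?h ys) \<in> univ M"
      using is_struct_fun[OF iso_struct1[OF assms]] 2 f by simp
    moreover have "g (fun_int M f (map ?h ys)) = fun_int N f ys"
      using iso_fun[OF assms, of f "map ?h ys"] f 1 2 by simp
    ultimately show "?h (fun_int N f ys) = fun_int M f (map ?h ys)"
      using bij_betw_inv_into_left[OF b] by metis
  next
    fix s ys assume "set ys \<subseteq> univ N"
    then show "rel_int N s ys = rel_int M s (map ?h ys)"
      using iso_rel[OF assms, of "map ?h ys" s] 1 2 by simp
  qed (use assms hb in \<open>auto intro: iso_struct1 iso_struct2\<close>)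
qed

lemma iso_restr:
  assumes g: "iso \<tau> g M N" and U: "U \<subseteq> univ M" and c: "fun_closed \<tau> M U"
  shows "fun_closed \<tau> N (g ` U)" and "iso \<tau> g (restr U M) (restr (g ` U) N)"
proof -
  have b: "bij_betw g (univ M) (univ N)" using g by (rule iso_bij)
  show c': "fun_closed \<tau> N (g ` U)"
  proof (intro allI impI, elim conjE)
    fix f ys assume f: "FunSym f (length ys) \<in> \<tau>" "set ys \<subseteq> g ` U"
    then have "ys \<in> lists (g ` U)" by auto
    then obtain xs where "xs \<in> lists U" "ys = map g xs" unfolding lists_image by auto
    then have xs: "set xs \<subseteq> U" "ys = map g xs" by auto
    have "fun_int M f xs \<in> U" using c f(1) xs by simp
    moreover have "g (fun_int M f xs) = fun_int N f ys"
      using iso_fun[OF g, of f xs] f(1) xs U by simp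
    ultimately show "fun_int N f ys \<in> g ` U" by (metis imageI)
  qed
  have gU: "g ` U \<subseteq> univ N" using b U by (auto simp: bij_betw_def)
  show "iso \<tau> g (restr U M) (restr (g ` U) N)"
    unfolding iso_def
  proof (intro conjI allI impI; (elim conjE)?)
    show "is_struct \<tau> (restr U M)" "is_struct \<tau> (restr (g ` U) N)"
      using is_struct_restr_iff[OF iso_struct1[OF g] U] is_struct_restr_iff[OF iso_struct2[OF g] gU] c c'
      by auto
    show "bij_betw g (univ (restr U M)) (univ (restr (g ` U) N))"
      using b U by (auto simp: bij_betw_def intro: inj_on_subset)
  next
    fix f xs assume "FunSym f (length xs) \<in> \<tau>" "set xs \<subseteq> univ (restr U M)"
    then show "g (fun_int (restr U M) f xs) = fun_int (restr (g ` U) N) f (map g xs)"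
      using iso_fun[OF g, of f xs] U by (simp add: fun_int_restr image_mono)
  next
    fix s xs assume "set xs \<subseteq> univ (restr U M)"
    then show "rel_int (restr U M) s xs = rel_int (restr (g ` U) N) s (map g xs)"
      using iso_rel[OF g, of xs s] U by (simp add: rel_int_restr image_mono)
  qed
qed

lemma ex_iso_copy:
  assumes M: "is_struct \<tau> M" and b: "bij_betw g (univ M) V"
  shows "\<exists>N. univ N = V \<and> iso \<tau> g M N"
proof -
  let ?h = "inv_into (univ M) g"
  define N :: "'a struc" where "N = \<lparr>univ = V,
    fun_int = (\<lambda>f ys. if FunSym f (length ys) \<in> \<tau> \<and> set ys \<subseteq> V
      then g (fun_int M f (map ?h ys)) else undefined),
    rel_int = (\<lambda>s ys. set ys \<subseteq> V \<and> rel_int M s (map ?h ys))\<rparr>"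
  have [simp]: "univ N = V" by (simp add: N_def)
  have h: "map ?h (map g xs) = xs" if "set xs \<subseteq> univ M" for xs
    using that bij_betw_inv_into_left[OF b] by (simp add: map_idI subset_iff)
  have hV: "set (map ?h ys) \<subseteq> univ M" if "set ys \<subseteq> V" for ys
    using that bij_betw_imp_surj_on[OF bij_betw_inv_into[OF b]] by auto
  have gV: "g x \<in> V" if "x \<in> univ M" for x
    using that b by (auto simp: bij_betw_def)
  have gVs: "g ` X \<subseteq> V" if "X \<subseteq> univ M" for X
    using that gV by auto
  have "small V"
    using is_struct_small[OF M] card_of_ordIsoI[OF b] ordIso_ordLess_trans ordIso_symmetric by blast
  moreover have "g (fun_int M f (map ?h ys)) \<in> V" if "FunSym f (length ys) \<in> \<tau>" "set ys \<subseteq> V" for f ys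
    using is_struct_fun[OF M, of f "map ?h ys"] hV[OF that(2)] that gV by auto
  ultimately have "is_struct \<tau> N"
    using is_struct_rel[OF M] unfolding is_struct_def N_def by auto (metis length_map)
  then have "iso \<tau> g M N"
    using M b h gVs unfolding iso_def by (simp add: N_def)
  then show ?thesis by (intro exI[of _ N]) simp
qed

section \<open>Abstract elementary classes\<close>

text \<open>The union of the directed system indexed by the finite subsets of \<open>B\<close>. It
  is applied to closures in a model and to the R-sets of a structure not yet known to be a
  model.\<close>

definition fin_hull :: "('u set \<Rightarrow> 'u set) \<Rightarrow> 'u set \<Rightarrow> 'u set" where
  "fin_hull C B = (\<Union>b\<in>{b. finite b \<and> b \<subseteq> B}. C b)"

lemma mem_fin_hull: "x \<in> fin_hull C B \<longleftrightarrow> (\<exists>b. finite b \<and> b \<subseteq> B \<and> x \<in> C b)"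
  by (auto simp: fin_hull_def)

lemma fin_hull_finite:
  assumes "finite B" "\<And>b. b \<subseteq> B \<Longrightarrow> C b \<subseteq> C B"
  shows "fin_hull C B = C B"
proof
  show "fin_hull C B \<subseteq> C B" using assms(2) unfolding fin_hull_def by blast
  show "C B \<subseteq> fin_hull C B" using assms(1) by (auto simp: mem_fin_hull)
qed

locale aec =
  fixes \<K> :: "'u aclass"
  assumes AEC: "AEC \<K>"
begin

abbreviation \<tau> :: "'u symbol set" where "\<tau> \<equiv> voc \<K>"
abbreviation (input) le :: "'u struc \<Rightarrow> 'u struc \<Rightarrow> bool" (infix \<open>\<preceq>\<close> 50) where
  "M \<preceq> N \<equiv> (M, N) \<in> strong \<K>"
abbreviation cl :: "'u struc \<Rightarrow> 'u set \<Rightarrow> 'u set" where "cl \<equiv> closure_in \<K>"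

lemma vocabulary_voc: "vocabulary \<tau>"
  using AEC unfolding AEC_def by (elim conjE)

lemma struct_model: "M \<in> models \<K> \<Longrightarrow> is_struct \<tau> M"
  using AEC unfolding AEC_def by (elim conjE) blast

lemma partial_order_strong: "partial_order_on (models \<K>) (strong \<K>)"
  using AEC unfolding AEC_def by (elim conjE)

lemma strong_substruct: "M \<preceq> N \<Longrightarrow> substruct \<tau> M N"
  using AEC unfolding AEC_def by (elim conjE) blast

lemma iso_model:
  assumes "M \<in> models \<K>" "iso \<tau> g M N"
  shows "N \<in> models \<K>"
proof -
  have "\<forall>M N g. M \<in> models \<K> \<and> iso \<tau> g M N \<longrightarrow> N \<in> models \<K>"
    using AEC unfolding AEC_def by (elim conjE)
  then show ?thesis using assms by blast
qed

lemma iso_strong: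
  assumes "M1 \<preceq> M2" "iso \<tau> g M2 N2" "univ N1 = g ` univ M1" "iso \<tau> g M1 N1"
  shows "N1 \<preceq> N2"
proof -
  have "\<forall>M1 M2 N1 N2 g. M1 \<preceq> M2 \<and> iso \<tau> g M2 N2 \<and> univ N1 = g ` univ M1 \<and> iso \<tau> g M1 N1 \<longrightarrow>
    N1 \<preceq> N2"
    using AEC unfolding AEC_def by (elim conjE)
  then show ?thesis using assms by blast
qed

lemma coherence:
  assumes "M0 \<in> models \<K>" "substruct \<tau> M0 M1" "M1 \<preceq> M2" "M0 \<preceq> M2"
  shows "M0 \<preceq> M1"
proof -
  have "\<forall>M0 M1 M2. M0 \<in> models \<K> \<and> substruct \<tau> M0 M1 \<and> M1 \<preceq> M2 \<and> M0 \<preceq> M2 \<longrightarrow> M0 \<preceq> M1"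
    using AEC unfolding AEC_def by (elim conjE)
  then show ?thesis using assms by blast
qed

lemma
  assumes "is_limit d" "increasing_chain \<K> d Ms" "is_chain_union \<tau> (ords d) Ms M"
  shows chain_model: "M \<in> models \<K>"
    and chain_upper: "z \<in> ords d \<Longrightarrow> ords z = {} \<Longrightarrow> Ms z \<preceq> M"
    and chain_least: "N \<in> models \<K> \<Longrightarrow> (\<And>i. i \<in> ords d \<Longrightarrow> Ms i \<preceq> N) \<Longrightarrow> M \<preceq> N"
proof -
  have "\<forall>d Ms M. is_limit d \<and> increasing_chain \<K> d Ms \<and> is_chain_union \<tau> (ords d) Ms M \<longrightarrow>
    M \<in> models \<K> \<and> (\<forall>z\<in>ords d. ords z = {} \<longrightarrow> Ms z \<preceq> M) \<and>
    (\<forall>N\<in>models \<K>. (\<forall>i\<in>ords d. Ms i \<preceq> N) \<longrightarrow> M \<preceq> N)"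
    using AEC unfolding AEC_def by (elim conjE)
  then have *: "M \<in> models \<K> \<and> (\<forall>z\<in>ords d. ords z = {} \<longrightarrow> Ms z \<preceq> M) \<and>
    (\<forall>N\<in>models \<K>. (\<forall>i\<in>ords d. Ms i \<preceq> N) \<longrightarrow> M \<preceq> N)"
    using assms by blast
  show "M \<in> models \<K>" using * by blast
  show "z \<in> ords d \<Longrightarrow> ords z = {} \<Longrightarrow> Ms z \<preceq> M" using * by blast
  show "N \<in> models \<K> \<Longrightarrow> (\<And>i. i \<in> ords d \<Longrightarrow> Ms i \<preceq> N) \<Longrightarrow> M \<preceq> N" using * by blast
qed

lemma strong_refl: "M \<in> models \<K> \<Longrightarrow> M \<preceq> M"
  and strong_trans: "L \<preceq> M \<Longrightarrow> M \<preceq> N \<Longrightarrow> L \<preceq> N"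
  and strong_model1: "M \<preceq> N \<Longrightarrow> M \<in> models \<K>"
  and strong_model2: "M \<preceq> N \<Longrightarrow> N \<in> models \<K>"
  using partial_order_onD[OF partial_order_strong]
  by (auto dest: refl_onD transD simp: refl_on_def)

lemma strong_eq_restr: "M \<preceq> N \<Longrightarrow> M = restr (univ M) N"
  by (rule substruct_eq_restr[OF strong_substruct])

lemma coherence_restr:
  assumes "restr U N \<preceq> N" "restr V N \<preceq> N" "U \<subseteq> V"
  shows "restr U N \<preceq> restr V N"
proof (rule coherence[OF strong_model1[OF assms(1)] _ assms(2,1)])
  show "substruct \<tau> (restr U N) (restr V N)"
    using assms substruct_univ[OF strong_substruct[OF assms(2)]]
    by (intro substruct_restr_restr) (auto intro: struct_model strong_model1 strong_model2)
qed

subsection \<open>Directed unions\<close>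

text \<open>
  No continuity is demanded of the chains in the Tarski-Vaught axioms. Hence the hulls of the sets
  \<open>B \<inter> (ords i \<union> c)\<close>, for \<open>i\<close> below a limit ordinal and a fixed finite set \<open>c\<close>, can be used
  as a chain, and the induction over ordinals \<open>d\<close> needs no cardinal arithmetic when it is
  formulated for all sets that are contained in \<open>ords d\<close> up to finitely many elements.
\<close>

lemma directed_union_strong:
  assumes N: "is_struct \<tau> N"
    and C: "\<And>b. finite b \<Longrightarrow> b \<subseteq> univ N \<Longrightarrow> C b \<subseteq> univ N"
    and C_strong: "\<And>b c. finite c \<Longrightarrow> c \<subseteq> univ N \<Longrightarrow> b \<subseteq> c \<Longrightarrow> restr (C b) N \<preceq> restr (C c) N"
    and reg: "regularCard |UNIV :: 'u set|"
    and BX: "B \<subseteq> X" "X \<subseteq> univ N"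
  shows "restr (fin_hull C B) N \<preceq> restr (fin_hull C X) N"
proof -
  let ?D = "fin_hull C"
  have C_mono: "C b \<subseteq> C c" if "finite c" "c \<subseteq> univ N" "b \<subseteq> c" for b c
    using substruct_univ[OF strong_substruct[OF C_strong[OF that]]] by simp
  have D_univ: "?D B \<subseteq> univ N" if "B \<subseteq> univ N" for B
    using C that unfolding fin_hull_def by blast
  have D_mono: "?D A \<subseteq> ?D B" if "A \<subseteq> B" for A B
    using that unfolding fin_hull_def by blast
  \<comment> \<open>Directedness: a finite tuple of the hull already lies in one \<open>C b\<close>.
    As function symbols are finitary, this is what closes the hull under functions.\<close>
  have D_directed: "\<exists>b. finite b \<and> b \<subseteq> B \<and> Y \<subseteq> C b" if "finite Y" "Y \<subseteq> ?D B" "B \<subseteq> univ N" for Y B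
    using that(1,2)
  proof (induction Y rule: finite_induct)
    case empty
    then show ?case by auto
  next
    case (insert y Y)
    then obtain b c where bc: "finite b" "b \<subseteq> B" "Y \<subseteq> C b" "finite c" "c \<subseteq> B" "y \<in> C c"
      by (auto simp: mem_fin_hull)
    have "C b \<subseteq> C (b \<union> c)" "C c \<subseteq> C (b \<union> c)"
      using bc that(3) by (intro C_mono; blast)+
    with bc show ?case by (intro exI[of _ "b \<union> c"]) auto
  qed
  have D_struct: "is_struct \<tau> (restr (?D B) N)" if B: "B \<subseteq> univ N" for B
    unfolding is_struct_restr_iff[OF N D_univ[OF B]]
  proof (intro allI impI, elim conjE)
    fix f xs assume f: "FunSym f (length xs) \<in> \<tau>" "set xs \<subseteq> ?D B"
    then obtain b where b: "finite b" "b \<subseteq> B" "set xs \<subseteq> C b"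
      using D_directed[of "set xs" B] B by auto
    have bN: "b \<subseteq> univ N" using b B by blast
    have "is_struct \<tau> (restr (C b) N)"
      using C_strong[of b b] b bN struct_model strong_model1 by blast
    then have "fun_int N f xs \<in> C b"
      using is_struct_restr_iff[OF N C[OF b(1) bN]] f(1) b(3) by blast
    then show "fun_int N f xs \<in> ?D B" using b by (auto simp: mem_fin_hull)
  qed
  have chain: "is_chain_union \<tau> (ords d) (\<lambda>j. restr (?D (F j)) N) (restr (?D B) N)"
    if F: "\<And>j. j \<in> ords d \<Longrightarrow> F j \<subseteq> B" and B: "B \<subseteq> univ N"
      and cof: "\<And>b. finite b \<Longrightarrow> b \<subseteq> B \<Longrightarrow> \<exists>j\<in>ords d. b \<subseteq> F j" for F B and d :: 'u
    unfolding is_chain_union_def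
  proof (intro conjI ballI)
    show "is_struct \<tau> (restr (?D B) N)" using D_struct[OF B] .
    show "univ (restr (?D B) N) = (\<Union>j\<in>ords d. univ (restr (?D (F j)) N))"
    proof
      show "univ (restr (?D B) N) \<subseteq> (\<Union>j\<in>ords d. univ (restr (?D (F j)) N))"
      proof
        fix x assume "x \<in> univ (restr (?D B) N)"
        then obtain b where b: "finite b" "b \<subseteq> B" "x \<in> C b" by (auto simp: mem_fin_hull)
        then obtain j where "j \<in> ords d" "b \<subseteq> F j" using cof by blast
        with b show "x \<in> (\<Union>j\<in>ords d. univ (restr (?D (F j)) N))" by (auto simp: mem_fin_hull)
      qed
      show "(\<Union>j\<in>ords d. univ (restr (?D (F j)) N)) \<subseteq> univ (restr (?D B) N)"
        using D_mono F by (simp add: UN_least)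
    qed
    fix j assume "j \<in> ords d"
    then have "F j \<subseteq> B" by (rule F)
    then show "substruct \<tau> (restr (?D (F j)) N) (restr (?D B) N)"
      using B by (intro substruct_restr_restr N D_mono D_univ D_struct) auto
  qed
  have main: "restr (?D B) N \<preceq> restr (?D X) N"
    if "finite (X - ords d)" "B \<subseteq> X" "X \<subseteq> univ N" for d B X
    using that
  proof (induction d arbitrary: B X rule: ords_induct)
    case (less d)
    consider "ords d = {}" | i where "i \<in> ords d" "\<forall>j\<in>ords d. i \<notin> ords j" | "is_limit d"
      unfolding is_limit_def by blast
    then show ?case
    proof cases
      case 1
      then have fin: "finite X" using less.prems by simp
      have "?D Y = C Y" if "Y \<subseteq> X" for Y
        using that less.prems(3) finite_subset[OF that fin] by (intro fin_hull_finite C_mono) auto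
      then have "?D X = C X" "?D B = C B"
        using less.prems(2) by auto
      then show ?thesis using C_strong[OF fin] less.prems by simp
    next
      \<comment> \<open>\<open>d\<close> is the successor of \<open>i\<close>: the finite remainder
        of \<open>X\<close> grows by at most \<open>i\<close>.\<close>
      case 2
      have "X - ords i \<subseteq> insert i (X - ords d)"
      proof
        fix x assume x: "x \<in> X - ords i"
        then have "x = i \<or> i \<in> ords x" using ords_linear[of x i] by auto
        then show "x \<in> insert i (X - ords d)" using 2 x by auto
      qed
      then have "finite (X - ords i)" by (rule finite_subset) (use less.prems(1) in simp)
      then show ?thesis using less.IH[OF 2(1)] less.prems by blast
    next
      case 3
      let ?c = "X - ords d"
      \<comment> \<open>The chain axiom puts only the first member of a chain below the union. The
        extra index \<open>i\<close> shifts the start: the chain of the hulls of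
        \<open>F X i j\<close> begins with the hull of
        \<open>X \<inter> (ords i \<union> ?c)\<close>, so each of these hulls occurs as a first
        member.\<close>
      define F where "F Y i j = Y \<inter> (ords i \<union> ords j \<union> ?c)" for Y i j
      have le: "restr (?D (F Y i j)) N \<preceq> restr (?D (F Z i k)) N"
        if "Y \<subseteq> Z" "Z \<subseteq> X" "i \<in> ords d" "k \<in> ords d" "j = k \<or> j \<in> ords k" for Y Z i j k
      proof -
        have sub: "F Y i j \<subseteq> F Z i k"
          using that(1,5) ords_mono[of j k] by (auto simp: F_def)
        \<comment> \<open>\<open>m\<close> is the larger of \<open>i\<close> and \<open>k\<close>.
          Beyond \<open>ords m\<close> only elements of the finite set \<open>?c\<close> remain, so
          the induction hypothesis for \<open>m\<close> applies.\<close>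
        have "\<exists>m\<in>ords d. ords i \<union> ords k = ords m"
          using that(3,4) ords_linear[of i k] ords_mono[of i k] ords_mono[of k i]
          by (metis Un_absorb sup.absorb1 sup.absorb2)
        then obtain m where m: "m \<in> ords d" "ords i \<union> ords k = ords m" by blast
        have "F Z i k - ords m \<subseteq> X - ords d"
          using m(2) that(2) by (auto simp: F_def)
        then have "finite (F Z i k - ords m)"
          by (rule finite_subset) (rule less.prems(1))
        then show ?thesis
          using less.IH[OF m(1) _ sub] that(2) less.prems(3) by (auto simp: F_def)
      qed
      have ordsd: "ords d \<noteq> {}" using 3 by (simp add: is_limit_def)
      have inc: "increasing_chain \<K> d (\<lambda>j. restr (?D (F Y i j)) N)"
        if "Y \<subseteq> X" "i \<in> ords d" for Y i
        unfolding increasing_chain_def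
      proof (intro conjI ballI)
        show "restr (?D (F Y i j)) N \<in> models \<K>" if j: "j \<in> ords d" for j
          using le[OF subset_refl \<open>Y \<subseteq> X\<close> \<open>i \<in> ords d\<close> j, of j] strong_model1 by blast
        show "restr (?D (F Y i j)) N \<preceq> restr (?D (F Y i k)) N" if "k \<in> ords d" "j \<in> ords k" for j k
          using le[OF subset_refl \<open>Y \<subseteq> X\<close> \<open>i \<in> ords d\<close>] that by blast
      qed
      have un: "is_chain_union \<tau> (ords d) (\<lambda>j. restr (?D (F Y i j)) N) (restr (?D Y) N)"
        if "Y \<subseteq> X" for Y i
      proof (rule chain)
        show "Y \<subseteq> univ N" using that less.prems by blast
        fix b assume b: "finite b" "b \<subseteq> Y"
        then obtain j where "j \<in> ords d" "b \<inter> ords d \<subseteq> ords j"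
          using finite_subset_ords_limit[OF 3, of "b \<inter> ords d"] by blast
        then show "\<exists>j\<in>ords d. b \<subseteq> F Y i j"
          using b(2) that by (auto simp: F_def)
      qed (auto simp: F_def)
      obtain z where z: "z \<in> ords d" "ords z = {}"
      proof -
        have "\<exists>z\<in>ords d. ords z = {}" if "i \<in> ords d" for i
          using that
        proof (induction i rule: ords_induct)
          case (less i)
          then show ?case using ords_trans[of _ i d] by blast
        qed
        then show ?thesis using ordsd that by blast
      qed
      have X_model: "restr (?D X) N \<in> models \<K>"
        using chain_model[OF 3 inc[OF subset_refl z(1)] un[OF subset_refl]] .
      have "restr (?D (F B i z)) N \<preceq> restr (?D X) N" if "i \<in> ords d" for i
        using le[OF less.prems(2) subset_refl that z(1), of z]
          chain_upper[OF 3 inc[OF subset_refl that] un[OF subset_refl] z]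
        by (blast intro: strong_trans)
      \<comment> \<open>\<open>ords z\<close> is empty, so \<open>i\<close> and \<open>z\<close> may
        be exchanged: the first members found above are the members of one chain whose union is the
        hull of \<open>B\<close>.\<close>
      then have "restr (?D (F B z i)) N \<preceq> restr (?D X) N" if "i \<in> ords d" for i
        using that by (simp add: F_def Un_commute)
      then show ?thesis
        using chain_least[OF 3 inc[OF less.prems(2) z(1)] un[OF less.prems(2)] X_model] by simp
    qed
  qed
  \<comment> \<open>The possible extra point \<open>d\<close> is absorbed by the finite remainder
    allowed in \<open>main\<close>.\<close>
  obtain d where "univ N \<subseteq> insert d (ords d)"
    using small_subset_insert_ords[OF reg is_struct_small[OF N]] by blast
  then have "X - ords d \<subseteq> {d}" using BX(2) by blast
  then have "finite (X - ords d)" by (rule finite_subset) simp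
  then show ?thesis using main BX by blast
qed

subsection \<open>The Loewenheim-Skolem-Tarski number\<close>

text \<open>A least witness exists by well-foundedness and is unique because \<open>ords\<close> is
  injective, which resolves the \<open>THE\<close> in \<open>LS\<close>.\<close>

lemma LST_cardinal_LS: "LST_cardinal \<K> (LS \<K>)"
proof -
  have "\<exists>l. LST_cardinal \<K> l"
    using AEC unfolding AEC_def by (elim conjE)
  then obtain l0 where l0: "LST_cardinal \<K> l0" ..
  have "\<exists>l. LST_cardinal \<K> l \<and> (\<forall>l'. LST_cardinal \<K> l' \<longrightarrow> ords l \<subseteq> ords l')"
    using l0
  proof (induction l0 rule: ords_induct)
    case (less l)
    show ?case
    proof (cases "\<exists>i\<in>ords l. LST_cardinal \<K> i")
      case True
      then show ?thesis using less.IH by blast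
    next
      case False
      then have "ords l \<subseteq> ords l'" if "LST_cardinal \<K> l'" for l'
        using that ords_linear[of l l'] unfolding ords_subset_iff by blast
      with less.prems show ?thesis by blast
    qed
  qed
  then obtain l where l: "LST_cardinal \<K> l" "\<And>l'. LST_cardinal \<K> l' \<Longrightarrow> ords l \<subseteq> ords l'"
    by blast
  have "LS \<K> = l"
    unfolding LS_def
  proof (rule the_equality)
    fix l' assume "LST_cardinal \<K> l' \<and> (\<forall>l''. LST_cardinal \<K> l'' \<longrightarrow> ords l' \<subseteq> ords l'')"
    then have "ords l' = ords l" using l by blast
    then show "l' = l" by (rule ords_inj)
  qed (use l in blast)
  with l show ?thesis by simp
qed

lemma infinite_LS: "infinite (ords (LS \<K>))"
  and card_voc_le_LS: "|\<tau>| \<le>o |ords (LS \<K>)|"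
proof -
  have *: "|\<tau>| +c natLeq \<le>o |ords (LS \<K>)|"
    using LST_cardinal_LS by (simp add: LST_cardinal_def)
  have "natLeq \<le>o |ords (LS \<K>)|"
    using ordLeq_transitive[OF ordLeq_csum2[OF natLeq_Card_order] *] .
  then show "infinite (ords (LS \<K>))"
    using infinite_iff_natLeq_ordLeq by blast
  show "|\<tau>| \<le>o |ords (LS \<K>)|"
    using ordLeq_transitive[OF ordLeq_csum1[OF card_of_Card_order] *] .
qed

lemma LST:
  assumes "N \<in> models \<K>" "A \<subseteq> univ N" "finite A"
  shows "\<exists>M. A \<subseteq> univ M \<and> M \<preceq> N \<and> |univ M| \<le>o |ords (LS \<K>)|"
proof -
  obtain M where M: "A \<subseteq> univ M" "M \<preceq> N" "|univ M| \<le>o |A| +c |ords (LS \<K>)|"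
    using LST_cardinal_LS assms unfolding LST_cardinal_def by blast
  have "|A| +c |ords (LS \<K>)| \<le>o |ords (LS \<K>)|"
  proof (rule csum_cinfinite_bound)
    show "|A| \<le>o |ords (LS \<K>)|"
      using assms(3) infinite_LS by (rule card_of_finite_infinite)
  qed (use infinite_LS in \<open>simp_all add: cinfinite_def card_of_card_order_on card_of_mono1 Field_card_of\<close>)
  with M show ?thesis using ordLeq_transitive by blast
qed

subsection \<open>Closures\<close>

lemma closure_subset_strong: "M \<preceq> N \<Longrightarrow> A \<subseteq> univ M \<Longrightarrow> cl N A \<subseteq> univ M"
  by (auto simp: closure_in_def)

lemma subset_closure: "A \<subseteq> cl N A"
  by (auto simp: closure_in_def)

lemma closure_subset: "N \<in> models \<K> \<Longrightarrow> A \<subseteq> univ N \<Longrightarrow> cl N A \<subseteq> univ N"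
  using closure_subset_strong strong_refl by blast

lemma card_closure:
  assumes "N \<in> models \<K>" "A \<subseteq> univ N" "finite A"
  shows "|cl N A| \<le>o |ords (LS \<K>)|"
proof -
  obtain M where "A \<subseteq> univ M" "M \<preceq> N" "|univ M| \<le>o |ords (LS \<K>)|"
    using LST[OF assms] by blast
  then show ?thesis
    using ordLeq_transitive[OF card_of_mono1[OF closure_subset_strong[of M N A]]] by blast
qed

lemma strong_image:
  assumes M0: "M0 \<preceq> M" and g: "iso \<tau> g M N"
  shows "restr (g ` univ M0) N \<preceq> N"
proof (rule iso_strong[OF M0 g])
  have "iso \<tau> g (restr (univ M0) M) (restr (g ` univ M0) N)"
    using strong_substruct[OF M0] by (intro iso_restr(2)[OF g] substruct_univ substruct_closed)
  then show "iso \<tau> g M0 (restr (g ` univ M0) N)"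
    using strong_eq_restr[OF M0] by simp
qed simp

text \<open>Isomorphisms carry strong submodels to strong submodels, which gives one inclusion; the
  other is the same inclusion for the inverse.\<close>

lemma closure_iso:
  assumes M: "M \<in> models \<K>" and g: "iso \<tau> g M N" and A: "A \<subseteq> univ M"
  shows "cl N (g ` A) = g ` cl M A"
proof -
  have sub: "cl N (g ` A) \<subseteq> g ` cl M A"
    if M: "M \<in> models \<K>" and g: "iso \<tau> g M N" and A: "A \<subseteq> univ M" for M N g A
  proof
    fix y assume y: "y \<in> cl N (g ` A)"
    have inj: "inj_on g (univ M)" using iso_bij[OF g] by (simp add: bij_betw_def)
    have *: "y \<in> g ` univ M0" if "M0 \<preceq> M" "A \<subseteq> univ M0" for M0
      using closure_subset_strong[OF strong_image[OF that(1) g], of "g ` A"] that(2) y by auto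
    \<comment> \<open>\<open>M\<close> is strong in itself, which yields one preimage
      \<open>x\<close>; by injectivity it serves for every \<open>M0\<close>.\<close>
    obtain x where x: "x \<in> univ M" "y = g x" using *[OF strong_refl[OF M] A] by blast
    have "x \<in> univ M0" if "M0 \<preceq> M" "A \<subseteq> univ M0" for M0
      using *[OF that] x inj substruct_univ[OF strong_substruct[OF that(1)]]
      by (auto simp: inj_on_def)
    then have "x \<in> cl M A" by (auto simp: closure_in_def)
    with x show "y \<in> g ` cl M A" by blast
  qed
  let ?h = "inv_into (univ M) g"
  have b: "bij_betw g (univ M) (univ N)" using g by (rule iso_bij)
  have N: "N \<in> models \<K>" using M g by (rule iso_model)
  have gA: "g ` A \<subseteq> univ N" using A b by (auto simp: bij_betw_def)
  have "?h ` g ` A = A" using b A by (simp add: bij_betw_def inv_into_image_cancel)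
  then have "cl M A \<subseteq> ?h ` cl N (g ` A)"
    using sub[OF N iso_sym[OF g] gA] by simp
  then have "g ` cl M A \<subseteq> g ` ?h ` cl N (g ` A)" by (rule image_mono)
  also have "\<dots> = cl N (g ` A)"
    using closure_subset[OF N gA] b by (simp add: bij_betw_def image_inv_into_cancel)
  finally show ?thesis using sub[OF M g A] by blast
qed

end

locale aec_intersections = aec +
  assumes has_intersections: "has_intersections \<K>"
begin

lemma closure_strong: "N \<in> models \<K> \<Longrightarrow> A \<subseteq> univ N \<Longrightarrow> restr (cl N A) N \<preceq> N"
  using has_intersections by (simp add: has_intersections_def)

lemma closure_least: "N \<in> models \<K> \<Longrightarrow> A \<subseteq> univ N \<Longrightarrow> B \<subseteq> cl N A \<Longrightarrow> cl N B \<subseteq> cl N A"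
  using closure_subset_strong[OF closure_strong] by simp

lemma closure_mono: "N \<in> models \<K> \<Longrightarrow> B \<subseteq> univ N \<Longrightarrow> A \<subseteq> B \<Longrightarrow> cl N A \<subseteq> cl N B"
  by (rule closure_least) (use subset_closure[of B N] in auto)

text \<open>\<open>cl M A\<close> is strong in \<open>N\<close> by transitivity and so takes part in
  the intersection defining \<open>cl N A\<close>. Conversely \<open>cl N A\<close> lies inside
  \<open>M\<close> and is strong in it by coherence.\<close>

lemma closure_strong_eq:
  assumes "M \<preceq> N" "A \<subseteq> univ M"
  shows "cl M A = cl N A"
proof
  have M: "M \<in> models \<K>" and N: "N \<in> models \<K>" and AN: "A \<subseteq> univ N"
    using assms strong_model1 strong_model2 substruct_univ[OF strong_substruct] by blast+
  have sub: "cl N A \<subseteq> univ M" using closure_subset_strong[OF assms] .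
  have "restr (cl M A) M \<preceq> N"
    using strong_trans[OF closure_strong[OF M assms(2)] assms(1)] .
  then show "cl N A \<subseteq> cl M A"
    using closure_subset_strong[of "restr (cl M A) M" N A] subset_closure[of A M] by simp
  have "restr (cl N A) N \<preceq> restr (univ M) N"
    using closure_strong[OF N AN] assms(1) sub strong_eq_restr[OF assms(1)]
    by (intro coherence_restr) auto
  then have "restr (cl N A) N \<preceq> M" using strong_eq_restr[OF assms(1)] by simp
  then show "cl M A \<subseteq> cl N A"
    using closure_subset_strong[of "restr (cl N A) N" M A] subset_closure[of A N] by simp
qed

end

section \<open>Structural logic\<close>

lemma tm_val_cong:
  "(\<And>x. x \<in> tm_vars t \<Longrightarrow> v x = w x) \<Longrightarrow> tm_val N v t = tm_val N w t"
proof (induction t)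
  case (App f ts)
  then have "map (tm_val N v) ts = map (tm_val N w) ts" by fastforce
  then show ?case by (simp del: map_eq_conv)
qed simp

lemma tm_val_substruct:
  assumes "substruct \<tau> M N" "t \<in> terms \<tau>" "v ` tm_vars t \<subseteq> univ M"
  shows "tm_val M v t \<in> univ M \<and> tm_val M v t = tm_val N v t"
  using assms(2,3)
proof (induction t rule: terms.induct)
  case (2 f ts)
  have IH: "tm_val M v t \<in> univ M" "tm_val M v t = tm_val N v t" if "t \<in> set ts" for t
    using 2(3)[OF that] 2(4) that by auto
  then have eq: "map (tm_val M v) ts = map (tm_val N v) ts" by simp
  have sub: "set (map (tm_val M v) ts) \<subseteq> univ M" using IH(1) by auto
  have f: "FunSym f (length (map (tm_val M v) ts)) \<in> \<tau>" using 2(1) by simp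
  have "fun_int M f (map (tm_val M v) ts) = fun_int N f (map (tm_val M v) ts)"
    using assms(1) f sub unfolding substruct_def by blast
  then show ?case
    using is_struct_fun[OF substruct_struct1[OF assms(1)] f sub] unfolding tm_val.simps eq[symmetric] by simp
qed simp

text \<open>Trades the zipped semantic functions of \<open>sat\<close> for definable sets indexed by
  \<open>k\<close>; equal lengths keep \<open>zip\<close> from truncating.\<close>

lemma sat_QStruct:
  assumes "length ys = length \<psi>s"
  shows "sat N (QStruct \<tau>\<^sub>0 M As x \<phi> ys \<psi>s) v \<longleftrightarrow>
    struct_quant N \<tau>\<^sub>0 M As (def_set N x \<phi> v) (map (\<lambda>k. def_set N (ys ! k) (\<psi>s ! k) v) [0..<length \<psi>s])"
proof -
  have "map (\<lambda>(y, S). {a \<in> univ N. S (v(y := a))}) (zip ys (map (sat N) \<psi>s)) =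
    map (\<lambda>k. def_set N (ys ! k) (\<psi>s ! k) v) [0..<length \<psi>s]"
    using assms by (intro nth_equalityI) (auto simp: def_set_def)
  then show ?thesis by (simp add: def_set_def)
qed

lemma free_vars_QStruct:
  assumes "length ys = length \<psi>s"
  shows "free_vars (QStruct \<tau>\<^sub>0 M As x \<phi> ys \<psi>s) =
    (free_vars \<phi> - {x}) \<union> (\<Union>k<length \<psi>s. free_vars (\<psi>s ! k) - {ys ! k})"
proof -
  have "(\<Union>(y, V)\<in>set (zip ys (map free_vars \<psi>s)). V - {y}) =
    (\<Union>k<length \<psi>s. free_vars (\<psi>s ! k) - {ys ! k})"
    using assms by (auto simp: set_zip)
  then show ?thesis by simp
qed

lemma sat_cong:
  "(\<And>x. x \<in> free_vars \<phi> \<Longrightarrow> v x = w x) \<Longrightarrow> sat N \<phi> v = sat N \<phi> w"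
proof (induction \<phi> arbitrary: v w)
  case (Eq s t)
  then have "tm_val N v s = tm_val N w s" "tm_val N v t = tm_val N w t"
    by (auto intro!: tm_val_cong)
  then show ?case by simp
next
  case (Rel r ts)
  then have "map (tm_val N v) ts = map (tm_val N w) ts"
    by (auto intro!: tm_val_cong)
  then show ?case by (simp del: map_eq_conv)
next
  case (Neg \<phi>)
  have "sat N \<phi> v = sat N \<phi> w" using Neg.prems by (intro Neg.IH) auto
  then show ?case by simp
next
  case (Conj I F)
  have "sat N (F i) v = sat N (F i) w" if "i \<in> I" for i
    using Conj.prems that by (intro Conj.IH) auto
  then show ?case by simp
next
  case (Disj I F)
  have "sat N (F i) v = sat N (F i) w" if "i \<in> I" for i
    using Disj.prems that by (intro Disj.IH) auto
  then show ?case by simp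
next
  case (Ex x \<phi>)
  have "sat N \<phi> (v(x := a)) = sat N \<phi> (w(x := a))" for a
    using Ex.prems by (intro Ex.IH) auto
  then show ?case by simp
next
  case (All x \<phi>)
  have "sat N \<phi> (v(x := a)) = sat N \<phi> (w(x := a))" for a
    using All.prems by (intro All.IH) auto
  then show ?case by simp
next
  case (QStruct \<tau>\<^sub>0 M As x \<phi> ys \<psi>s)
  have 1: "{a \<in> univ N. sat N \<phi> (v(x := a))} = {a \<in> univ N. sat N \<phi> (w(x := a))}"
    using QStruct.prems by (intro Collect_cong conj_cong refl QStruct.IH(1)) auto
  have 2: "{a \<in> univ N. sat N (\<psi>s ! k) (v(ys ! k := a))} = {a \<in> univ N. sat N (\<psi>s ! k) (w(ys ! k := a))}"
    if k: "k < length ys" "k < length \<psi>s" for k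
  proof -
    have "(ys ! k, free_vars (\<psi>s ! k)) \<in> set (zip ys (map free_vars \<psi>s))"
      using k by (auto simp: set_zip)
    then have "v z = w z" if "z \<in> free_vars (\<psi>s ! k) - {ys ! k}" for z
      using that QStruct.prems[of z] by auto
    then show ?thesis
      using k by (intro Collect_cong conj_cong refl QStruct.IH(2)[of "\<psi>s ! k"]) auto
  qed
  have "map (\<lambda>(y, S). {a \<in> univ N. S (v(y := a))}) (zip ys (map (sat N) \<psi>s)) =
    map (\<lambda>(y, S). {a \<in> univ N. S (w(y := a))}) (zip ys (map (sat N) \<psi>s))"
    by (rule nth_equalityI) (simp_all add: 2)
  then show ?case using 1 by (simp del: map_eq_conv)
qed

lemma free_vars_foldr_All [simp]: "free_vars (foldr All zs \<phi>) = free_vars \<phi> - set zs"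
  by (induction zs) auto

text \<open>Quantified variables may repeat in \<open>zs\<close>, so the block is described by whole
  assignments \<open>w\<close> that agree with \<open>v\<close> off \<open>zs\<close>.\<close>

lemma sat_foldr_All:
  "sat N (foldr All zs \<phi>) v \<longleftrightarrow>
    (\<forall>w. w ` set zs \<subseteq> univ N \<and> (\<forall>x. x \<notin> set zs \<longrightarrow> w x = v x) \<longrightarrow> sat N \<phi> w)"
proof (induction zs arbitrary: v)
  case Nil
  have "w = v" if "\<forall>x. w x = v x" for w by (rule ext) (use that in auto)
  then show ?case by auto
next
  case (Cons z zs)
  have "sat N (foldr All (z # zs) \<phi>) v \<longleftrightarrow> (\<forall>a\<in>univ N. \<forall>w. w ` set zs \<subseteq> univ N \<and>
      (\<forall>x. x \<notin> set zs \<longrightarrow> w x = (v(z := a)) x) \<longrightarrow> sat N \<phi> w)"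
    by (simp add: Cons.IH)
  also have "\<dots> \<longleftrightarrow> (\<forall>w. w ` set (z # zs) \<subseteq> univ N \<and>
      (\<forall>x. x \<notin> set (z # zs) \<longrightarrow> w x = v x) \<longrightarrow> sat N \<phi> w)" (is "?L \<longleftrightarrow> ?R")
  proof
    assume L: ?L
    show ?R
    proof (intro allI impI, elim conjE)
      fix w assume w: "w ` set (z # zs) \<subseteq> univ N" "\<forall>x. x \<notin> set (z # zs) \<longrightarrow> w x = v x"
      then show "sat N \<phi> w"
        by (intro L[rule_format, of "w z" w]) auto
    qed
  next
    assume R: ?R
    show ?L
    proof (intro ballI allI impI, elim conjE)
      fix a w assume w: "a \<in> univ N" "w ` set zs \<subseteq> univ N"
        "\<forall>x. x \<notin> set zs \<longrightarrow> w x = (v(z := a)) x"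
      \<comment> \<open>If \<open>z\<close> is quantified again in \<open>zs\<close>, its final
        value comes from there and not from \<open>a\<close>.\<close>
      then have "w z \<in> univ N" by (cases "z \<in> set zs") auto
      with w show "sat N \<phi> w"
        by (intro R[rule_format]) auto
    qed
  qed
  finally show ?case .
qed

section \<open>Transfer of formulas between a structure and its substructures\<close>

inductive_cases formulas_NegE: "Neg \<phi> \<in> formulas \<tau> \<kappa>"
inductive_cases formulas_ConjE: "Conj I F \<in> formulas \<tau> \<kappa>"
inductive_cases formulas_DisjE: "Disj I F \<in> formulas \<tau> \<kappa>"
inductive_cases formulas_AllE: "All x \<phi> \<in> formulas \<tau> \<kappa>"
inductive_cases formulas_EqE: "Eq s t \<in> formulas \<tau> \<kappa>"
inductive_cases formulas_RelE: "Rel r ts \<in> formulas \<tau> \<kappa>"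
inductive_cases formulas_QStructE: "QStruct \<tau>\<^sub>0 M As x \<phi> ys \<psi>s \<in> formulas \<tau> \<kappa>"

lemma direct_subformulas_formulas:
  "\<theta> \<in> formulas \<tau> \<kappa> \<Longrightarrow> direct_subformulas \<theta> \<subseteq> formulas \<tau> \<kappa>"
proof (induction \<theta> rule: formulas.induct)
  case (1 \<phi>)
  then show ?case by (auto simp: atomic_formulas_def)
qed auto

lemma formulas_foldr_All: "foldr All zs \<phi> \<in> formulas \<tau> \<kappa> \<Longrightarrow> \<phi> \<in> formulas \<tau> \<kappa>"
  by (induction zs) (auto elim!: formulas_AllE simp: atomic_formulas_def)

lemma sat_quantifier_free_substruct:
  assumes "quantifier_free \<phi>" "\<phi> \<in> formulas \<tau> \<kappa>" "substruct \<tau> M N" "v ` free_vars \<phi> \<subseteq> univ M"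
  shows "sat M \<phi> v = sat N \<phi> v"
  using assms(1,2,4)
proof (induction \<phi> rule: quantifier_free.induct)
  case (1 s t)
  then have "s \<in> terms \<tau>" "t \<in> terms \<tau>"
    by (auto elim!: formulas_EqE simp: atomic_formulas_def)
  then show ?case
    using 1 tm_val_substruct[OF assms(3)] by (simp add: image_Un)
next
  case (2 r ts)
  then have ts: "set ts \<subseteq> terms \<tau>"
    by (auto elim!: formulas_RelE simp: atomic_formulas_def)
  have *: "tm_val M v t \<in> univ M" "tm_val M v t = tm_val N v t" if "t \<in> set ts" for t
    using tm_val_substruct[OF assms(3), of t v] that ts 2(2) by auto
  then have eq: "map (tm_val M v) ts = map (tm_val N v) ts" by simp
  have "set (map (tm_val M v) ts) \<subseteq> univ M" using * by auto
  then show ?case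
    using substruct_rel[OF assms(3), of "map (tm_val M v) ts" r] unfolding sat.simps eq[symmetric] by simp
next
  case (3 \<phi>)
  then have "sat M \<phi> v = sat N \<phi> v"
    by (auto elim!: formulas_NegE simp: atomic_formulas_def)
  then show ?case by simp
next
  case (4 I F)
  have "F i \<in> formulas \<tau> \<kappa>" if "i \<in> I" for i
    using 4(3) that by (auto elim!: formulas_ConjE simp: atomic_formulas_def)
  then have "sat M (F i) v = sat N (F i) v" if "i \<in> I" for i
    using 4(2)[OF that] 4(4) that by (auto simp: image_subset_iff)
  then show ?case by simp
next
  case (5 I F)
  have "F i \<in> formulas \<tau> \<kappa>" if "i \<in> I" for i
    using 5(3) that by (auto elim!: formulas_DisjE simp: atomic_formulas_def)
  then have "sat M (F i) v = sat N (F i) v" if "i \<in> I" for i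
    using 5(2)[OF that] 5(4) that by (auto simp: image_subset_iff)
  then show ?case by simp
qed

lemma def_set_quantifier_free_substruct:
  assumes "quantifier_free \<phi>" "\<phi> \<in> formulas \<tau> \<kappa>" "substruct \<tau> M N"
    "v ` (free_vars \<phi> - {x}) \<subseteq> univ M"
  shows "def_set M x \<phi> v = def_set N x \<phi> v \<inter> univ M"
proof -
  have "sat M \<phi> (v(x := a)) = sat N \<phi> (v(x := a))" if "a \<in> univ M" for a
    using that assms(4) by (intro sat_quantifier_free_substruct[OF assms(1-3)]) auto
  then show ?thesis
    using substruct_univ[OF assms(3)] by (auto simp: def_set_def)
qed

text \<open>A \<open>\<tau>\<^sub>0\<close>-substructure with universe \<open>P\<close> is the
  restriction to \<open>P\<close>, which is the same whether taken in \<open>M\<close> or in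
  \<open>N\<close>.\<close>

lemma struct_quant_substruct:
  assumes "substruct \<tau> M N" "\<tau>\<^sub>0 \<subseteq> \<tau>" "P \<subseteq> univ M"
  shows "struct_quant M \<tau>\<^sub>0 L As P Ps \<longleftrightarrow> struct_quant N \<tau>\<^sub>0 L As P Ps"
proof -
  have MN: "substruct \<tau>\<^sub>0 (reduct \<tau>\<^sub>0 M) (reduct \<tau>\<^sub>0 N)"
    using substruct_reduct[OF assms(1,2)] .
  have "substruct \<tau>\<^sub>0 N0 (reduct \<tau>\<^sub>0 M) \<longleftrightarrow> substruct \<tau>\<^sub>0 N0 (reduct \<tau>\<^sub>0 N)" if "univ N0 = P" for N0
  proof
    assume "substruct \<tau>\<^sub>0 N0 (reduct \<tau>\<^sub>0 M)"
    then show "substruct \<tau>\<^sub>0 N0 (reduct \<tau>\<^sub>0 N)" using MN by (rule substruct_trans)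
  next
    assume *: "substruct \<tau>\<^sub>0 N0 (reduct \<tau>\<^sub>0 N)"
    have "N0 = restr P (reduct \<tau>\<^sub>0 N)" "reduct \<tau>\<^sub>0 M = restr (univ M) (reduct \<tau>\<^sub>0 N)"
      using substruct_eq_restr[OF *] substruct_eq_restr[OF MN] that by simp_all
    then show "substruct \<tau>\<^sub>0 N0 (reduct \<tau>\<^sub>0 M)"
      using substruct_restr_restr[OF substruct_struct2[OF MN] assms(3)]
        substruct_univ[OF MN] substruct_struct1[OF MN] substruct_struct1[OF *] by simp
  qed
  then show ?thesis unfolding struct_quant_def by metis
qed

lemma struct_quant_card:
  assumes "struct_quant N \<tau>\<^sub>0 L As P Ps"
  shows "|P| =o |univ L|"
proof -
  obtain N0 g where "univ N0 = P" "iso \<tau>\<^sub>0 g N0 L"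
    using assms unfolding struct_quant_def by blast
  then show ?thesis using card_of_ordIsoI[OF iso_bij[of \<tau>\<^sub>0 g N0 L]] by simp
qed

section \<open>Universal structural theories\<close>

text \<open>The conclusion of the second clause of \<open>elem_sub_star\<close>, freed from its
  cardinality guard, which \<open>Mod_def_set_card\<close> discharges in models.\<close>

definition agree ::
    "'u struc \<Rightarrow> 'u struc \<Rightarrow> nat \<Rightarrow> ('u, 'i) fm \<Rightarrow> nat list \<Rightarrow> ('u, 'i) fm list \<Rightarrow> (nat \<Rightarrow> 'u) \<Rightarrow> bool"
  where
  "agree M N x \<phi> ys \<psi>s v \<longleftrightarrow>
     def_set M x \<phi> v = def_set N x \<phi> v \<and>
     (\<forall>k<length \<psi>s. def_set M (ys ! k) (\<psi>s ! k) v = def_set N (ys ! k) (\<psi>s ! k) v)"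

locale forall_Q =
  fixes \<tau> :: "'u symbol set" and \<kappa> :: "'k rel" and T :: "('u, 'i) fm set"
  assumes T_sentences: "T \<subseteq> sentences \<tau> \<kappa>"
    and T_forall_Q: "\<And>\<sigma>. \<sigma> \<in> T \<Longrightarrow> is_forall_Q \<sigma>"
begin

text \<open>All disjuncts of an axiom share the formulas and bound variables and differ only in the
  structure with its marked sets, so one \<open>agree\<close> condition governs them all. As
  \<open>I\<close> is nonempty, facts about these formulas can be read off any disjunct.\<close>

definition block :: "nat list \<Rightarrow> 'i set \<Rightarrow> ('i \<Rightarrow> ('u, 'i) fm) \<Rightarrow> nat \<Rightarrow> ('u, 'i) fm \<Rightarrow> nat list \<Rightarrow> ('u, 'i) fm list \<Rightarrow> bool"
  where "block zs I F x \<phi> ys \<psi>s \<longleftrightarrow> foldr All zs (Disj I F) \<in> T \<and>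
     I \<noteq> {} \<and> (\<forall>i\<in>I. \<exists>\<tau>\<^sub>0 M As. F i = QStruct \<tau>\<^sub>0 M As x \<phi> ys \<psi>s) \<and>
     quantifier_free \<phi> \<and> (\<forall>\<psi>\<in>set \<psi>s. quantifier_free \<psi>)"

abbreviation frag :: "('u, 'i) fm set" where "frag \<equiv> generated_fragment \<tau> \<kappa> T"

lemma T_block:
  assumes "\<sigma> \<in> T"
  obtains zs I F x \<phi> ys \<psi>s where "\<sigma> = foldr All zs (Disj I F)" "block zs I F x \<phi> ys \<psi>s"
proof -
  obtain zs I and F :: "'i \<Rightarrow> ('u, 'i) fm" and S x \<phi> ys \<psi>s where
    *: "\<sigma> = foldr All zs (Disj I F)" "S \<noteq> {}"
      "F ` I = (\<lambda>(\<tau>\<^sub>0, M, As). QStruct \<tau>\<^sub>0 M As x \<phi> ys \<psi>s) ` S"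
      "quantifier_free \<phi>" "\<forall>\<psi>\<in>set \<psi>s. quantifier_free \<psi>"
    using T_forall_Q[OF assms] unfolding is_forall_Q_def by (elim exE conjE) (rule that; assumption)
  have "\<exists>\<tau>\<^sub>0 M As. F i = QStruct \<tau>\<^sub>0 M As x \<phi> ys \<psi>s" if "i \<in> I" for i
  proof -
    have "F i \<in> (\<lambda>(\<tau>\<^sub>0, M, As). QStruct \<tau>\<^sub>0 M As x \<phi> ys \<psi>s) ` S"
      using that *(3) by blast
    then show ?thesis by auto
  qed
  moreover have "I \<noteq> {}" using *(2,3) by auto
  ultimately show ?thesis
    using that[of zs I F x \<phi> ys \<psi>s] * assms by (auto simp: block_def)
qed

lemma
  assumes "block zs I F x \<phi> ys \<psi>s"
  shows block_closed: "free_vars (Disj I F) \<subseteq> set zs"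
    and block_formula: "i \<in> I \<Longrightarrow> F i \<in> formulas \<tau> \<kappa>"
proof -
  have "foldr All zs (Disj I F) \<in> sentences \<tau> \<kappa>"
    using assms T_sentences unfolding block_def by blast
  then have *: "foldr All zs (Disj I F) \<in> formulas \<tau> \<kappa>" "free_vars (foldr All zs (Disj I F)) = {}"
    unfolding sentences_def by blast+
  then show "free_vars (Disj I F) \<subseteq> set zs" by simp
  have D: "Disj I F \<in> formulas \<tau> \<kappa>" using formulas_foldr_All[OF *(1)] .
  show "F i \<in> formulas \<tau> \<kappa>" if "i \<in> I"
    using D that direct_subformulas_formulas[OF D] by auto
qed

lemma
  assumes b: "block zs I F x \<phi> ys \<psi>s"
  shows block_length: "length ys = length \<psi>s"
    and block_phi: "\<phi> \<in> formulas \<tau> \<kappa>" and block_psi: "\<psi> \<in> set \<psi>s \<Longrightarrow> \<psi> \<in> formulas \<tau> \<kappa>"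
    and block_card: "i \<in> I \<Longrightarrow> F i = QStruct \<tau>\<^sub>0 M As x \<phi> ys \<psi>s \<Longrightarrow> |univ M| <o \<kappa>"
    and block_voc: "i \<in> I \<Longrightarrow> F i = QStruct \<tau>\<^sub>0 M As x \<phi> ys \<psi>s \<Longrightarrow> \<tau>\<^sub>0 \<subseteq> \<tau>"
proof -
  have *: "length ys = length \<psi>s \<and> \<phi> \<in> formulas \<tau> \<kappa> \<and> (\<forall>\<psi>\<in>set \<psi>s. \<psi> \<in> formulas \<tau> \<kappa>) \<and>
    |univ M| <o \<kappa> \<and> \<tau>\<^sub>0 \<subseteq> \<tau>"
    if "i \<in> I" "F i = QStruct \<tau>\<^sub>0 M As x \<phi> ys \<psi>s" for i \<tau>\<^sub>0 M As
    using block_formula[OF b that(1)] unfolding that(2)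
    by (auto elim!: formulas_QStructE simp: atomic_formulas_def)
  show "i \<in> I \<Longrightarrow> F i = QStruct \<tau>\<^sub>0 M As x \<phi> ys \<psi>s \<Longrightarrow> |univ M| <o \<kappa>"
    and "i \<in> I \<Longrightarrow> F i = QStruct \<tau>\<^sub>0 M As x \<phi> ys \<psi>s \<Longrightarrow> \<tau>\<^sub>0 \<subseteq> \<tau>"
    using *[of i \<tau>\<^sub>0 M As] by blast+
  obtain i \<tau>\<^sub>0 M As where "i \<in> I" "F i = QStruct \<tau>\<^sub>0 M As x \<phi> ys \<psi>s"
    using b unfolding block_def by blast
  from *[OF this] show "length ys = length \<psi>s" "\<phi> \<in> formulas \<tau> \<kappa>" "\<psi> \<in> set \<psi>s \<Longrightarrow> \<psi> \<in> formulas \<tau> \<kappa>"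
    by blast+
qed

lemma block_free_vars:
  assumes b: "block zs I F x \<phi> ys \<psi>s"
  shows "free_vars (Disj I F) =
    (free_vars \<phi> - {x}) \<union> (\<Union>k<length \<psi>s. free_vars (\<psi>s ! k) - {ys ! k})" (is "_ = ?V")
proof -
  have "free_vars (F i) = ?V" if i: "i \<in> I" for i
  proof -
    obtain \<tau>\<^sub>0 L As where "F i = QStruct \<tau>\<^sub>0 L As x \<phi> ys \<psi>s"
      using b i unfolding block_def by blast
    then show ?thesis using free_vars_QStruct[OF block_length[OF b]] by simp
  qed
  then show ?thesis using b by (auto simp: block_def)
qed

lemma block_sat:
  assumes b: "block zs I F x \<phi> ys \<psi>s" and "i \<in> I" "F i = QStruct \<tau>\<^sub>0 L As x \<phi> ys \<psi>s"
  shows "sat N (F i) v \<longleftrightarrow> struct_quant N \<tau>\<^sub>0 L As (def_set N x \<phi> v)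
    (map (\<lambda>k. def_set N (ys ! k) (\<psi>s ! k) v) [0..<length \<psi>s])"
  unfolding assms(3) by (rule sat_QStruct[OF block_length[OF b]])

lemma agree_sat:
  assumes b: "block zs I F x \<phi> ys \<psi>s" and MN: "substruct \<tau> M N"
    and a: "agree M N x \<phi> ys \<psi>s v" and i: "i \<in> I"
  shows "sat M (F i) v = sat N (F i) v"
proof -
  obtain \<tau>\<^sub>0 L As where F: "F i = QStruct \<tau>\<^sub>0 L As x \<phi> ys \<psi>s"
    using b i unfolding block_def by blast
  have "def_set M x \<phi> v \<subseteq> univ M" by (auto simp: def_set_def)
  moreover have "map (\<lambda>k. def_set M (ys ! k) (\<psi>s ! k) v) [0..<length \<psi>s] =
    map (\<lambda>k. def_set N (ys ! k) (\<psi>s ! k) v) [0..<length \<psi>s]"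
    using a by (simp add: agree_def)
  moreover have "def_set M x \<phi> v = def_set N x \<phi> v" using a by (simp add: agree_def)
  ultimately show ?thesis
    unfolding block_sat[OF b i F] by (simp add: struct_quant_substruct[OF MN block_voc[OF b i F]] del: map_eq_conv)
qed

text \<open>The stripped quantifiers are instantiated by the values of \<open>v\<close>. In the
  empty structure there is nothing to instantiate with; there a remaining quantifier is needed to
  make the formula vacuously true.\<close>

lemma Mod_sat_suffix:
  assumes N: "N \<in> Mod \<tau> T" and T: "foldr All (zs1 @ zs2) \<theta> \<in> T"
    and v: "v ` free_vars (foldr All zs2 \<theta>) \<subseteq> univ N" and ne: "univ N \<noteq> {} \<or> zs2 \<noteq> []"
  shows "sat N (foldr All zs2 \<theta>) v"
proof (cases "univ N = {}")
  case True
  then show ?thesis using ne by (cases zs2) auto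
next
  case False
  then obtain a where a: "a \<in> univ N" by blast
  \<comment> \<open>Variables that are not free may have values outside \<open>N\<close> under
    \<open>v\<close>; they are sent to \<open>a\<close>.\<close>
  define w where "w x = (if x \<in> free_vars (foldr All zs2 \<theta>) then v x else a)" for x
  have "sat N (foldr All zs1 (foldr All zs2 \<theta>)) w"
    using N T by (simp add: Mod_def)
  then have "sat N (foldr All zs2 \<theta>) w"
    unfolding sat_foldr_All[of N zs1] by (elim allE[of _ w]) (use v a in \<open>auto simp: w_def\<close>)
  then show ?thesis by (subst sat_cong[of _ v w]) (auto simp: w_def)
qed

text \<open>A disjunct true at \<open>v\<close> puts the set in bijection with the universe of its
  structure, which is smaller than \<kappa>. In the empty model the axiom may be vacuous, but the
  set is empty and any disjunct shows that the empty set is smaller than \<kappa>.\<close>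

lemma Mod_def_set_card:
  assumes N: "N \<in> Mod \<tau> T" and b: "block zs I F x \<phi> ys \<psi>s"
    and v: "v ` free_vars (Disj I F) \<subseteq> univ N"
  shows "|def_set N x \<phi> v| <o \<kappa>"
proof (cases "univ N = {}")
  case True
  then have [simp]: "def_set N x \<phi> v = {}" by (simp add: def_set_def)
  obtain i \<tau>\<^sub>0 M As where i: "i \<in> I" "F i = QStruct \<tau>\<^sub>0 M As x \<phi> ys \<psi>s"
    using b unfolding block_def by blast
  show ?thesis
    using ordLeq_ordLess_trans[OF card_of_empty[of "univ M"] block_card[OF b i]] by simp
next
  case False
  have "sat N (Disj I F) v"
    using Mod_sat_suffix[OF N, of zs "[]" "Disj I F" v] b False v by (simp add: block_def)
  then obtain i where i: "i \<in> I" "sat N (F i) v" by auto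
  then obtain \<tau>\<^sub>0 L As where F: "F i = QStruct \<tau>\<^sub>0 L As x \<phi> ys \<psi>s"
    using b unfolding block_def by blast
  show ?thesis
    using struct_quant_card i(2) ordIso_ordLess_trans[OF _ block_card[OF b i(1) F]]
    unfolding block_sat[OF b i(1) F] by blast
qed

section \<open>The generated fragment and its ordering\<close>

lemma fragment_generated: "fragment \<tau> \<kappa> frag"
  and T_subset_generated: "T \<subseteq> frag"
proof -
  have "fragment \<tau> \<kappa> (formulas \<tau> \<kappa>)"
    using direct_subformulas_formulas by (auto simp: fragment_def intro: formulas.intros(1))
  moreover have "T \<subseteq> formulas \<tau> \<kappa>" using T_sentences by (auto simp: sentences_def)
  ultimately have "frag \<subseteq> formulas \<tau> \<kappa>"
    unfolding generated_fragment_def by blast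
  then show "fragment \<tau> \<kappa> frag"
    unfolding fragment_def generated_fragment_def by blast
  show "T \<subseteq> frag" unfolding generated_fragment_def by blast
qed

lemma generated_foldr_All: "foldr All zs \<theta> \<in> frag \<Longrightarrow> \<theta> \<in> frag"
  using fragment_generated by (induction zs) (auto simp: fragment_def)

lemma block_generated:
  assumes "block zs I F x \<phi> ys \<psi>s" "i \<in> I"
  shows "F i \<in> frag"
proof -
  have "Disj I F \<in> frag"
    using assms T_subset_generated generated_foldr_All[of zs] by (auto simp: block_def)
  then show ?thesis
    using assms(2) fragment_generated by (fastforce simp: fragment_def)
qed

text \<open>The three families together form a fragment containing \<open>T\<close>, so they exhaust
  the least one. In the last case \<open>zs1\<close> records the quantifiers already removed from an
  axiom; for empty \<open>zs2\<close> the bare disjunction remains.\<close>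

lemma generated_cases:
  assumes "\<theta> \<in> frag"
  obtains (qf) "quantifier_free \<theta>" "\<theta> \<in> formulas \<tau> \<kappa>"
  | (Q) zs I F x \<phi> ys \<psi>s i where "block zs I F x \<phi> ys \<psi>s" "i \<in> I" "\<theta> = F i"
  | (All) zs1 zs2 I F x \<phi> ys \<psi>s where "block (zs1 @ zs2) I F x \<phi> ys \<psi>s" "\<theta> = foldr All zs2 (Disj I F)"
proof -
  define A :: "('u, 'i) fm set" where "A = {\<theta> \<in> formulas \<tau> \<kappa>. quantifier_free \<theta>}"
  define B where "B = {\<theta>. \<exists>zs I F x \<phi> ys \<psi>s i. block zs I F x \<phi> ys \<psi>s \<and> i \<in> I \<and> \<theta> = F i}"
  define C where "C = {\<theta>. \<exists>zs1 zs2 I F x \<phi> ys \<psi>s.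
    block (zs1 @ zs2) I F x \<phi> ys \<psi>s \<and> \<theta> = foldr All zs2 (Disj I F)}"
  have A: "direct_subformulas \<theta> \<subseteq> A" if "\<theta> \<in> A" for \<theta>
  proof -
    have "quantifier_free \<theta>" using that by (simp add: A_def)
    then have "\<forall>\<theta>'\<in>direct_subformulas \<theta>. quantifier_free \<theta>'" by cases auto
    then show ?thesis
      using that direct_subformulas_formulas[of \<theta> \<tau> \<kappa>] by (auto simp: A_def)
  qed
  have B: "direct_subformulas \<theta> \<subseteq> A" if \<theta>: "\<theta> \<in> B" for \<theta>
  proof -
    obtain zs I F x \<phi> ys \<psi>s i where b: "block zs I F x \<phi> ys \<psi>s" "i \<in> I" "\<theta> = F i"
      using \<theta> unfolding B_def by blast
    obtain \<tau>\<^sub>0 L As where F: "\<theta> = QStruct \<tau>\<^sub>0 L As x \<phi> ys \<psi>s"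
      using b unfolding block_def by blast
    show ?thesis
      using b(1) block_phi[OF b(1)] block_psi[OF b(1)] by (auto simp: F A_def block_def)
  qed
  have C: "direct_subformulas \<theta> \<subseteq> B \<union> C" if \<theta>: "\<theta> \<in> C" for \<theta>
  proof -
    obtain zs1 zs2 I F x \<phi> ys \<psi>s where
      b: "block (zs1 @ zs2) I F x \<phi> ys \<psi>s" "\<theta> = foldr All zs2 (Disj I F)"
      using \<theta> unfolding C_def by blast
    show ?thesis
    proof (cases zs2)
      case Nil
      then show ?thesis using b by (fastforce simp: B_def)
    next
      case (Cons z zs)
      then have "block ((zs1 @ [z]) @ zs) I F x \<phi> ys \<psi>s" using b(1) by simp
      then have "foldr All zs (Disj I F) \<in> C" unfolding C_def by blast
      then show ?thesis using b(2) Cons by simp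
    qed
  qed
  have "fragment \<tau> \<kappa> (A \<union> B \<union> C)"
    unfolding fragment_def
  proof (intro conjI ballI)
    show "atomic_formulas \<tau> \<subseteq> A \<union> B \<union> C"
      by (auto simp: A_def atomic_formulas_def intro: quantifier_free.intros formulas.intros)
    have "C \<subseteq> formulas \<tau> \<kappa>"
    proof
      fix \<theta> assume "\<theta> \<in> C"
      then obtain zs1 zs2 I F x \<phi> ys \<psi>s where
        b: "block (zs1 @ zs2) I F x \<phi> ys \<psi>s" "\<theta> = foldr All zs2 (Disj I F)"
        unfolding C_def by blast
      have "foldr All zs1 \<theta> \<in> T" using b by (simp add: block_def)
      then show "\<theta> \<in> formulas \<tau> \<kappa>"
        using T_sentences formulas_foldr_All[of zs1 \<theta> \<tau> \<kappa>] by (auto simp: sentences_def)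
    qed
    then show "A \<union> B \<union> C \<subseteq> formulas \<tau> \<kappa>"
      using block_formula by (auto simp: A_def B_def)
  next
    fix \<theta> assume "\<theta> \<in> A \<union> B \<union> C"
    then show "direct_subformulas \<theta> \<subseteq> A \<union> B \<union> C" using A B C by blast
  qed
  moreover have "T \<subseteq> A \<union> B \<union> C"
  proof
    fix \<sigma> assume "\<sigma> \<in> T"
    then obtain zs I F x \<phi> ys \<psi>s where "\<sigma> = foldr All zs (Disj I F)" "block zs I F x \<phi> ys \<psi>s"
      by (rule T_block)
    then have "\<sigma> \<in> C" unfolding C_def by (metis (mono_tags, lifting) append_Nil mem_Collect_eq)
    then show "\<sigma> \<in> A \<union> B \<union> C" by blast
  qed
  ultimately have "\<theta> \<in> A \<union> B \<union> C"
    using assms unfolding generated_fragment_def by blast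
  then show ?thesis
    using that unfolding A_def B_def C_def by blast
qed

text \<open>Left to right, the cardinality guard is met by \<open>Mod_def_set_card\<close>. Right to
  left, quantifier-free formulas transfer anyway, agreement makes the structural quantifiers speak
  of the same sets, and partly stripped axioms are settled by \<open>Mod_sat_suffix\<close>.\<close>

lemma elem_sub_star_iff:
  assumes M: "M \<in> Mod \<tau> T" and N: "N \<in> Mod \<tau> T" and MN: "substruct \<tau> M N"
  shows "elem_sub_star \<tau> \<kappa> frag M N \<longleftrightarrow> (\<forall>zs I F x \<phi> ys \<psi>s v.
    block zs I F x \<phi> ys \<psi>s \<and> v ` free_vars (Disj I F) \<subseteq> univ M \<longrightarrow> agree M N x \<phi> ys \<psi>s v)"
    (is "_ \<longleftrightarrow> ?R")
proof
  assume *: "elem_sub_star \<tau> \<kappa> frag M N"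
  show ?R
  proof (intro allI impI, elim conjE)
    fix zs I F x \<phi> ys \<psi>s v
    assume b: "block zs I F x \<phi> ys \<psi>s" and v: "v ` free_vars (Disj I F) \<subseteq> univ M"
    obtain i \<tau>\<^sub>0 L As where i: "i \<in> I" "F i = QStruct \<tau>\<^sub>0 L As x \<phi> ys \<psi>s"
      using b unfolding block_def by blast
    have "QStruct \<tau>\<^sub>0 L As x \<phi> ys \<psi>s \<in> frag"
      using block_generated[OF b i(1)] i(2) by simp
    moreover have "v ` free_vars (QStruct \<tau>\<^sub>0 L As x \<phi> ys \<psi>s) \<subseteq> univ M"
      using v block_free_vars[OF b] free_vars_QStruct[OF block_length[OF b]] by simp
    moreover have "|def_set M x \<phi> v| <o \<kappa>" using Mod_def_set_card[OF M b v] .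
    ultimately show "agree M N x \<phi> ys \<psi>s v"
      using * unfolding elem_sub_star_def agree_def by blast
  qed
next
  assume R: ?R
  have Q_sat: "sat M (F i) v = sat N (F i) v"
    if b: "block zs I F x \<phi> ys \<psi>s" and "i \<in> I" "v ` free_vars (Disj I F) \<subseteq> univ M"
    for zs I F x \<phi> ys \<psi>s i v
    using R that by (intro agree_sat[OF b MN]) blast+
  have fv: "free_vars (F i) = free_vars (Disj I F)" if b: "block zs I F x \<phi> ys \<psi>s" and i: "i \<in> I"
    for zs I F x \<phi> ys \<psi>s i
  proof -
    obtain \<tau>\<^sub>0 L As where "F i = QStruct \<tau>\<^sub>0 L As x \<phi> ys \<psi>s"
      using b i unfolding block_def by blast
    then show ?thesis using block_free_vars[OF b] free_vars_QStruct[OF block_length[OF b]] by simp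
  qed
  have elem: "sat M \<theta> v = sat N \<theta> v" if \<theta>: "\<theta> \<in> frag" and v: "v ` free_vars \<theta> \<subseteq> univ M" for \<theta> v
    using \<theta>
  proof (cases rule: generated_cases)
    case qf
    then show ?thesis using sat_quantifier_free_substruct MN v by blast
  next
    case (Q zs I F x \<phi> ys \<psi>s i)
    then show ?thesis using Q_sat[OF Q(1,2)] v fv[OF Q(1,2)] by simp
  next
    case (All zs1 zs2 I F x \<phi> ys \<psi>s)
    have T: "foldr All (zs1 @ zs2) (Disj I F) \<in> T" using All(1) by (simp add: block_def)
    show ?thesis
    \<comment> \<open>A remaining quantifier makes the formula true in both models, even empty ones.
      The bare disjunction may fail in the empty model and is compared disjunct by disjunct.\<close>
    proof (cases "zs2 = []")
      case True
      then show ?thesis using All v Q_sat[OF All(1)] by simp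
    next
      case False
      have "v ` free_vars \<theta> \<subseteq> univ N" using v substruct_univ[OF MN] by blast
      then show ?thesis
        using Mod_sat_suffix[OF M T] Mod_sat_suffix[OF N T] False v unfolding All(2) by blast
    qed
  qed
  show "elem_sub_star \<tau> \<kappa> frag M N"
    unfolding elem_sub_star_def elem_sub_def
  proof (intro conjI ballI allI impI; (elim conjE)?)
    fix \<tau>\<^sub>0 L As x \<phi> ys \<psi>s and v :: "nat \<Rightarrow> 'u"
    assume Qf: "QStruct \<tau>\<^sub>0 L As x \<phi> ys \<psi>s \<in> frag"
      and v: "v ` free_vars (QStruct \<tau>\<^sub>0 L As x \<phi> ys \<psi>s) \<subseteq> univ M"
    have "agree M N x \<phi> ys \<psi>s v"
      using Qf
    proof (cases rule: generated_cases)
      case qf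
      then show ?thesis by (auto elim: quantifier_free.cases)
    next
      case (Q zs I F x' \<phi>' ys' \<psi>s' i)
      then have "x' = x" "\<phi>' = \<phi>" "ys' = ys" "\<psi>s' = \<psi>s"
        by (auto simp: block_def)
      then show ?thesis using R Q(1) v fv[OF Q(1,2)] Q(3) by metis
    next
      case (All zs1 zs2 I F x \<phi> ys \<psi>s)
      then show ?thesis by (cases zs2) auto
    qed
    then show "def_set M x \<phi> v = def_set N x \<phi> v"
      and "k < length \<psi>s \<Longrightarrow> def_set M (ys ! k) (\<psi>s ! k) v = def_set N (ys ! k) (\<psi>s ! k) v" for k
      by (auto simp: agree_def)
  qed (use MN elem in auto)
qed

lemma Mod_Inter:
  assumes N: "N \<in> Mod \<tau> T" and ne: "\<M> \<noteq> {}"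
    and \<M>: "\<And>M. M \<in> \<M> \<Longrightarrow> M \<in> Mod \<tau> T \<and> elem_sub_star \<tau> \<kappa> frag M N"
    and U: "U = (\<Inter>M\<in>\<M>. univ M)"
  shows "restr U N \<in> Mod \<tau> T" and "elem_sub_star \<tau> \<kappa> frag (restr U N) N"
proof -
  have sub: "substruct \<tau> M N" if "M \<in> \<M>" for M
    using \<M>[OF that] by (simp add: elem_sub_star_def elem_sub_def)
  have N': "is_struct \<tau> N" using N by (simp add: Mod_def)
  have UM: "U \<subseteq> univ M" if "M \<in> \<M>" for M using U that by blast
  have "U \<subseteq> univ N" using ne UM substruct_univ[OF sub] by blast
  moreover have "fun_closed \<tau> N U"
    using substruct_closed[OF sub] unfolding U by (simp add: subset_iff)
  ultimately have subU: "substruct \<tau> (restr U N) N"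
    by (rule substruct_restr[OF N'])
  \<comment> \<open>Parameters in \<open>U\<close> lie in every \<open>M\<close> of the family, so
    agreement traps the set defined in \<open>N\<close> inside each \<open>M\<close>, hence inside
    \<open>U\<close>; quantifier-freeness then identifies it with the set defined in the
    restriction.\<close>
  have restrict: "def_set (restr U N) y \<theta> v = def_set N y \<theta> v"
    if b: "block zs I F x \<phi> ys \<psi>s" and v: "v ` free_vars (Disj I F) \<subseteq> U"
      and \<theta>: "y = x \<and> \<theta> = \<phi> \<or> (\<exists>k<length \<psi>s. y = ys ! k \<and> \<theta> = \<psi>s ! k)"
    for zs I F x \<phi> ys \<psi>s v y \<theta>
  proof -
    have "def_set N y \<theta> v \<subseteq> univ M" if "M \<in> \<M>" for M
    proof -
      have "v ` free_vars (Disj I F) \<subseteq> univ M" using v UM[OF that] by blast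
      then have "agree M N x \<phi> ys \<psi>s v"
        using \<M>[OF that] b elem_sub_star_iff[OF _ N sub[OF that]] by blast
      then have "def_set N y \<theta> v = def_set M y \<theta> v"
        using \<theta> by (auto simp: agree_def)
      then show ?thesis by (auto simp: def_set_def)
    qed
    then have "def_set N y \<theta> v \<subseteq> U" using U by blast
    moreover have "quantifier_free \<theta>" "\<theta> \<in> formulas \<tau> \<kappa>"
      using \<theta> b block_phi[OF b] block_psi[OF b] by (auto simp: block_def)
    moreover have "v ` (free_vars \<theta> - {y}) \<subseteq> univ (restr U N)"
      using \<theta> v unfolding block_free_vars[OF b] by auto
    ultimately show ?thesis
      using def_set_quantifier_free_substruct[of \<theta> \<tau> \<kappa> "restr U N" N v y] subU by auto
  qed
  have agree: "agree (restr U N) N x \<phi> ys \<psi>s v"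
    if b: "block zs I F x \<phi> ys \<psi>s" and v: "v ` free_vars (Disj I F) \<subseteq> univ (restr U N)"
    for zs I F x \<phi> ys \<psi>s v
    using restrict[OF b] v unfolding agree_def by auto
  show Mod: "restr U N \<in> Mod \<tau> T"
    unfolding Mod_def
  proof (intro CollectI conjI ballI allI)
    show "is_struct \<tau> (restr U N)" using substruct_struct1[OF subU] .
    fix \<sigma> v assume \<sigma>: "\<sigma> \<in> T"
    then obtain zs I F x \<phi> ys \<psi>s where
      b: "\<sigma> = foldr All zs (Disj I F)" "block zs I F x \<phi> ys \<psi>s" by (rule T_block)
    show "sat (restr U N) \<sigma> v"
      unfolding b(1) sat_foldr_All
    proof (intro allI impI, elim conjE)
      fix w assume w: "w ` set zs \<subseteq> univ (restr U N)" "\<forall>x. x \<notin> set zs \<longrightarrow> w x = v x"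
      have "sat N \<sigma> v" using N \<sigma> by (simp add: Mod_def)
      then have "sat N (Disj I F) w"
        unfolding b(1) sat_foldr_All
        by (elim allE[of _ w]) (use w substruct_univ[OF subU] in auto)
      moreover have "w ` free_vars (Disj I F) \<subseteq> univ (restr U N)"
        using w(1) block_closed[OF b(2)] by blast
      ultimately show "sat (restr U N) (Disj I F) w"
        using agree_sat[OF b(2) subU agree[OF b(2)]] by auto
    qed
  qed
  show "elem_sub_star \<tau> \<kappa> frag (restr U N) N"
    unfolding elem_sub_star_iff[OF Mod N subU] by (intro allI impI, elim conjE) (rule agree)
qed

end

section \<open>From axioms to intersections\<close>

context aec
begin

lemma has_intersections_if_forall_Q:
  assumes fe: "functorial_expansion \<K> \<tau>' Kp"
    and T: "forall_Q_theory \<tau>' \<kappa> T"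
    and eq: "expansion_class \<K> \<tau>' Kp = Mod_class \<tau>' \<kappa> (generated_fragment \<tau>' \<kappa> T) T"
  shows "has_intersections \<K>"
  unfolding has_intersections_def
proof (intro ballI allI impI)
  interpret Q: forall_Q \<tau>' \<kappa> T
    using T by unfold_locales (auto simp: forall_Q_theory_def)
  have "models (expansion_class \<K> \<tau>' Kp) = models (Mod_class \<tau>' \<kappa> Q.frag T)" using eq by simp
  then have Kp: "Kp = Mod \<tau>' T" by (simp add: expansion_class_def Mod_class_def)
  have "strong (expansion_class \<K> \<tau>' Kp) = strong (Mod_class \<tau>' \<kappa> Q.frag T)" using eq by simp
  then have strong: "reduct \<tau> M \<preceq> reduct \<tau> N \<longleftrightarrow> elem_sub_star \<tau>' \<kappa> Q.frag M N"
    if "M \<in> Kp" "N \<in> Kp" for M N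
    using that unfolding expansion_class_def Mod_class_def Kp by auto
  have onto: "\<exists>M'\<in>Kp. reduct \<tau> M' = M" if "M \<in> models \<K>" for M
  proof -
    have "reduct \<tau> ` Kp = models \<K>"
      using fe unfolding functorial_expansion_def by (elim conjE) (rule bij_betw_imp_surj_on)
    then show ?thesis using that by (metis imageE)
  qed
  fix N A assume N: "N \<in> models \<K>" and A: "A \<subseteq> univ N"
  obtain N' where N': "N' \<in> Kp" "reduct \<tau> N' = N" using onto[OF N] by blast
  let ?\<M> = "{M \<in> Kp. reduct \<tau> M \<preceq> N \<and> A \<subseteq> univ M}"
  \<comment> \<open>Strong submodels of \<open>N\<close> are reducts of members of
    \<open>Kp\<close>, and reducts keep the universe; so the closure is an intersection over members
    of \<open>Kp\<close>, where \<open>Mod_Inter\<close> applies.\<close>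
  have U: "cl N A = (\<Inter>M\<in>?\<M>. univ M)"
  proof
    show "cl N A \<subseteq> (\<Inter>M\<in>?\<M>. univ M)"
      using closure_subset_strong[of "reduct \<tau> _" N A] by auto
    show "(\<Inter>M\<in>?\<M>. univ M) \<subseteq> cl N A"
      unfolding closure_in_def
    proof (intro Inter_greatest, clarify)
      fix x N0 assume x: "x \<in> (\<Inter>M\<in>?\<M>. univ M)" and N0: "N0 \<preceq> N" "A \<subseteq> univ N0"
      obtain M where M: "M \<in> Kp" "reduct \<tau> M = N0" using onto[OF strong_model1[OF N0(1)]] by blast
      then have "univ M = univ N0" by auto
      then show "x \<in> univ N0" using x M N0 by auto
    qed
  qed
  have "?\<M> \<noteq> {}" using N' A strong_refl[OF N] by auto
  moreover have "M \<in> Mod \<tau>' T \<and> elem_sub_star \<tau>' \<kappa> Q.frag M N'" if "M \<in> ?\<M>" for M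
    using that strong[of M N'] N' Kp by auto
  ultimately have "restr (cl N A) N' \<in> Mod \<tau>' T" "elem_sub_star \<tau>' \<kappa> Q.frag (restr (cl N A) N') N'"
    using Q.Mod_Inter[OF _ _ _ U, of N'] N'(1) Kp by blast+
  then have "reduct \<tau> (restr (cl N A) N') \<preceq> reduct \<tau> N'"
    using strong[of "restr (cl N A) N'" N'] N'(1) Kp by simp
  then show "restr (cl N A) N \<preceq> N" by (simp add: reduct_restr N'(2))
qed

end

section \<open>The expansion by the closure relations\<close>

locale closure_expansion = aec_intersections \<K> for \<K> :: "'u aclass" +
  fixes r :: 'u
  assumes fresh: "RelSym r k \<notin> voc \<K>"
begin

text \<open>One fresh name carries all the new relations, separated by arity: one place for the
  element and \<open>n\<close> for the generating tuple. The symbol with \<open>n = 0\<close>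
  describes the closure of the empty set.\<close>

definition \<tau>' :: "'u symbol set" where
  "\<tau>' = \<tau> \<union> range (\<lambda>n. RelSym r (Suc n))"

text \<open>Only the set of entries of the tuple matters. The guard
  \<open>set xs \<subseteq> univ M\<close> is essential because \<open>cl M\<close> of a set not
  contained in \<open>univ M\<close> is an empty intersection, thus \<open>UNIV\<close>.\<close>

definition E :: "'u struc \<Rightarrow> 'u struc" where
  "E M = M\<lparr>rel_int := (\<lambda>s xs. if s = r
     then xs \<noteq> [] \<and> set xs \<subseteq> univ M \<and> hd xs \<in> cl M (set (tl xs)) else rel_int M s xs)\<rparr>"

lemma univ_E [simp]: "univ (E M) = univ M"
  and fun_int_E [simp]: "fun_int (E M) = fun_int M"
  and rel_int_E: "s \<noteq> r \<Longrightarrow> rel_int (E M) s xs = rel_int M s xs"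
  and rel_int_E_Nil [simp]: "\<not> rel_int (E M) r []"
  and rel_int_E_Cons [simp]: "rel_int (E M) r (x # b) \<longleftrightarrow>
    x \<in> univ M \<and> set b \<subseteq> univ M \<and> x \<in> cl M (set b)"
  by (auto simp: E_def)

lemma FunSym_expansion [simp]: "FunSym f k \<in> \<tau>' \<longleftrightarrow> FunSym f k \<in> \<tau>"
  and RelSym_expansion: "s \<noteq> r \<Longrightarrow> RelSym s k \<in> \<tau>' \<longleftrightarrow> RelSym s k \<in> \<tau>"
  and RelSym_expansion_fresh [simp]: "RelSym r (Suc k) \<in> \<tau>'"
  and voc_subset: "\<tau> \<subseteq> \<tau>'"
  by (auto simp: \<tau>'_def)

lemma rel_int_fresh: "M \<in> models \<K> \<Longrightarrow> \<not> rel_int M r xs"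
  using is_struct_rel[OF struct_model] fresh by blast

lemma E_struct:
  assumes M: "M \<in> models \<K>"
  shows "is_struct \<tau>' (E M)"
  unfolding is_struct_def
proof (intro conjI allI impI)
  show "small (univ (E M))" using is_struct_small[OF struct_model[OF M]] by simp
  fix f xs
  show "if FunSym f (length xs) \<in> \<tau>' \<and> set xs \<subseteq> univ (E M)
    then fun_int (E M) f xs \<in> univ (E M) else fun_int (E M) f xs = undefined"
    using is_struct_fun[OF struct_model[OF M]] is_struct_undefined[OF struct_model[OF M]] by simp
next
  fix s xs assume s: "rel_int (E M) s xs"
  show "RelSym s (length xs) \<in> \<tau>'"
    using s is_struct_rel[OF struct_model[OF M], of s xs] voc_subset
    by (cases "s = r"; cases xs) (auto simp: rel_int_E)
  show "set xs \<subseteq> univ (E M)"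
    using s is_struct_rel[OF struct_model[OF M], of s xs]
    by (cases "s = r"; cases xs) (auto simp: rel_int_E)
qed

lemma reduct_E:
  assumes M: "M \<in> models \<K>"
  shows "reduct \<tau> (E M) = M"
proof (rule struc_eqI)
  fix f xs
  show "fun_int (reduct \<tau> (E M)) f xs = fun_int M f xs"
    using is_struct_undefined[OF struct_model[OF M], of f xs] by (auto simp: fun_int_reduct)
  show "rel_int (reduct \<tau> (E M)) f xs = rel_int M f xs"
    using is_struct_rel[OF struct_model[OF M], of f xs] rel_int_fresh[OF M] fresh
    by (cases "f = r") (auto simp: rel_int_reduct rel_int_E)
qed simp

lemma E_iso:
  assumes M: "M \<in> models \<K>" and g: "iso \<tau> g M N"
  shows "iso \<tau>' g (E M) (E N)"
  unfolding iso_def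
proof (intro conjI allI impI; (elim conjE)?)
  have N: "N \<in> models \<K>" using M g by (rule iso_model)
  show "is_struct \<tau>' (E M)" "is_struct \<tau>' (E N)" using E_struct[OF M] E_struct[OF N] by simp_all
  have b: "bij_betw g (univ M) (univ N)" using g by (rule iso_bij)
  then show "bij_betw g (univ (E M)) (univ (E N))" by simp
  show "g (fun_int (E M) f xs) = fun_int (E N) f (map g xs)"
    if "FunSym f (length xs) \<in> \<tau>'" "set xs \<subseteq> univ (E M)" for f xs
    using that iso_fun[OF g] by simp
  fix s xs assume xs: "set xs \<subseteq> univ (E M)"
  show "rel_int (E M) s xs = rel_int (E N) s (map g xs)"
  proof (cases "s = r")
    case False
    then show ?thesis using iso_rel[OF g, of xs s] xs by (simp add: rel_int_E)
  next
    case True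
    show ?thesis
    proof (cases xs)
      case (Cons x c)
      then have x: "x \<in> univ M" and c: "set c \<subseteq> univ M" using xs by auto
      have "g x \<in> univ N" "g ` set c \<subseteq> univ N" using x c b by (auto simp: bij_betw_def)
      moreover have "g x \<in> g ` cl M (set c) \<longleftrightarrow> x \<in> cl M (set c)"
        using x closure_subset[OF M c] b by (meson bij_betw_def inj_on_image_mem_iff)
      ultimately show ?thesis
        using x c True Cons closure_iso[OF M g c] by simp
    qed (simp add: True)
  qed
qed

lemma E_substruct:
  assumes "M \<preceq> N"
  shows "substruct \<tau>' (E M) (E N)"
  unfolding substruct_def
proof (intro conjI allI impI; (elim conjE)?)
  have sub: "substruct \<tau> M N" using assms by (rule strong_substruct)
  show "is_struct \<tau>' (E M)" "is_struct \<tau>' (E N)"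
    using assms by (blast intro: E_struct strong_model1 strong_model2)+
  show "univ (E M) \<subseteq> univ (E N)" using substruct_univ[OF sub] by simp
  show "fun_int (E M) f xs = fun_int (E N) f xs"
    if "FunSym f (length xs) \<in> \<tau>'" "set xs \<subseteq> univ (E M)" for f xs
    using that sub by (simp add: substruct_def)
  fix s xs assume xs: "set xs \<subseteq> univ (E M)"
  show "rel_int (E M) s xs = rel_int (E N) s xs"
  proof (cases "s = r")
    case False
    then show ?thesis using substruct_rel[OF sub, of xs s] xs by (simp add: rel_int_E)
  next
    case True
    then show ?thesis
      using xs substruct_univ[OF sub] closure_strong_eq[OF assms, of "set (tl xs)"]
      by (cases xs) auto
  qed
qed

lemma functorial_expansion_E:
  assumes "natLeq <o |UNIV :: 'u set|"
  shows "functorial_expansion \<K> \<tau>' (E ` models \<K>)"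
  unfolding functorial_expansion_def
proof (intro conjI ballI allI impI)
  have inf: "infinite (UNIV :: 'u set)"
    using assms infinite_iff_natLeq_ordLeq ordLess_imp_ordLeq by blast
  have "|range (\<lambda>n. RelSym r (Suc n))| \<le>o natLeq"
    using ordLeq_ordIso_trans[OF card_of_image card_of_nat] .
  then have "|range (\<lambda>n. RelSym r (Suc n))| <o |UNIV :: 'u set|"
    using assms by (rule ordLeq_ordLess_trans)
  then show "vocabulary \<tau>'"
    using vocabulary_voc card_of_Un_ordLess_infinite[OF inf]
    unfolding vocabulary_def \<tau>'_def by blast
  show "\<tau> \<subseteq> \<tau>'" by (rule voc_subset)
  show "is_struct \<tau>' M" if "M \<in> E ` models \<K>" for M
    using that E_struct by blast
  show "bij_betw (reduct \<tau>) (E ` models \<K>) (models \<K>)"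
    by (rule bij_betw_byWitness[where f' = E]) (auto simp: reduct_E)
  show "iso \<tau>' g M N" if "M \<in> E ` models \<K>" "N \<in> E ` models \<K>"
    "iso \<tau> g (reduct \<tau> M) (reduct \<tau> N)" for M N g
    using that E_iso by (auto simp: reduct_E)
  show "substruct \<tau>' M N" if "M \<in> E ` models \<K>" "N \<in> E ` models \<K>"
    "reduct \<tau> M \<preceq> reduct \<tau> N" for M N
    using that E_substruct by (auto simp: reduct_E)
qed

section \<open>R-sets and the recognition of expanded models\<close>

definition R_set :: "'u struc \<Rightarrow> 'u list \<Rightarrow> 'u set" where
  "R_set N b = {x \<in> univ N. rel_int N r (x # b)}"

lemma R_set_E: "N \<in> models \<K> \<Longrightarrow> set b \<subseteq> univ N \<Longrightarrow> R_set (E N) b = cl N (set b)"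
  using closure_subset by (auto simp: R_set_def)

text \<open>
  What the axioms say about a tuple \<open>b\<close>: its \<open>R\<close>-set carries a member of the expanded class
  that is generated by \<open>b\<close>.
\<close>

definition closed_at :: "'u struc \<Rightarrow> 'u list \<Rightarrow> bool" where
  "closed_at N b \<longleftrightarrow> fun_closed \<tau>' N (R_set N b) \<and> set b \<subseteq> R_set N b \<and>
     restr (R_set N b) N \<in> E ` models \<K> \<and>
     cl (reduct \<tau> (restr (R_set N b) N)) (set b) = R_set N b"

text \<open>The closure of \<open>b\<close> is a strong submodel: its expansion is therefore a
  restriction of \<open>E N\<close>, and the closure of \<open>b\<close> is the same inside
  it.\<close>

lemma closed_at_E:
  assumes N: "N \<in> models \<K>" and b: "set b \<subseteq> univ N"
  shows "closed_at (E N) b"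
proof -
  let ?P = "cl N (set b)"
  have P: "restr ?P N \<preceq> N" using closure_strong[OF N b] .
  have sub: "substruct \<tau>' (E (restr ?P N)) (E N)" using E_substruct[OF P] .
  have "restr ?P (E N) = E (restr ?P N)" using substruct_eq_restr[OF sub] by simp
  moreover have "cl (restr ?P N) (set b) = ?P"
    using closure_strong_eq[OF P, of "set b"] subset_closure[of "set b" N] by simp
  ultimately show ?thesis
    using substruct_closed[OF sub] subset_closure[of "set b" N] strong_model1[OF P]
    by (simp add: closed_at_def R_set_E[OF N b] reduct_E)
qed

text \<open>
  Since \<open>R\<close> is interpreted as closure in each of the structures on the sets \<open>R_set N b\<close>, the
  comparison of \<open>R_set N b\<close> and \<open>R_set N c\<close> for \<open>set b \<subseteq> set c\<close> may be carried out,
  elementwise in \<open>x \<in> R_set N b\<close>, inside the structure on \<open>R_set N (x # c)\<close>.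
\<close>

lemma model_if_closed_at:
  assumes N: "is_struct \<tau>' N" and closed: "\<And>b. set b \<subseteq> univ N \<Longrightarrow> closed_at N b"
    and reg: "regularCard |UNIV :: 'u set|"
  shows "N \<in> E ` models \<K>"
proof -
  let ?N = "reduct \<tau> N"
  define S where "S b = restr (R_set N b) ?N" for b
  have R_univ: "R_set N b \<subseteq> univ N" for b by (auto simp: R_set_def)
  have univ_S [simp]: "univ (S b) = R_set N b" for b by (simp add: S_def)
  have R_gen: "set b \<subseteq> R_set N b" and S_model: "S b \<in> models \<K>"
    and S_E: "restr (R_set N b) N = E (S b)" and S_cl: "cl (S b) (set b) = R_set N b"
    if b: "set b \<subseteq> univ N" for b
  proof -
    have *: "closed_at N b" using closed[OF b] .
    then show "set b \<subseteq> R_set N b" by (simp add: closed_at_def)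
    obtain M where M: "M \<in> models \<K>" "restr (R_set N b) N = E M"
      using * by (auto simp: closed_at_def)
    then have S: "S b = M" by (simp add: S_def flip: reduct_restr) (simp add: reduct_E)
    then show "S b \<in> models \<K>" "restr (R_set N b) N = E (S b)" using M by auto
    show "cl (S b) (set b) = R_set N b"
      using * by (simp add: closed_at_def S_def reduct_restr)
  qed
  \<comment> \<open>Membership in \<open>R_set N c\<close> is an atomic fact, so it can be read off
    in the piece on \<open>R_set N b\<close>, where the new relation is known to be closure.\<close>
  have R_local: "x \<in> R_set N c \<longleftrightarrow> x \<in> cl (S b) (set c)"
    if b: "set b \<subseteq> univ N" and c: "set c \<subseteq> R_set N b" and x: "x \<in> R_set N b" for b c x
  proof -
    have "x \<in> univ N" using x R_univ by blast
    then have "x \<in> R_set N c \<longleftrightarrow> rel_int N r (x # c)" by (simp add: R_set_def)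
    also have "\<dots> \<longleftrightarrow> rel_int (E (S b)) r (x # c)"
      unfolding S_E[OF b, symmetric] using c x by (simp add: rel_int_restr)
    also have "\<dots> \<longleftrightarrow> x \<in> cl (S b) (set c)" using c x by simp
    finally show ?thesis .
  qed
  have R_mono: "R_set N b \<subseteq> R_set N c" if c: "set c \<subseteq> univ N" and bc: "set b \<subseteq> set c" for b c
  proof
    fix x assume x: "x \<in> R_set N b"
    let ?d = "x # c"
    have d: "set ?d \<subseteq> univ N" using c x R_univ by auto
    have cd: "set c \<subseteq> R_set N ?d" and xd: "x \<in> R_set N ?d" using R_gen[OF d] by auto
    have "x \<in> cl (S ?d) (set b)"
      using R_local[OF d _ xd, of b] x bc cd by blast
    then have "x \<in> cl (S ?d) (set c)"
      using closure_mono[OF S_model[OF d], of "set c" "set b"] bc cd by auto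
    then show "x \<in> R_set N c" using R_local[OF d cd xd] by blast
  qed
  have S_strong: "S b \<preceq> S c" if c: "set c \<subseteq> univ N" and bc: "set b \<subseteq> set c" for b c
  proof -
    have bR: "set b \<subseteq> R_set N c" using bc R_gen[OF c] by blast
    \<comment> \<open>Both inclusions are \<open>R_local\<close> inside \<open>S c\<close>; that
      \<open>R_set N b\<close> lies in it at all is \<open>R_mono\<close>. As a closure in
      \<open>S c\<close>, the piece of \<open>b\<close> is strong there.\<close>
    have "cl (S c) (set b) = R_set N b"
    proof
      show "cl (S c) (set b) \<subseteq> R_set N b"
        using closure_subset[OF S_model[OF c], of "set b"] R_local[OF c bR] bR by auto
      show "R_set N b \<subseteq> cl (S c) (set b)"
        using R_mono[OF c bc] R_local[OF c bR] by blast
    qed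
    then show ?thesis
      using closure_strong[OF S_model[OF c], of "set b"] bR R_mono[OF c bc]
      by (simp add: S_def restr_restr)
  qed
  \<comment> \<open>The R-set depends a priori on the listing of the tuple, so one listing of each
    finite set is chosen; \<open>R_mono\<close> in both directions removes the dependence.\<close>
  define C where "C B = R_set N (SOME b. set b = B)" for B
  have some: "set (SOME b. set b = B) = B" if "finite B" for B :: "'u set"
    using someI_ex[OF finite_list[OF that]] .
  have N': "is_struct \<tau> ?N" using is_struct_reduct[OF N voc_subset] .
  have strong: "restr (fin_hull C B) ?N \<preceq> restr (fin_hull C X) ?N"
    if "B \<subseteq> X" "X \<subseteq> univ N" for B X
  proof (rule directed_union_strong[OF N' _ _ reg])
    fix b c :: "'u set" assume *: "finite c" "c \<subseteq> univ ?N" "b \<subseteq> c"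
    then have "finite b" using finite_subset by blast
    with * show "restr (C b) ?N \<preceq> restr (C c) ?N"
      using S_strong[of "SOME b. set b = c" "SOME c. set c = b"] some
      by (simp add: C_def S_def)
  qed (use that in \<open>auto simp: C_def R_set_def\<close>)
  have "fin_hull C (univ N) = univ N"
  proof
    show "fin_hull C (univ N) \<subseteq> univ N" by (auto simp: mem_fin_hull C_def R_set_def)
    show "univ N \<subseteq> fin_hull C (univ N)"
    proof
      fix x assume x: "x \<in> univ N"
      then have "x \<in> C {x}"
        using R_gen[of "SOME b. set b = {x}"] some[of "{x}"] by (simp add: C_def)
      with x show "x \<in> fin_hull C (univ N)"
        unfolding mem_fin_hull by (intro exI[of _ "{x}"]) simp
    qed
  qed
  then have top: "restr (fin_hull C (univ N)) ?N = ?N"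
    using restr_univ[OF N'] by simp
  then have model: "?N \<in> models \<K>" using strong[of "univ N" "univ N"] strong_model1 by simp
  have S_top: "S b \<preceq> ?N" if b: "set b \<subseteq> univ N" for b
  proof -
    have "fin_hull C (set b) = C (set b)"
    proof (rule fin_hull_finite)
      fix c assume "c \<subseteq> set b"
      then show "C c \<subseteq> C (set b)"
        unfolding C_def using some[of c] some[of "set b"] b finite_subset[of c "set b"]
        by (intro R_mono) auto
    qed simp
    also have "\<dots> = R_set N b"
      unfolding C_def using some[of "set b"] b by (intro equalityI R_mono) auto
    finally show ?thesis
      using strong[of "set b" "univ N"] b top by (simp add: S_def)
  qed
  have "N = E ?N"
  proof (rule struc_eqI)
    fix f xs
    show "fun_int N f xs = fun_int (E ?N) f xs"
      using is_struct_undefined[OF N, of f xs] by (simp add: fun_int_reduct)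
    show "rel_int N f xs = rel_int (E ?N) f xs"
    proof (cases "f = r")
      case False
      then show ?thesis
        using is_struct_rel[OF N, of f xs] RelSym_expansion[OF False]
        by (auto simp: rel_int_E rel_int_reduct)
    next
      case True
      show ?thesis
      proof (cases xs)
        case Nil
        have "RelSym r 0 \<notin> \<tau>'" using fresh by (auto simp: \<tau>'_def)
        then show ?thesis using is_struct_rel[OF N, of r "[]"] True Nil by auto
      next
        case (Cons x b)
        show ?thesis
        proof (cases "set xs \<subseteq> univ N")
          case inN: True
          then have b: "set b \<subseteq> univ N" and x: "x \<in> univ N" using Cons by auto
          \<comment> \<open>Each piece is strong in the reduct \<open>?N\<close>, so the closure of
            \<open>b\<close> may be computed in its own piece, where it is everything.\<close>
          have "cl ?N (set b) = R_set N b"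
            using closure_strong_eq[OF S_top[OF b], of "set b"] R_gen[OF b] S_cl[OF b] by simp
          then show ?thesis using b x True Cons by (simp add: R_set_def)
        next
          case False
          then show ?thesis using is_struct_rel[OF N, of f xs] True Cons by auto
        qed
      qed
    qed
  qed simp
  then show ?thesis using model by blast
qed

text \<open>For the nontrivial direction, \<open>univ M\<close> and \<open>univ N\<close> are the
  directed unions of the closures in \<open>N\<close> of their finite subsets, and
  \<open>directed_union_strong\<close> applies to these closures.\<close>

lemma strong_iff_closure:
  assumes M: "M \<in> models \<K>" and N: "N \<in> models \<K>" and reg: "regularCard |UNIV :: 'u set|"
  shows "M \<preceq> N \<longleftrightarrow> substruct \<tau> M N \<and> (\<forall>b. finite b \<and> b \<subseteq> univ M \<longrightarrow> cl M b = cl N b)"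
proof
  assume "M \<preceq> N"
  then show "substruct \<tau> M N \<and> (\<forall>b. finite b \<and> b \<subseteq> univ M \<longrightarrow> cl M b = cl N b)"
    using strong_substruct closure_strong_eq by blast
next
  assume *: "substruct \<tau> M N \<and> (\<forall>b. finite b \<and> b \<subseteq> univ M \<longrightarrow> cl M b = cl N b)"
  then have sub: "univ M \<subseteq> univ N" by (blast dest: substruct_univ)
  have strong: "restr (fin_hull (cl N) (univ M)) N \<preceq> restr (fin_hull (cl N) (univ N)) N"
  proof (rule directed_union_strong[OF struct_model[OF N] _ _ reg sub subset_refl])
    show "cl N b \<subseteq> univ N" if "b \<subseteq> univ N" for b using closure_subset[OF N that] .
    fix b c assume c: "c \<subseteq> univ N" "b \<subseteq> c"
    then show "restr (cl N b) N \<preceq> restr (cl N c) N"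
      using closure_strong[OF N, of b] closure_strong[OF N, of c] closure_mono[OF N, of c b]
      by (intro coherence_restr) auto
  qed
  have hull: "fin_hull (cl N) (univ L) = univ L"
    if L: "L \<in> models \<K>" "\<And>b. finite b \<Longrightarrow> b \<subseteq> univ L \<Longrightarrow> cl L b = cl N b" for L
  proof
    show "fin_hull (cl N) (univ L) \<subseteq> univ L"
    proof
      fix x assume "x \<in> fin_hull (cl N) (univ L)"
      then obtain b where "finite b" "b \<subseteq> univ L" "x \<in> cl N b" unfolding mem_fin_hull by blast
      then show "x \<in> univ L" using L closure_subset[OF L(1), of b] by auto
    qed
    show "univ L \<subseteq> fin_hull (cl N) (univ L)"
    proof
      fix x assume "x \<in> univ L"
      then show "x \<in> fin_hull (cl N) (univ L)"
        unfolding mem_fin_hull using subset_closure[of "{x}" N] by (intro exI[of _ "{x}"]) simp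
    qed
  qed
  have "restr (univ M) N \<preceq> N"
    using strong hull[OF M] hull[OF N] * restr_univ[OF struct_model[OF N]] by auto
  then show "M \<preceq> N" using substruct_eq_restr[of \<tau> M N] * by simp
qed

end

section \<open>Cardinalities\<close>

lemma card_of_lists_infinite:
  assumes "infinite A"
  shows "|lists A| \<le>o |A|"
proof -
  have A: "A \<noteq> {}" using assms by auto
  have n: "|{xs \<in> lists A. length xs = n}| \<le>o |A|" for n
  proof (induction n)
    case 0
    have "{xs \<in> lists A. length xs = 0} = {[]}" by auto
    then show ?case using card_of_singl_ordLeq[OF A] by metis
  next
    case (Suc n)
    let ?L = "{xs \<in> lists A. length xs = n}"
    have "{xs \<in> lists A. length xs = Suc n} \<subseteq> (\<lambda>(x, xs). x # xs) ` (A \<times> ?L)"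
      by (auto simp: length_Suc_conv image_iff)
    then have "|{xs \<in> lists A. length xs = Suc n}| \<le>o |A \<times> ?L|" by (rule surj_imp_ordLeq)
    moreover have "|A \<times> ?L| \<le>o |A|"
      using Suc assms by (intro card_of_Sigma_ordLeq_infinite) (auto intro: card_of_mono1)
    ultimately show ?case by (rule ordLeq_transitive)
  qed
  have "lists A = (\<Union>n. {xs \<in> lists A. length xs = n})" by auto
  moreover have "|\<Union>n. {xs \<in> lists A. length xs = n}| \<le>o |A|"
  proof (rule card_of_UNION_ordLeq_infinite[OF assms])
    show "|UNIV :: nat set| \<le>o |A|" using assms unfolding infinite_iff_card_of_nat .
  qed (use n in blast)
  ultimately show ?thesis by simp
qed

lemma card_of_Pow_mono:
  assumes "|A| \<le>o |B|"
  shows "|Pow A| \<le>o |Pow B|"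
proof -
  obtain f where "inj_on f A" "f ` A \<subseteq> B" using assms unfolding card_of_ordLeq[symmetric] by blast
  then have "inj_on (image f) (Pow A)" "image f ` Pow A \<subseteq> Pow B"
    by (auto simp: inj_on_image_Pow)
  then show ?thesis unfolding card_of_ordLeq[symmetric] by blast
qed

text \<open>
  A pair of a structure with universe inside \<open>A\<close> and a tuple from \<open>A\<close>, coded as a subset of
  \<open>(\<tau> <+> {0, 1}) \<times> lists A\<close>.
\<close>

definition struct_code :: "'u symbol set \<Rightarrow> 'u struc \<times> 'u list \<Rightarrow> (('u symbol + nat) \<times> 'u list) set" where
  "struct_code \<tau> = (\<lambda>(M, as). (\<lambda>x. (Inr 0, [x])) ` univ M \<union> {(Inr 1, as)} \<union>
     {(Inl (RelSym s (length xs)), xs) | s xs. rel_int M s xs} \<union>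
     {(Inl (FunSym f (length xs)), y # xs) | f xs y.
       FunSym f (length xs) \<in> \<tau> \<and> set xs \<subseteq> univ M \<and> y \<in> univ M \<and> fun_int M f xs = y})"

lemma card_of_structs:
  fixes A :: "'u set"
  assumes A: "infinite A" "|\<tau>| \<le>o |A|"
    and W: "\<And>M as. (M, as) \<in> W \<Longrightarrow> is_struct \<tau> M \<and> univ M \<subseteq> A \<and> set as \<subseteq> A"
  shows "|W| \<le>o |Pow A|"
proof -
  let ?Z = "(\<tau> <+> {0, 1 :: nat}) \<times> lists A"
  have mem0: "(Inr 0, ys) \<in> struct_code \<tau> (M, as) \<longleftrightarrow> (\<exists>x\<in>univ M. ys = [x])"
    and mem1: "(Inr (Suc 0), ys) \<in> struct_code \<tau> (M, as) \<longleftrightarrow> ys = as"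
    and memR: "(Inl (RelSym s k), ys) \<in> struct_code \<tau> (M, as) \<longleftrightarrow> rel_int M s ys \<and> k = length ys"
    and memF: "(Inl (FunSym f (length xs)), y # xs) \<in> struct_code \<tau> (M, as) \<longleftrightarrow>
      FunSym f (length xs) \<in> \<tau> \<and> set xs \<subseteq> univ M \<and> y \<in> univ M \<and> fun_int M f xs = y"
    for M :: "'u struc" and as ys s k f xs y
    by (auto simp: struct_code_def)
  have inj: "inj_on (struct_code \<tau>) W"
  proof (rule inj_onI)
    fix p q assume pq: "p \<in> W" "q \<in> W" "struct_code \<tau> p = struct_code \<tau> q"
    obtain M as N bs where p: "p = (M, as)" and q: "q = (N, bs)" by (cases p, cases q)
    have M: "is_struct \<tau> M" and N: "is_struct \<tau> N" using W pq p q by blast+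
    have code: "c \<in> struct_code \<tau> (M, as) \<longleftrightarrow> c \<in> struct_code \<tau> (N, bs)" for c
      using pq(3) p q by simp
    have "as = bs" using code[of "(Inr (Suc 0), as)"] by (simp add: mem1)
    moreover have U: "univ M = univ N"
      using code[of "(Inr 0, [_])"] by (auto simp: mem0)
    moreover have "M = N"
    proof (rule struc_eqI[OF U])
      show "rel_int M s xs = rel_int N s xs" for s xs
        using code[of "(Inl (RelSym s (length xs)), xs)"] by (simp add: memR)
      show "fun_int M f xs = fun_int N f xs" for f xs
      proof (cases "FunSym f (length xs) \<in> \<tau> \<and> set xs \<subseteq> univ M")
        case True
        then show ?thesis
          using code[of "(Inl (FunSym f (length xs)), fun_int M f xs # xs)"] is_struct_fun[OF M, of f xs]
          unfolding memF by auto
      next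
        case False
        then show ?thesis using is_struct_undefined[OF M, of f xs] is_struct_undefined[OF N, of f xs] U
          by auto
      qed
    qed
    ultimately show "p = q" using p q by simp
  qed
  have Z: "(c, ys) \<in> ?Z" if W': "(M, as) \<in> W" and c: "(c, ys) \<in> struct_code \<tau> (M, as)" for M as c ys
  proof -
    have M: "is_struct \<tau> M" and U: "univ M \<subseteq> A" "set as \<subseteq> A" using W[OF W'] by blast+
    consider x where "c = Inr 0" "ys = [x]" "x \<in> univ M" | "c = Inr 1" "ys = as"
      | s where "c = Inl (RelSym s (length ys))" "rel_int M s ys"
      | f xs y where "c = Inl (FunSym f (length xs))" "FunSym f (length xs) \<in> \<tau>" "ys = y # xs" "set xs \<subseteq> univ M" "y \<in> univ M"
      using c unfolding struct_code_def by auto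
    then show "(c, ys) \<in> ?Z"
    proof cases
      case (3 s)
      then show ?thesis using is_struct_rel[OF M, of s ys] U by auto
    next
      case (4 f xs y)
      then show ?thesis using U by auto
    qed (use U in auto)
  qed
  have "struct_code \<tau> ` W \<subseteq> Pow ?Z"
  proof (intro image_subsetI PowI subsetI)
    fix p c assume "p \<in> W" "c \<in> struct_code \<tau> p"
    then show "c \<in> ?Z" by (cases p; cases c) (simp only: Z)
  qed
  with inj have "|W| \<le>o |Pow ?Z|" unfolding card_of_ordLeq[symmetric] by blast
  moreover have "|?Z| \<le>o |A|"
  proof (rule card_of_Sigma_ordLeq_infinite[OF A(1)])
    have "|{0, 1 :: nat}| \<le>o |A|"
      using A(1) by (intro card_of_finite_infinite) auto
    then show "|\<tau> <+> {0, 1 :: nat}| \<le>o |A|"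
      using A card_of_Plus_ordLeq_infinite_Field[of "|A|" \<tau> "{0, 1 :: nat}"]
      by (simp add: Field_card_of card_of_card_order_on)
  qed (use card_of_lists_infinite[OF A(1)] in blast)
  ultimately show ?thesis using card_of_Pow_mono[of ?Z A] ordLeq_transitive by blast
qed

section \<open>The axioms of the expansion\<close>

locale closure_axioms = closure_expansion \<K> r for \<K> :: "'u aclass" and r :: 'u +
  fixes ty :: "'i itself"
  assumes set_universe: "set_universe TYPE('u) TYPE('i)"
begin

abbreviation L :: "'u set" where "L \<equiv> ords (LS \<K>)"

lemma uncountable: "natLeq <o |UNIV :: 'u set|"
  and regular: "regularCard |UNIV :: 'u set|"
  and card_Pow_L: "|Pow L| <o |UNIV :: 'i set|"
  using set_universe small_ords[of "LS \<K>"] by (simp_all add: set_universe_def)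

lemma infinite_index: "infinite (UNIV :: 'i set)"
proof -
  have "infinite (Pow L)" using infinite_LS by simp
  then show ?thesis
    using ordLess_imp_ordLeq[OF card_Pow_L] card_of_ordLeq_infinite by blast
qed

text \<open>Variable 0 is bound by the structural quantifier; variables 1 to \<open>n\<close> are
  the parameters.\<close>

definition phi :: "nat \<Rightarrow> ('u, 'i) fm" where
  "phi n = Rel r (map Var [0..<Suc n])"

text \<open>The equations single out the parameters one by one, so an isomorphism has to match the
  tuple in order; by the inclusion clause of \<open>struct_quant\<close> they also force the
  parameters into their R-set.\<close>

definition psis :: "nat \<Rightarrow> ('u, 'i) fm list" where
  "psis n = phi n # map (\<lambda>k. Eq (Var 0) (Var (Suc k))) [0..<n]"

text \<open>
  The disjunct for \<open>absurd\<close> is unsatisfiable: it would map one set onto both \<open>L\<close> and the empty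
  set, since \<open>phi n\<close> is repeated as the head of \<open>psis n\<close>. It keeps the disjunction non-empty
  when \<open>\<K>\<close> has no model with \<open>n\<close> generators. Only universes below \<open>LS \<K>\<close> are listed in
  \<open>generated n\<close>, because all structures on ordinals below the successor cardinal need not form
  a small set.
\<close>

definition absurd :: "'u struc" where
  "absurd = \<lparr>univ = L, fun_int = (\<lambda>_ _. undefined), rel_int = (\<lambda>_ _. False)\<rparr>"

definition generated :: "nat \<Rightarrow> ('u struc \<times> 'u list) set" where
  "generated n = {(M, as). M \<in> models \<K> \<and> (\<exists>a. univ M = ords a \<and> ords a \<subseteq> L) \<and>
     length as = n \<and> set as \<subseteq> univ M \<and> cl M (set as) = univ M}"

text \<open>The marked sets mirror \<open>psis n\<close>: the whole universe for the repeated
  \<open>phi n\<close>, then the generators as singletons. The unsatisfiable disjunct gets a list of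
  matching length.\<close>

definition generators :: "nat \<Rightarrow> ('u symbol set \<times> 'u struc \<times> 'u set list) set" where
  "generators n = insert ({}, absurd, replicate (Suc n) {})
     ((\<lambda>(M, as). (\<tau>', E M, univ M # map (\<lambda>a. {a}) as)) ` generated n)"

text \<open>Only structures in the vocabulary of \<open>\<K>\<close> have to be counted, since they
  determine their expansions; both that vocabulary and the universes are bounded by
  \<open>LS \<K>\<close>, which gives at most as many structures as \<open>L\<close> has
  subsets.\<close>

lemma card_generators: "|generators n| <o |UNIV :: 'i set|"
proof -
  have "|generated n| \<le>o |Pow L|"
    by (rule card_of_structs[OF infinite_LS card_voc_le_LS])
      (auto simp: generated_def intro: struct_model)
  then have "|(\<lambda>(M, as). (\<tau>', E M, univ M # map (\<lambda>a. {a}) as)) ` generated n| <o |UNIV :: 'i set|"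
    using ordLeq_ordLess_trans[OF ordLeq_transitive[OF card_of_image] card_Pow_L] by blast
  moreover have "|{({} :: 'u symbol set, absurd, replicate (Suc n) ({} :: 'u set))}| <o |UNIV :: 'i set|"
    by (rule finite_ordLess_infinite)
      (simp_all add: Field_card_of card_of_well_order_on infinite_index del: replicate_Suc)
  ultimately show ?thesis
    unfolding generators_def insert_is_Un[of _ "_ ` _"] using card_of_Un_ordLess_infinite[OF infinite_index]
    by blast
qed

text \<open>Disjunctions are indexed by elements of \<open>'i\<close>, so the generators are coded
  by an injection; \<open>card_generators\<close> provides one.\<close>

definition index :: "nat \<Rightarrow> 'u symbol set \<times> 'u struc \<times> 'u set list \<Rightarrow> 'i" where
  "index n = (SOME h. inj_on h (generators n))"

lemma inj_index: "inj_on (index n) (generators n)"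
proof -
  have "\<exists>h :: _ \<Rightarrow> 'i. inj_on h (generators n)"
    using ordLess_imp_ordLeq[OF card_generators] card_of_ordLeq[of "generators n" "UNIV :: 'i set"] by blast
  then show ?thesis unfolding index_def by (rule someI_ex)
qed

definition Q_fm :: "nat \<Rightarrow> 'u symbol set \<times> 'u struc \<times> 'u set list \<Rightarrow> ('u, 'i) fm" where
  "Q_fm n = (\<lambda>(\<tau>\<^sub>0, M, As). QStruct \<tau>\<^sub>0 M As 0 (phi n) (replicate (Suc n) 0) (psis n))"

abbreviation index_set :: "nat \<Rightarrow> 'i set" where "index_set n \<equiv> index n ` generators n"

definition disjunct :: "nat \<Rightarrow> 'i \<Rightarrow> ('u, 'i) fm" where
  "disjunct n i = Q_fm n (inv_into (generators n) (index n) i)"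

definition matrix :: "nat \<Rightarrow> ('u, 'i) fm" where
  "matrix n = Disj (index_set n) (disjunct n)"

text \<open>For \<open>n = 0\<close> there is no quantifier, so the statement on the closure of the
  empty set is imposed on the empty structure too.\<close>

definition axiom :: "nat \<Rightarrow> ('u, 'i) fm" where
  "axiom n = foldr All [1..<Suc n] (matrix n)"

lemma disjunct_index: "disjunct n ` index_set n = Q_fm n ` generators n"
proof -
  have "disjunct n (index n s) = Q_fm n s" if "s \<in> generators n" for s
    using that by (simp add: disjunct_def inv_into_f_f[OF inj_index])
  then show ?thesis by (simp add: image_image)
qed

section \<open>The axioms form a universal structural theory\<close>

lemma length_psis [simp]: "length (psis n) = Suc n"
  by (simp add: psis_def)

lemma free_vars_phi: "free_vars (phi n) = {..n}"
  by (auto simp: phi_def)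

lemma free_vars_psis: "k \<le> n \<Longrightarrow> free_vars (psis n ! k) \<subseteq> {..n}"
  by (cases k) (auto simp: psis_def free_vars_phi)

lemma free_vars_Q_fm: "free_vars (Q_fm n s) = {1..n}"
proof -
  obtain \<tau>\<^sub>0 M As where s: "s = (\<tau>\<^sub>0, M, As)" by (cases s)
  have "free_vars (Q_fm n s) = ({..n} - {0}) \<union> (\<Union>k<Suc n. free_vars (psis n ! k) - {replicate (Suc n) 0 ! k})"
    unfolding s Q_fm_def prod.case
    by (subst free_vars_QStruct) (simp_all only: length_psis length_replicate free_vars_phi)
  also have "\<dots> = {1..n}"
    using free_vars_psis[of _ n] by (fastforce simp: nth_replicate less_Suc_eq_le simp del: replicate_Suc)
  finally show ?thesis .
qed

lemma free_vars_matrix: "free_vars (matrix n) = {1..n}"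
proof -
  have "free_vars (matrix n) = (\<Union>\<theta>\<in>disjunct n ` index_set n. free_vars \<theta>)"
    by (simp add: matrix_def)
  also have "\<dots> = {1..n}"
    unfolding disjunct_index using free_vars_Q_fm[of n] by (auto simp: generators_def)
  finally show ?thesis .
qed

abbreviation \<kappa> :: "'u set rel" where "\<kappa> \<equiv> cardSuc |L|"

lemma phi_formula: "phi n \<in> formulas \<tau>' \<kappa>"
proof -
  have "phi n \<in> atomic_formulas \<tau>'"
    unfolding atomic_formulas_def phi_def
    by (rule UnI2, rule CollectI, rule exI[of _ r], rule exI[of _ "map Var [0..<Suc n]"])
      (auto intro: terms.intros simp del: upt_Suc)
  then show ?thesis by (rule formulas.intros)
qed

lemma psis_formula: "\<psi> \<in> set (psis n) \<Longrightarrow> \<psi> \<in> formulas \<tau>' \<kappa>"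
proof -
  assume "\<psi> \<in> set (psis n)"
  then consider "\<psi> = phi n" | k where "\<psi> = Eq (Var 0) (Var (Suc k))"
    by (auto simp: psis_def)
  then show ?thesis
  proof cases
    case (2 k)
    have "\<psi> \<in> atomic_formulas \<tau>'"
      unfolding 2 atomic_formulas_def by (auto intro: terms.intros)
    then show ?thesis by (rule formulas.intros)
  qed (simp add: phi_formula)
qed

lemma psis_quantifier_free: "\<psi> \<in> set (psis n) \<Longrightarrow> quantifier_free \<psi>"
  and phi_quantifier_free: "quantifier_free (phi n)"
  by (auto simp: psis_def phi_def intro: quantifier_free.intros)

lemma Q_fm_formula:
  assumes "s \<in> generators n"
  shows "Q_fm n s \<in> formulas \<tau>' \<kappa>"
proof -
  have card: "|ords a| <o \<kappa>" if "ords a \<subseteq> L" for a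
    using that card_of_mono1[OF that] cardSuc_ordLeq_ordLess[OF card_of_Card_order card_of_Card_order]
    by blast
  obtain \<tau>\<^sub>0 M As where s: "s = (\<tau>\<^sub>0, M, As)" by (cases s)
  have "\<tau>\<^sub>0 \<subseteq> \<tau>' \<and> is_struct \<tau>\<^sub>0 M \<and> (\<exists>a. univ M = ords a \<and> ords a \<subseteq> L) \<and>
    (\<forall>A\<in>set As. A \<subseteq> univ M) \<and> length As = Suc n"
    using assms unfolding generators_def
  proof
    assume "s = ({}, absurd, replicate (Suc n) {})"
    then show ?thesis
      using small_ords[of "LS \<K>"] unfolding s by (auto simp: absurd_def is_struct_def)
  next
    assume "s \<in> (\<lambda>(M, as). (\<tau>', E M, univ M # map (\<lambda>a. {a}) as)) ` generated n"
    then show ?thesis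
      unfolding s by (auto simp: generated_def E_struct)
  qed
  then obtain a where *: "\<tau>\<^sub>0 \<subseteq> \<tau>'" "is_struct \<tau>\<^sub>0 M" "univ M = ords a" "ords a \<subseteq> L"
    "\<And>A. A \<in> set As \<Longrightarrow> A \<subseteq> univ M" "length As = Suc n" by blast
  show ?thesis
    unfolding s Q_fm_def prod.case
    by (rule formulas.intros(7)[OF *(1-3) card[OF *(4)]])
      (use * phi_formula psis_formula in \<open>simp_all del: replicate_Suc\<close>)
qed

definition T :: "('u, 'i) fm set" where "T = range axiom"

lemma forall_Q_theory_T: "forall_Q_theory \<tau>' \<kappa> T"
  unfolding forall_Q_theory_def
proof (intro conjI ballI)
  have m: "matrix n \<in> formulas \<tau>' \<kappa>" for n
    unfolding matrix_def
  proof (rule formulas.intros(4))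
    show "|index_set n| <o |UNIV :: 'i set|"
      using ordLeq_ordLess_trans[OF card_of_image card_generators] .
    show "finite (\<Union>i\<in>index_set n. free_vars (disjunct n i))"
      using free_vars_matrix[of n] by (simp add: matrix_def)
    fix i assume "i \<in> index_set n"
    then have "disjunct n i \<in> Q_fm n ` generators n" unfolding disjunct_index[symmetric] by (rule imageI)
    then obtain s where "s \<in> generators n" "disjunct n i = Q_fm n s" by (rule imageE)
    then show "disjunct n i \<in> formulas \<tau>' \<kappa>" by (simp only: Q_fm_formula)
  qed
  have "foldr All zs \<theta> \<in> formulas \<tau>' \<kappa>" if "\<theta> \<in> formulas \<tau>' \<kappa>" for zs and \<theta> :: "('u, 'i) fm"
    using that by (induction zs) (auto intro: formulas.intros(6))
  then show "T \<subseteq> sentences \<tau>' \<kappa>"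
    using m by (auto simp: T_def sentences_def axiom_def free_vars_matrix)
  have "|T| \<le>o |UNIV :: nat set|" unfolding T_def by (rule card_of_image)
  moreover have "|UNIV :: nat set| \<le>o |L|" using infinite_LS unfolding infinite_iff_card_of_nat .
  ultimately have "|T| \<le>o |L|" by (rule ordLeq_transitive)
  then have "|T| \<le>o |Pow L|" using ordLess_imp_ordLeq[OF card_of_Pow] by (rule ordLeq_transitive)
  then show "|T| <o |UNIV :: 'i set|" using card_Pow_L by (rule ordLeq_ordLess_trans)
  fix \<sigma> assume "\<sigma> \<in> T"
  then obtain n where \<sigma>: "\<sigma> = axiom n" by (auto simp: T_def)
  show "is_forall_Q \<sigma>"
    unfolding is_forall_Q_def
  proof (intro exI conjI)
    show "\<sigma> = foldr All [1..<Suc n] (Disj (index_set n) (disjunct n))"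
      by (simp add: \<sigma> axiom_def matrix_def)
    show "generators n \<noteq> {}" by (simp add: generators_def)
    show "disjunct n ` index_set n =
      (\<lambda>(\<tau>\<^sub>0, M, As). QStruct \<tau>\<^sub>0 M As 0 (phi n) (replicate (Suc n) 0) (psis n)) ` generators n"
      unfolding disjunct_index Q_fm_def ..
    show "quantifier_free (phi n)" by (rule phi_quantifier_free)
    show "\<forall>\<psi>\<in>set (psis n). quantifier_free \<psi>" using psis_quantifier_free by blast
  qed
qed

sublocale Q: forall_Q \<tau>' \<kappa> T
  using forall_Q_theory_T by unfold_locales (auto simp: forall_Q_theory_def)

subsection \<open>The models of the axioms\<close>

lemma map_upt_Suc_eq: "(\<And>k. k < n \<Longrightarrow> v (Suc k) = b ! k) \<Longrightarrow> length b = n \<Longrightarrow> map v [1..<Suc n] = b"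
  by (rule nth_equalityI) (auto simp: nth_append simp del: upt_Suc)

lemma def_set_phi: "def_set N 0 (phi n) v = R_set N (map v [1..<Suc n])"
proof -
  have "map (v(0 := a)) [0..<Suc n] = a # map v [1..<Suc n]" for a
    by (simp add: upt_conv_Cons del: upt_Suc)
  moreover have "map (tm_val N w) (map Var xs) = map w xs" for w xs
    by simp
  ultimately have "sat N (phi n) (v(0 := a)) \<longleftrightarrow> rel_int N r (a # map v [1..<Suc n])" for a
    by (simp only: phi_def sat.simps)
  then show ?thesis by (simp add: def_set_def R_set_def del: upt_Suc)
qed

lemma def_set_psis:
  assumes "v ` {1..n} \<subseteq> univ N"
  shows "map (\<lambda>k. def_set N (replicate (Suc n) 0 ! k) (psis n ! k) v) [0..<Suc n] =
    R_set N (map v [1..<Suc n]) # map (\<lambda>c. {c}) (map v [1..<Suc n])"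
proof (rule nth_equalityI)
  fix k assume k: "k < length (map (\<lambda>k. def_set N (replicate (Suc n) 0 ! k) (psis n ! k) v) [0..<Suc n])"
  have y: "replicate (Suc n) 0 ! k = 0" using k by (simp add: nth_replicate del: replicate_Suc)
  have "def_set N 0 (psis n ! k) v = (R_set N (map v [1..<Suc n]) # map (\<lambda>c. {c}) (map v [1..<Suc n])) ! k"
  proof (cases k)
    case 0
    then show ?thesis by (simp add: psis_def def_set_phi del: upt_Suc)
  next
    case (Suc j)
    then have "v k \<in> univ N" using k assms by auto
    then show ?thesis using k Suc by (auto simp: psis_def def_set_def simp del: upt_Suc)
  qed
  then show "map (\<lambda>k. def_set N (replicate (Suc n) 0 ! k) (psis n ! k) v) [0..<Suc n] ! k =
    (R_set N (map v [1..<Suc n]) # map (\<lambda>c. {c}) (map v [1..<Suc n])) ! k"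
    using k y by (simp del: upt_Suc replicate_Suc)
qed simp

lemma sat_matrix:
  assumes "v ` {1..n} \<subseteq> univ N"
  shows "sat N (matrix n) v \<longleftrightarrow> (\<exists>(\<tau>\<^sub>0, M, As)\<in>generators n.
    struct_quant N \<tau>\<^sub>0 M As (R_set N (map v [1..<Suc n]))
      (R_set N (map v [1..<Suc n]) # map (\<lambda>c. {c}) (map v [1..<Suc n])))"
proof -
  have "sat N (matrix n) v \<longleftrightarrow> (\<exists>\<theta>\<in>disjunct n ` index_set n. sat N \<theta> v)"
    by (simp add: matrix_def)
  also have "\<dots> \<longleftrightarrow> (\<exists>s\<in>generators n. sat N (Q_fm n s) v)"
    unfolding disjunct_index by blast
  also have "\<dots> \<longleftrightarrow> (\<exists>(\<tau>\<^sub>0, M, As)\<in>generators n.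
    struct_quant N \<tau>\<^sub>0 M As (R_set N (map v [1..<Suc n]))
      (R_set N (map v [1..<Suc n]) # map (\<lambda>c. {c}) (map v [1..<Suc n])))"
  proof (rule bex_cong[OF refl])
    fix s :: "'u symbol set \<times> 'u struc \<times> 'u set list"
    obtain \<tau>\<^sub>0 M As where s: "s = (\<tau>\<^sub>0, M, As)" by (cases s)
    show "sat N (Q_fm n s) v \<longleftrightarrow> (case s of (\<tau>\<^sub>0, M, As) \<Rightarrow>
      struct_quant N \<tau>\<^sub>0 M As (R_set N (map v [1..<Suc n]))
        (R_set N (map v [1..<Suc n]) # map (\<lambda>c. {c}) (map v [1..<Suc n])))"
      unfolding s Q_fm_def prod.case
      by (subst sat_QStruct) (simp_all only: length_psis length_replicate def_set_psis[OF assms] def_set_phi)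
  qed
  finally show ?thesis .
qed

text \<open>From left to right, closures and \<open>E\<close> are invariant under isomorphism, so a
  piece isomorphic to a listed structure with its generators is itself generated by \<open>b\<close>
  and correctly expanded. From right to left, the closure has at most \<open>LS \<K>\<close>
  elements and can be copied onto an ordinal allowed in \<open>generated n\<close>.\<close>

lemma struct_quant_generators_iff:
  assumes N: "is_struct \<tau>' N" and b: "set b \<subseteq> univ N" "length b = n"
  shows "(\<exists>(\<tau>\<^sub>0, M, As)\<in>generators n.
    struct_quant N \<tau>\<^sub>0 M As (R_set N b) (R_set N b # map (\<lambda>c. {c}) b)) \<longleftrightarrow> closed_at N b"
    (is "?sat \<longleftrightarrow> _")
proof
  assume ?sat
  then obtain \<tau>\<^sub>0 M As where s: "(\<tau>\<^sub>0, M, As) \<in> generators n"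
    and q: "struct_quant N \<tau>\<^sub>0 M As (R_set N b) (R_set N b # map (\<lambda>c. {c}) b)" by blast
  obtain N0 g where sub: "\<forall>k<Suc n. (R_set N b # map (\<lambda>c. {c}) b) ! k \<subseteq> R_set N b"
    and N0: "substruct \<tau>\<^sub>0 N0 (reduct \<tau>\<^sub>0 N)" "univ N0 = R_set N b" "iso \<tau>\<^sub>0 g N0 M"
    and As: "\<forall>k<Suc n. g ` ((R_set N b # map (\<lambda>c. {c}) b) ! k) = As ! k"
    using q b(2) unfolding struct_quant_def by auto
  have surj: "g ` R_set N b = univ M"
    using iso_bij[OF N0(3)] N0(2) by (simp add: bij_betw_def)
  \<comment> \<open>A witness for \<open>absurd\<close> would make \<open>g\<close> map the same set
    onto the infinite \<open>L\<close> and onto the empty set.\<close>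
  have "(\<tau>\<^sub>0, M, As) \<noteq> ({}, absurd, replicate (Suc n) {})"
  proof
    assume *: "(\<tau>\<^sub>0, M, As) = ({}, absurd, replicate (Suc n) {})"
    then have "univ M = {}" using As[rule_format, of 0] surj by simp
    then show False using * infinite_LS by (simp add: absurd_def)
  qed
  then obtain M' as where M': "(M', as) \<in> generated n" "\<tau>\<^sub>0 = \<tau>'" "M = E M'"
    and As': "As = univ M' # map (\<lambda>a. {a}) as"
    using s by (auto simp: generators_def)
  have model: "M' \<in> models \<K>" and len: "length as = n" and gen: "cl M' (set as) = univ M'"
    using M' by (auto simp: generated_def)
  have bR: "set b \<subseteq> R_set N b"
  proof
    fix c assume "c \<in> set b"
    then obtain k where "k < n" "b ! k = c" using b(2) by (metis in_set_conv_nth)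
    then show "c \<in> R_set N b" using sub[rule_format, of "Suc k"] b(2) by simp
  qed
  have "map g b = as"
  proof (rule nth_equalityI)
    fix k assume "k < length (map g b)"
    then show "map g b ! k = as ! k"
      using As[rule_format, of "Suc k"] As' b(2) len by simp
  qed (simp add: b(2) len)
  then have gb: "g ` set b = set as" by (metis set_map)
  have subN: "substruct \<tau>' N0 N" using N0(1) M'(2) by (simp add: reduct_id[OF N])
  then have N0_eq: "N0 = restr (R_set N b) N" using substruct_eq_restr N0(2) by metis
  have g: "iso \<tau>' g N0 (E M')" using N0(3) M' by simp
  then have "iso \<tau> g (reduct \<tau> N0) M'"
    using iso_reduct[OF g voc_subset] by (simp add: reduct_E[OF model])
  note g_inv = iso_sym[OF this] and g_red = this
  have red: "reduct \<tau> N0 \<in> models \<K>" using iso_model[OF model g_inv] .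
  have E: "iso \<tau>' g (E (reduct \<tau> N0)) (E M')" using E_iso[OF red g_red] .
  \<comment> \<open>\<open>g\<close> is an isomorphism onto \<open>E M'\<close> from both
    structures, which have the same universe and functions; hence their relations agree as
    well.\<close>
  have "N0 = E (reduct \<tau> N0)"
  proof (rule struc_eqI)
    fix f xs
    show "fun_int N0 f xs = fun_int (E (reduct \<tau> N0)) f xs"
      using is_struct_undefined[OF iso_struct1[OF g], of f xs] by (simp add: fun_int_reduct)
    show "rel_int N0 f xs = rel_int (E (reduct \<tau> N0)) f xs"
    proof (cases "set xs \<subseteq> univ N0")
      case True
      then show ?thesis using iso_rel[OF g, of xs f] iso_rel[OF E, of xs f] by simp
    next
      case False
      then show ?thesis
        using is_struct_rel[OF iso_struct1[OF g], of f xs] is_struct_rel[OF iso_struct1[OF E], of f xs]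
        by auto
    qed
  qed simp
  moreover have "cl (reduct \<tau> N0) (set b) = R_set N b"
  proof -
    have bij: "bij_betw g (R_set N b) (univ M')" using iso_bij[OF g_red] N0(2) by simp
    have cl: "cl (reduct \<tau> N0) (set b) \<subseteq> R_set N b"
      using closure_subset[OF red, of "set b"] bR N0(2) by simp
    have "g ` cl (reduct \<tau> N0) (set b) = g ` R_set N b"
      using closure_iso[OF red g_red, of "set b"] bR N0(2) gb gen bij by (simp add: bij_betw_def)
    then show ?thesis
      using cl bij by (meson bij_betw_def inj_on_image_eq_iff subset_refl)
  qed
  ultimately show "closed_at N b"
    using substruct_closed[OF subN] N0(2) bR red unfolding closed_at_def N0_eq[symmetric] by auto
next
  assume c: "closed_at N b"
  let ?P = "R_set N b"
  have P: "?P \<subseteq> univ N" by (auto simp: R_set_def)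
  have closed: "fun_closed \<tau>' N ?P" and bP: "set b \<subseteq> ?P"
    and cl: "cl (reduct \<tau> (restr ?P N)) (set b) = ?P"
    using c by (simp_all add: closed_at_def)
  obtain M where M: "M \<in> models \<K>" "restr ?P N = E M" using c by (auto simp: closed_at_def)
  have red: "reduct \<tau> (restr ?P N) = M" using M by (simp add: reduct_E)
  have univM: "univ M = ?P" by (simp flip: red)
  have "|?P| \<le>o |L|"
    using card_closure[OF M(1), of "set b"] bP cl univM red by simp
  then obtain g a where g: "bij_betw g ?P (ords a)" "ords a \<subseteq> L"
    using ex_ords_bij[of ?P "LS \<K>"] by blast
  obtain M' where M': "univ M' = ords a" "iso \<tau> g M M'"
    using ex_iso_copy[OF struct_model[OF M(1)], of g "ords a"] g univM by auto
  have model: "M' \<in> models \<K>" using iso_model[OF M(1) M'(2)] .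
  have gP: "g ` ?P = univ M'" using g M' by (simp add: bij_betw_def)
  have "cl M' (set (map g b)) = univ M'"
    using closure_iso[OF M(1) M'(2), of "set b"] bP univM cl red gP by simp
  moreover have "set (map g b) \<subseteq> univ M'" using bP gP by auto
  ultimately have "(M', map g b) \<in> generated n"
    using model M' g b(2) by (auto simp: generated_def)
  then have s: "(\<tau>', E M', univ M' # map (\<lambda>a. {a}) (map g b)) \<in> generators n"
    by (force simp: generators_def)
  have iso: "iso \<tau>' g (restr ?P N) (E M')" using E_iso[OF M(1) M'(2)] M(2) by simp
  have sub: "substruct \<tau>' (restr ?P N) (reduct \<tau>' N)"
    using substruct_restr[OF N P closed] by (simp add: reduct_id[OF N])
  have "struct_quant N \<tau>' (E M') (univ M' # map (\<lambda>a. {a}) (map g b)) ?P (?P # map (\<lambda>c. {c}) b)"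
    unfolding struct_quant_def
  proof (intro conjI exI)
    show "\<forall>k<length (?P # map (\<lambda>c. {c}) b). (?P # map (\<lambda>c. {c}) b) ! k \<subseteq> ?P"
      using bP by (auto simp: nth_Cons split: nat.split)
    show "substruct \<tau>' (restr ?P N) (reduct \<tau>' N)" by (rule sub)
    show "iso \<tau>' g (restr ?P N) (E M')" by (rule iso)
    show "\<forall>k<length (?P # map (\<lambda>c. {c}) b).
      g ` ((?P # map (\<lambda>c. {c}) b) ! k) = (univ M' # map (\<lambda>a. {a}) (map g b)) ! k"
      using gP by (auto simp: nth_Cons split: nat.split)
  qed simp
  with s show ?sat by blast
qed

lemma sat_axiom:
  assumes N: "is_struct \<tau>' N"
  shows "sat N (axiom n) v \<longleftrightarrow> (\<forall>b. set b \<subseteq> univ N \<and> length b = n \<longrightarrow> closed_at N b)"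
proof -
  have set: "set [1..<Suc n] = {1..n}" by auto
  have mat: "sat N (matrix n) w \<longleftrightarrow> closed_at N (map w [1..<Suc n])" if "w ` {1..n} \<subseteq> univ N" for w
  proof -
    have "set (map w [1..<Suc n]) \<subseteq> univ N" using that by (simp only: set_map set)
    then show ?thesis
      unfolding sat_matrix[OF that] by (rule struct_quant_generators_iff[OF N]) simp
  qed
  have "sat N (axiom n) v \<longleftrightarrow> (\<forall>w. w ` {1..n} \<subseteq> univ N \<and> (\<forall>x. x \<notin> {1..n} \<longrightarrow> w x = v x) \<longrightarrow>
      closed_at N (map w [1..<Suc n]))"
    unfolding axiom_def sat_foldr_All set using mat by blast
  also have "\<dots> \<longleftrightarrow> (\<forall>b. set b \<subseteq> univ N \<and> length b = n \<longrightarrow> closed_at N b)" (is "?L \<longleftrightarrow> ?R")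
  proof
    assume L: ?L
    show ?R
    proof (intro allI impI, elim conjE)
      fix b assume b: "set b \<subseteq> univ N" "length b = n"
      \<comment> \<open>Parameters start at variable 1, list positions at 0.\<close>
      define w where "w x = (if x \<in> {1..n} then b ! (x - 1) else v x)" for x
      have eq: "map w [1..<Suc n] = b" using b by (intro map_upt_Suc_eq) (auto simp: w_def)
      have "w ` {1..n} = set b" by (metis eq set set_map)
      then show "closed_at N b"
        using L[rule_format, of w] b(1) unfolding eq by (simp add: w_def)
    qed
  next
    assume R: ?R
    then show ?L using set by (auto simp del: upt_Suc)
  qed
  finally show ?thesis .
qed

lemma Mod_T: "Mod \<tau>' T = E ` models \<K>"
proof
  show "Mod \<tau>' T \<subseteq> E ` models \<K>"
  proof
    fix N assume "N \<in> Mod \<tau>' T"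
    then have N: "is_struct \<tau>' N" and sat: "sat N (axiom n) v" for n v
      by (auto simp: Mod_def T_def)
    have "closed_at N b" if "set b \<subseteq> univ N" for b
      using sat[of "length b"] that unfolding sat_axiom[OF N] by blast
    then show "N \<in> E ` models \<K>" using model_if_closed_at[OF N _ regular] by blast
  qed
  show "E ` models \<K> \<subseteq> Mod \<tau>' T"
    using closed_at_E by (auto simp: Mod_def T_def E_struct sat_axiom)
qed

section \<open>The ordering of the expanded class\<close>

lemma block_axiom: "Q.block [1..<Suc n] (index_set n) (disjunct n) 0 (phi n) (replicate (Suc n) 0) (psis n)"
  unfolding Q.block_def
proof (intro conjI ballI)
  show "foldr All [1..<Suc n] (Disj (index_set n) (disjunct n)) \<in> T"
    by (auto simp: T_def axiom_def matrix_def)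
  show "index_set n \<noteq> {}" by (simp add: generators_def)
  show "\<exists>\<tau>\<^sub>0 M As. disjunct n i = QStruct \<tau>\<^sub>0 M As 0 (phi n) (replicate (Suc n) 0) (psis n)" for i
    by (cases "inv_into (generators n) (index n) i") (simp add: disjunct_def Q_fm_def)
qed (use phi_quantifier_free psis_quantifier_free in blast)+

lemma foldr_All_Disj_inject:
  "foldr All zs (Disj I F) = foldr All zs' (Disj I' F') \<longleftrightarrow> zs = zs' \<and> I = I' \<and> F = F'"
proof (induction zs arbitrary: zs')
  case Nil
  then show ?case by (cases zs') auto
next
  case (Cons z zs)
  then show ?case by (cases zs') auto
qed

text \<open>The prefix and matrix of an axiom can be read off uniquely, because a disjunction is not
  a universally quantified formula; any disjunct then reveals the shared formulas.\<close>

lemma blockD: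
  assumes "Q.block zs I F x \<phi> ys \<psi>s"
  shows "\<exists>n. x = 0 \<and> \<phi> = phi n \<and> ys = replicate (Suc n) 0 \<and> \<psi>s = psis n \<and>
    free_vars (Disj I F) = {1..n}"
proof -
  have "foldr All zs (Disj I F) \<in> T" using assms by (simp add: Q.block_def)
  then obtain n where "foldr All zs (Disj I F) = axiom n" by (auto simp: T_def)
  then have IF: "I = index_set n" "F = disjunct n"
    by (simp_all add: axiom_def matrix_def foldr_All_Disj_inject)
  obtain i where i: "i \<in> I" using assms by (auto simp: Q.block_def)
  obtain \<tau>\<^sub>0 M As where 1: "F i = QStruct \<tau>\<^sub>0 M As x \<phi> ys \<psi>s"
    using assms i unfolding Q.block_def by blast
  obtain \<tau>\<^sub>1 M' As' where 2: "F i = QStruct \<tau>\<^sub>1 M' As' 0 (phi n) (replicate (Suc n) 0) (psis n)"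
    using block_axiom[of n] i unfolding Q.block_def IF by blast
  show ?thesis
    using 1 2 free_vars_matrix[of n] unfolding matrix_def IF by (intro exI[of _ n]) simp
qed

text \<open>The equations define the same singletons in both structures, so only the R-sets remain
  to be compared.\<close>

lemma agree_iff:
  assumes MN: "univ M \<subseteq> univ N" and v: "v ` {1..n} \<subseteq> univ M"
  shows "agree M N 0 (phi n) (replicate (Suc n) 0) (psis n) v \<longleftrightarrow>
    R_set M (map v [1..<Suc n]) = R_set N (map v [1..<Suc n])"
proof -
  have "v ` {1..n} \<subseteq> univ N" using MN v by blast
  note M = def_set_psis[OF v] and N = def_set_psis[OF this]
  have "(\<forall>k<Suc n. def_set M (replicate (Suc n) 0 ! k) (psis n ! k) v =
      def_set N (replicate (Suc n) 0 ! k) (psis n ! k) v) \<longleftrightarrow>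
    map (\<lambda>k. def_set M (replicate (Suc n) 0 ! k) (psis n ! k) v) [0..<Suc n] =
    map (\<lambda>k. def_set N (replicate (Suc n) 0 ! k) (psis n ! k) v) [0..<Suc n]"
    by (simp only: map_eq_conv set_upt) auto
  then show ?thesis
    unfolding agree_def M N length_psis def_set_phi by simp
qed

text \<open>For substructures, both sides say that finite subsets of \<open>M\<close> have the same
  closure in \<open>M\<close> and \<open>N\<close>: the left one by
  \<open>strong_iff_closure\<close>, the right one by agreement of R-sets.\<close>

lemma strong_iff_elem_sub_star:
  assumes M: "M \<in> models \<K>" and N: "N \<in> models \<K>"
  shows "M \<preceq> N \<longleftrightarrow> elem_sub_star \<tau>' \<kappa> Q.frag (E M) (E N)"
proof -
  have Mod: "E M \<in> Mod \<tau>' T" "E N \<in> Mod \<tau>' T" using M N by (simp_all add: Mod_T)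
  have star: "elem_sub_star \<tau>' \<kappa> Q.frag (E M) (E N) \<longleftrightarrow> (\<forall>b. finite b \<and> b \<subseteq> univ M \<longrightarrow> cl M b = cl N b)"
    if sub: "substruct \<tau>' (E M) (E N)"
  proof -
    have MN: "univ M \<subseteq> univ N" using substruct_univ[OF sub] by simp
    have agree: "agree (E M) (E N) 0 (phi n) (replicate (Suc n) 0) (psis n) v \<longleftrightarrow>
      cl M (v ` {1..n}) = cl N (v ` {1..n})" if v: "v ` {1..n} \<subseteq> univ M" for n v
    proof -
      have set: "set (map v [1..<Suc n]) = v ` {1..n}" by auto
      then have "R_set (E M) (map v [1..<Suc n]) = cl M (v ` {1..n})"
        "R_set (E N) (map v [1..<Suc n]) = cl N (v ` {1..n})"
        using R_set_E[OF M, of "map v [1..<Suc n]"] R_set_E[OF N, of "map v [1..<Suc n]"] v MN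
        by (auto simp del: upt_Suc)
      then show ?thesis using agree_iff[of "E M" "E N" v n] v MN by simp
    qed
    show ?thesis
      unfolding Q.elem_sub_star_iff[OF Mod sub]
    proof (intro iffI allI impI; elim conjE)
      fix zs I F x \<phi> ys \<psi>s v
      assume cl: "\<forall>b. finite b \<and> b \<subseteq> univ M \<longrightarrow> cl M b = cl N b"
        and b: "Q.block zs I F x \<phi> ys \<psi>s" and v: "v ` free_vars (Disj I F) \<subseteq> univ (E M)"
      obtain n where n: "x = 0" "\<phi> = phi n" "ys = replicate (Suc n) 0" "\<psi>s = psis n"
        "free_vars (Disj I F) = {1..n}" using blockD[OF b] by blast
      have v': "v ` {1..n} \<subseteq> univ M" using v n(5) by simp
      then show "agree (E M) (E N) x \<phi> ys \<psi>s v"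
        using agree[OF v'] cl unfolding n(1-4) by blast
    next
      fix b assume A: "\<forall>zs I F x \<phi> ys \<psi>s v. Q.block zs I F x \<phi> ys \<psi>s \<and>
          v ` free_vars (Disj I F) \<subseteq> univ (E M) \<longrightarrow> agree (E M) (E N) x \<phi> ys \<psi>s v"
        and b: "finite b" "b \<subseteq> univ M"
      obtain c where c: "set c = b" using finite_list[OF b(1)] by blast
      define v where "v x = c ! (x - 1)" for x
      have v: "v ` {1..length c} = b"
      proof -
        have "map v [1..<Suc (length c)] = c"
          by (intro map_upt_Suc_eq) (auto simp: v_def)
        then have "v ` set [1..<Suc (length c)] = set c" by (metis set_map)
        then show ?thesis using c by (simp add: atLeastLessThanSuc_atLeastAtMost del: upt_Suc)
      qed
      have "v ` free_vars (Disj (index_set (length c)) (disjunct (length c))) \<subseteq> univ (E M)"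
        using free_vars_matrix[of "length c"] v b unfolding matrix_def by simp
      then have "agree (E M) (E N) 0 (phi (length c)) (replicate (Suc (length c)) 0) (psis (length c)) v"
        by (intro A[rule_format] conjI) (rule block_axiom)
      then show "cl M b = cl N b" using agree[of v "length c"] v b by simp
    qed
  qed
  show ?thesis
  proof
    assume MN: "M \<preceq> N"
    show "elem_sub_star \<tau>' \<kappa> Q.frag (E M) (E N)"
      unfolding star[OF E_substruct[OF MN]] using MN strong_iff_closure[OF M N regular] by blast
  next
    assume *: "elem_sub_star \<tau>' \<kappa> Q.frag (E M) (E N)"
    then have sub: "substruct \<tau>' (E M) (E N)" by (simp add: elem_sub_star_def elem_sub_def)
    then have "substruct \<tau> M N" using substruct_reduct[OF sub voc_subset] by (simp add: reduct_E M N)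
    then show "M \<preceq> N" using * star[OF sub] strong_iff_closure[OF M N regular] by blast
  qed
qed

lemma expansion_class_eq: "expansion_class \<K> \<tau>' (E ` models \<K>) = Mod_class \<tau>' \<kappa> Q.frag T"
proof -
  have "{(M, N). M \<in> E ` models \<K> \<and> N \<in> E ` models \<K> \<and> reduct \<tau> M \<preceq> reduct \<tau> N} =
    {(M, N). M \<in> E ` models \<K> \<and> N \<in> E ` models \<K> \<and> elem_sub_star \<tau>' \<kappa> Q.frag M N}"
    using strong_iff_elem_sub_star by (auto simp: reduct_E)
  then show ?thesis by (simp add: expansion_class_def Mod_class_def Mod_T)
qed

end

theorem corollary3p11:
  fixes \<K> :: "'u aclass"
  assumes "set_universe TYPE('u) TYPE('i)"
    and "AEC \<K>"
  shows "has_intersections \<K> \<longleftrightarrow>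
    (\<exists>\<tau>' Kp (T :: ('u, 'i) fm set).
       functorial_expansion \<K> \<tau>' Kp \<and>
       countable (\<tau>' - voc \<K>) \<and> (\<forall>s \<in> \<tau>' - voc \<K>. \<exists>r n. s = RelSym r n) \<and>
       forall_Q_theory \<tau>' (cardSuc |ords (LS \<K>)| ) T \<and>
       expansion_class \<K> \<tau>' Kp =
         Mod_class \<tau>' (cardSuc |ords (LS \<K>)| )
           (generated_fragment \<tau>' (cardSuc |ords (LS \<K>)| ) T) T)"
    (is "_ \<longleftrightarrow> ?axiomatizable")
proof
  interpret aec \<K> using assms(2) by unfold_locales
  show "has_intersections \<K>" if ?axiomatizable
    using that by (elim exE conjE) (rule has_intersections_if_forall_Q)
  assume int: "has_intersections \<K>"
  \<comment> \<open>A small vocabulary cannot use up all names, so one is left for the closure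
    relations.\<close>
  define name :: "'u symbol \<Rightarrow> 'u" where "name s = (case s of FunSym f k \<Rightarrow> f | RelSym f k \<Rightarrow> f)" for s
  have "|name ` \<tau>| <o |UNIV :: 'u set|"
    using vocabulary_voc ordLeq_ordLess_trans[OF card_of_image] unfolding vocabulary_def by blast
  then have "name ` \<tau> \<noteq> UNIV" using ordLess_irreflexive by metis
  then obtain r where "r \<notin> name ` \<tau>" by blast
  then have "RelSym r k \<notin> \<tau>" for k by (force simp: name_def)
  then interpret closure_axioms \<K> r "TYPE('i)"
    using int assms(1) by unfold_locales
  have new: "\<tau>' - \<tau> \<subseteq> range (\<lambda>n. RelSym r (Suc n))" by (auto simp: \<tau>'_def)
  then have "countable (\<tau>' - \<tau>)" by (rule countable_subset) simp
  moreover have "\<forall>s\<in>\<tau>' - \<tau>. \<exists>r n. s = RelSym r n" using new by blast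
  ultimately show ?axiomatizable
    using functorial_expansion_E[OF uncountable] forall_Q_theory_T expansion_class_eq by blast
qed

end
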